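(* Let $T>0$, let $\omega_0\in L^1(\mathbb{R}^2)$ have compact support, and in the vortex-blob approximation built from $\omega_0$ let $h=h(\varepsilon)$ be chosen as $$h(\varepsilon)=\frac{\varepsilon^4}{\exp\left(C_1\varepsilon^{-2}\|\omega_0\|_{L^1}T\right)},$$ where $C_1>0$ is a positive constant. Then the estimate $$\sup_{0\le t\le T}\|\omega^\varepsilon(t,\cdot)-\varphi_\varepsilon*\bar\omega^\varepsilon(t,\cdot)\|_{L^p(\mathbb{R}^2)}\le C\,\varepsilon^{1+\frac2p}$$ holds for all $1\le p\le\infty$ (with $2/p=0$ when $p=\infty$), where $C>0$ is a positive constant which does not depend on $\varepsilon$.
   Context: **Vortex-blob approximation.** $K(x)=\frac{1}{2\pi}\frac{(-x_2,x_1)}{|x|^2}$. Let $j$ and $\varphi$ be standard mollifiers on $\mathbb{R}^2$ (smooth, nonnegative, radial, supported in the unit ball, with integral $1$), $j_\delta(x)=\delta^{-2}j(x/\delta)$, $\varphi_\varepsilon(x)=\varepsilon^{-2}\varphi(x/\varepsilon)$. For $\varepsilon\in(0,1)$ let $\delta=\delta(\varepsilon)$, $h=h(\varepsilon)$ be parameters in $(0,1)$. Put $\omega_0^\varepsilon=\omega_0*j_{\delta(\varepsilon)}$. Let $R_1,\dots,R_{N(\varepsilon)}$ be the squares with sides of length $h$ parallel to the axes, centered at points $\alpha_i$ of the lattice $h\mathbb{Z}^2$, that tile the support of $\omega_0^\varepsilon$, and $\Gamma_i^\varepsilon=\int_{R_i}\omega_0^\varepsilon\,dx$. Put $K_\varepsilon=K*\varphi_\varepsilon$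 and let $\{X_i^\varepsilon(t)\}$ be the unique solution of the ODE system $\dot X_i^\varepsilon(t)=v^\varepsilon(t,X_i^\varepsilon(t))$, $X_i^\varepsilon(0)=\alpha_i$, where $$v^\varepsilon(t,x)=\sum_{i=1}^{N(\varepsilon)}\Gamma_i^\varepsilon K_\varepsilon(x-X_i^\varepsilon(t)),\qquad \omega^\varepsilon(t,x)=\sum_{i=1}^{N(\varepsilon)}\Gamma_i^\varepsilon\varphi_\varepsilon(x-X_i^\varepsilon(t)),$$ so $v^\varepsilon=K*\omega^\varepsilon$, and $v^\varepsilon$ is smooth, bounded and Lipschitz in $x$ for each fixed $\varepsilon$. **Auxiliary problem.** $\bar\omega^\varepsilon$ denotes the unique smooth solution of the linear transport equation $\partial_t\bar\omega^\varepsilon+v^\varepsilon\cdot\nabla\bar\omega^\varepsilon=0$ on $[0,T]\times\mathbb{R}^2$ with $\bar\omega^\varepsilon(0,\cdot)=\omega_0^\varepsilon$; equivalently $\bar\omega^\varepsilon(t,x)=\omega_0^\varepsilon((X^\varepsilon)^{-1}(t,\cdot)(x))$ with $X^\varepsilon$ the flow of $v^\varepsilon$. Convolutions are in the space variable. *)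

theory Defs
  imports "HOL-Analysis.Analysis" "HOL-Probability.Essential_Supremum"
begin

type_synonym plane = "real^2"

(* On a set S that determines its Frechet derivatives (such as UNIV or a slab {0..T} x R^2)
   this is the usual class C^k: the functions x |-> f' x v are the directional derivatives of f. *)
primrec Ck_on :: "nat \<Rightarrow> ('a::euclidean_space \<Rightarrow> 'b::real_normed_vector) \<Rightarrow> 'a set \<Rightarrow> bool" where
  "Ck_on 0 f S \<longleftrightarrow> continuous_on S f"
| "Ck_on (Suc k) f S \<longleftrightarrow>
     (\<exists>f'. (\<forall>x\<in>S. (f has_derivative f' x) (at x within S)) \<and> (\<forall>v. Ck_on k (\<lambda>x. f' x v) S))"

definition smooth_on :: "('a::euclidean_space \<Rightarrow> 'b::real_normed_vector) \<Rightarrow> 'a set \<Rightarrow> bool" where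
  "smooth_on f S \<longleftrightarrow> (\<forall>k. Ck_on k f S)"

definition fsupport :: "(plane \<Rightarrow> real) \<Rightarrow> plane set" where
  "fsupport f = closure {x. f x \<noteq> 0}"

definition conv :: "(plane \<Rightarrow> real) \<Rightarrow> (plane \<Rightarrow> 'b::{banach, second_countable_topology}) \<Rightarrow> plane \<Rightarrow> 'b" where
  "conv f g x = (LINT y|lebesgue. f (x - y) *\<^sub>R g y)"

(* The case p = \<infinity> is separate; for p < \<infinity> the value is \<infinity> if the integral of |f|^p diverges. *)
definition Lp_norm :: "ennreal \<Rightarrow> (plane \<Rightarrow> real) \<Rightarrow> ennreal" where
  "Lp_norm p f =
     (if p = \<infinity> then esssup lebesgue (\<lambda>x. ennreal \<bar>f x\<bar>)
      else let q = enn2real p; I = (\<integral>\<^sup>+ x. ennreal (\<bar>f x\<bar> powr q) \<partial>lebesgue)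
           in if I = \<infinity> then \<infinity> else ennreal (enn2real I powr (1 / q)))"

definition mollifier :: "(plane \<Rightarrow> real) \<Rightarrow> bool" where
  "mollifier \<phi> \<longleftrightarrow> smooth_on \<phi> UNIV \<and> (\<forall>x. 0 \<le> \<phi> x) \<and>
     (\<forall>x y. norm x = norm y \<longrightarrow> \<phi> x = \<phi> y) \<and>
     fsupport \<phi> \<subseteq> cball 0 1 \<and> (LINT x|lebesgue. \<phi> x) = 1"

definition rescale :: "(plane \<Rightarrow> real) \<Rightarrow> real \<Rightarrow> plane \<Rightarrow> real" where
  "rescale \<phi> \<epsilon> x = \<phi> (x /\<^sub>R \<epsilon>) / \<epsilon>\<^sup>2"

(* Biot-Savart kernel; its value at the origin (0 by the convention 1/0 = 0) is immaterial. *)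
definition K :: "plane \<Rightarrow> plane" where
  "K x = (1 / (2 * pi)) *\<^sub>R (vector [- (x $ 2), x $ 1] /\<^sub>R (norm x)\<^sup>2)"

definition lattice :: "real \<Rightarrow> plane set" where
  "lattice h = {x. \<forall>i. \<exists>k::int. x $ i = h * of_int k}"

definition square :: "real \<Rightarrow> plane \<Rightarrow> plane set" where
  "square h \<alpha> = {x. \<forall>i. \<bar>x $ i - \<alpha> $ i\<bar> \<le> h / 2}"

(* Vortices are labelled by the lattice points themselves rather than by 1, ..., N.
   The set is finite when h > 0 and w has compact support.  A closed square meeting the
   support of w only in its boundary has circulation 0 and contributes nothing. *)
definition centers :: "real \<Rightarrow> (plane \<Rightarrow> real) \<Rightarrow> plane set" where
  "centers h w = {\<alpha> \<in> lattice h. square h \<alpha> \<inter> fsupport w \<noteq> {}}"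

definition circulation :: "real \<Rightarrow> (plane \<Rightarrow> real) \<Rightarrow> plane \<Rightarrow> real" where
  "circulation h w \<alpha> = (LINT y:square h \<alpha>|lebesgue. w y)"

(* In the following, w is the mollified initial vorticity and X \<alpha> t the position at time t
   of the vortex that starts at \<alpha>. *)

definition blob_velocity ::
  "(plane \<Rightarrow> real) \<Rightarrow> real \<Rightarrow> real \<Rightarrow> (plane \<Rightarrow> real) \<Rightarrow> (plane \<Rightarrow> real \<Rightarrow> plane) \<Rightarrow> real \<Rightarrow> plane \<Rightarrow> plane" where
  "blob_velocity \<phi> \<epsilon> h w X t x =
     (\<Sum>\<alpha>\<in>centers h w. circulation h w \<alpha> *\<^sub>R conv (rescale \<phi> \<epsilon>) K (x - X \<alpha> t))"

definition blob_vorticity ::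
  "(plane \<Rightarrow> real) \<Rightarrow> real \<Rightarrow> real \<Rightarrow> (plane \<Rightarrow> real) \<Rightarrow> (plane \<Rightarrow> real \<Rightarrow> plane) \<Rightarrow> real \<Rightarrow> plane \<Rightarrow> real" where
  "blob_vorticity \<phi> \<epsilon> h w X t x =
     (\<Sum>\<alpha>\<in>centers h w. circulation h w \<alpha> * rescale \<phi> \<epsilon> (x - X \<alpha> t))"

definition blob_trajectories ::
  "(plane \<Rightarrow> real) \<Rightarrow> real \<Rightarrow> real \<Rightarrow> (plane \<Rightarrow> real) \<Rightarrow> real \<Rightarrow> (plane \<Rightarrow> real \<Rightarrow> plane) \<Rightarrow> bool" where
  "blob_trajectories \<phi> \<epsilon> h w T X \<longleftrightarrow>
     (\<forall>\<alpha>\<in>centers h w. X \<alpha> 0 = \<alpha> \<and>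
        (\<forall>t\<in>{0..T}. (X \<alpha> has_vector_derivative blob_velocity \<phi> \<epsilon> h w X t (X \<alpha> t)) (at t within {0..T})))"

definition transport_solution ::
  "real \<Rightarrow> (real \<Rightarrow> plane \<Rightarrow> plane) \<Rightarrow> (plane \<Rightarrow> real) \<Rightarrow> (real \<Rightarrow> plane \<Rightarrow> real) \<Rightarrow> bool" where
  "transport_solution T v w u \<longleftrightarrow>
     smooth_on (\<lambda>(t, x). u t x) ({0..T} \<times> UNIV) \<and>
     (\<forall>x. u 0 x = w x) \<and>
     (\<forall>t\<in>{0..T}. \<forall>x. \<exists>a g.
        ((\<lambda>s. u s x) has_real_derivative a) (at t within {0..T}) \<and>
        (GDERIV (u t) x :> g) \<and> a + v t x \<bullet> g = 0)"

end

(* The error at time t is the integral of w y (phi_eps (x - X (a y)) - phi_eps (x - X y)) over y, where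
   X is the flow of the blob velocity at time t, w the mollified initial vorticity and a y the lattice
   point whose square contains y; for the term with X y one uses that the flow of the divergence-free
   blob velocity preserves area and transports w.  Hence everything follows, with an interpolation
   between L^1 and L^infinity, from |X (a y) - X y| <= C eps^4.

   The direct Lipschitz bound c eps^-2 |w|_1 on the velocity only gives this when C_1 is large.  For
   arbitrary C_1 > 0 one uses that the mollified vorticities are equi-integrable: as long as
   |X (a y) - X y| <= eps, a ball of radius A eps contains little circulation, by area preservation,
   and the remaining vortices contribute only O(A^-2 eps^-2) to the velocity gradient.  So particle
   distances grow at a rate below C_1 |omega_0|_1 eps^-2 for small eps, and a continuation argument
   keeps |X (a y) - X y| <= h exp (C_1 |omega_0|_1 T eps^-2) = eps^4 < eps up to time T. *)

theory Submission
  imports Defs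
begin

section \<open>Flows of bounded Lipschitz fields\<close>

text \<open>Area preservation would follow from Liouville's formula, but that needs
  differentiability of the flow in its starting point. Here the flow is approached by Euler polygons
  instead: one step x + \<tau> v(s, x) is an explicit bijection whose Jacobian is 1 up to a multiple
  of (\<tau> L)^2 because the trace of the derivative vanishes, so n steps of length t/n change
  integrals by a factor 1 + O(1/n). The factor \<epsilon>^4 in h is dictated by the blobs:
  \<open>rescale \<phi> \<epsilon>\<close> has a Lipschitz constant of order \<epsilon>^-3, so a
  displacement of order \<epsilon>^4 changes a blob by order \<epsilon> in the supremum norm and, on
  two discs of area of order \<epsilon>^2, by order \<epsilon>^3 in L^1. Interpolation then gives
  precisely the exponent 1 + 2/p. The vortices solve an ODE whose field they generate. With the
  trajectories given, the velocity is a known bounded Lipschitz field and the vortices are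
  particular orbits of its flow. The scales split: below some \<epsilon>_0 the small growth rate
  applies, from \<epsilon>_0 on the crude growth factor is bounded by its value at
  \<epsilon>_0.\<close>

locale lipschitz_field =
  fixes v :: "real \<Rightarrow> 'a::euclidean_space \<Rightarrow> 'a" and T L V :: real
  assumes T_pos: "0 < T" and L_pos: "0 < L"
    and cont: "continuous_on ({0..T} \<times> UNIV) (\<lambda>(t, x). v t x)"
    and bound: "\<And>t x. t \<in> {0..T} \<Longrightarrow> norm (v t x) \<le> V"
    and lip: "\<And>t x y. t \<in> {0..T} \<Longrightarrow> norm (v t x - v t y) \<le> L * norm (x - y)"
begin

lemma V_nonneg: "0 \<le> V"
  using order_trans[OF norm_ge_zero bound[of 0 0]] T_pos by simp

lemma continuous_along:
  assumes "continuous_on S x" "S \<subseteq> {0..T}"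
  shows "continuous_on S (\<lambda>s. v s (x s))"
proof -
  have "continuous_on S ((\<lambda>(t, x). v t x) \<circ> (\<lambda>s. (s, x s)))"
    by (rule continuous_on_compose[OF _ continuous_on_subset[OF cont]])
       (use assms in \<open>auto intro!: continuous_intros\<close>)
  then show ?thesis by (simp add: o_def)
qed

section \<open>Existence and uniqueness of trajectories on the whole time interval\<close>

definition solution :: "'a \<Rightarrow> (real \<Rightarrow> 'a) \<Rightarrow> bool" where
  "solution y x \<longleftrightarrow> x 0 = y \<and>
     (\<forall>t\<in>{0..T}. (x has_vector_derivative v t (x t)) (at t within {0..T}))"

text \<open>Picard iteration with a weight: for \<open>x t = exp (2 * L * t) *\<^sub>R z t\<close>
  the integral operator contracts by 1/2 in the supremum norm of \<open>z\<close> on all of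
  \<open>{0..T}\<close>, whatever the size of \<open>L * T\<close>. No local solutions have to be
  glued.\<close>

lemma solution_exists: "\<exists>x. solution y x"
proof -
  \<comment> \<open>Clamping time to \<open>{0..T}\<close> extends every iterate to a bounded
    continuous function on the real line, so the complete space
    \<open>real \<Rightarrow>\<^sub>C 'a\<close> can host the fixed point.\<close>
  define c where "c t = max 0 (min T t)" for t :: real
  have c01: "c t \<in> {0..T}" for t using T_pos by (auto simp: c_def)
  have c_cont: "continuous_on UNIV c" unfolding c_def by (intro continuous_intros)
  define I where "I z t = integral {0..t} (\<lambda>s. v s (exp (2 * L * s) *\<^sub>R apply_bcontfun z s))"
    for z :: "real \<Rightarrow>\<^sub>C 'a" and t
  define G where "G z t = exp (- (2 * L * c t)) *\<^sub>R (y + I z (c t))" for z t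
  have cz: "continuous_on {0..T} (\<lambda>s. v s (exp (2 * L * s) *\<^sub>R apply_bcontfun z s))" for z
    by (intro continuous_along continuous_intros order_refl) auto
  have iz: "(\<lambda>s. v s (exp (2 * L * s) *\<^sub>R apply_bcontfun z s)) integrable_on {0..t}"
    if "t \<in> {0..T}" for z t
    using integrable_continuous_real[OF cz] that
    by (meson atLeastAtMost_iff atLeastatMost_subset_iff integrable_on_subinterval order_refl)
  have Icont: "continuous_on {0..T} (I z)" for z
    unfolding I_def using indefinite_integral_continuous_1[OF iz[of T]] T_pos by simp
  have Gcont: "continuous_on UNIV (G z)" for z
  proof -
    have "continuous_on UNIV (\<lambda>t. I z (c t))"
      by (rule continuous_on_compose2[OF Icont c_cont]) (use c01 in auto)
    then show ?thesis unfolding G_def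
      by (intro continuous_intros c_cont)
  qed
  have Gbd: "norm (G z t) \<le> norm y + V * T" for z t
  proof -
    have "norm (I z (c t)) \<le> V * (c t - 0)"
      unfolding I_def
      by (rule integral_bound) (use c01[of t] cz[of z] bound in \<open>auto intro: continuous_on_subset\<close>)
    also have "\<dots> \<le> V * T" using c01[of t] V_nonneg by (auto intro: mult_left_mono)
    finally have "norm (y + I z (c t)) \<le> norm y + V * T"
      using norm_triangle_ineq[of y "I z (c t)"] by linarith
    moreover have "exp (- (2 * L * c t)) \<le> 1" using c01[of t] L_pos by auto
    ultimately have "exp (- (2 * L * c t)) * norm (y + I z (c t)) \<le> 1 * (norm y + V * T)"
      by (intro mult_mono) auto
    then show ?thesis unfolding G_def by simp
  qed
  have Gb: "G z \<in> bcontfun" for z using bcontfun_normI[OF Gcont Gbd] .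
  define F where "F z = Bcontfun (G z)" for z
  have F: "apply_bcontfun (F z) = G z" for z unfolding F_def using Gb by (simp add: Bcontfun_inverse)
  have contr: "dist (F z) (F z') \<le> 1/2 * dist z z'" for z z'
  proof (rule dist_bound)
    fix t
    let ?\<tau> = "c t" let ?d = "dist z z'"
    have tau: "?\<tau> \<in> {0..T}" by (rule c01)
    \<comment> \<open>The factor 1/2 of the contraction: \<open>L * exp (2 * L * s)\<close>
      integrates to at most \<open>exp (2 * L * c t) / 2\<close>, and the damping in
      \<open>G\<close> cancels the exponential.\<close>
    have hi: "((\<lambda>s. L * exp (2 * L * s) * ?d) has_integral
        (exp (2 * L * ?\<tau>) / 2 * ?d - exp (2 * L * 0) / 2 * ?d)) {0..?\<tau>}"
      by (rule fundamental_theorem_of_calculus)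
         (use tau L_pos in \<open>auto intro!: derivative_eq_intros simp flip: has_real_derivative_iff_has_vector_derivative\<close>)
    have "norm (I z ?\<tau> - I z' ?\<tau>) =
        norm (integral {0..?\<tau>} (\<lambda>s. v s (exp (2 * L * s) *\<^sub>R apply_bcontfun z s)
            - v s (exp (2 * L * s) *\<^sub>R apply_bcontfun z' s)))"
      unfolding I_def by (subst Henstock_Kurzweil_Integration.integral_diff[OF iz iz]) (use tau in auto)
    also have "\<dots> \<le> integral {0..?\<tau>} (\<lambda>s. L * exp (2 * L * s) * ?d)"
    proof (rule integral_norm_bound_integral)
      show "(\<lambda>s. v s (exp (2 * L * s) *\<^sub>R apply_bcontfun z s)
            - v s (exp (2 * L * s) *\<^sub>R apply_bcontfun z' s)) integrable_on {0..?\<tau>}"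
        by (intro Henstock_Kurzweil_Integration.integrable_diff iz tau)
      show "(\<lambda>s. L * exp (2 * L * s) * ?d) integrable_on {0..?\<tau>}" using hi by blast
      fix s assume s: "s \<in> {0..?\<tau>}"
      have "norm (v s (exp (2 * L * s) *\<^sub>R apply_bcontfun z s) - v s (exp (2 * L * s) *\<^sub>R apply_bcontfun z' s))
        \<le> L * norm (exp (2 * L * s) *\<^sub>R apply_bcontfun z s - exp (2 * L * s) *\<^sub>R apply_bcontfun z' s)"
        by (rule lip) (use s tau in auto)
      also have "\<dots> = L * (exp (2 * L * s) * dist (apply_bcontfun z s) (apply_bcontfun z' s))"
        by (simp add: dist_norm flip: scaleR_diff_right)
      also have "\<dots> \<le> L * (exp (2 * L * s) * ?d)"
        using L_pos by (intro mult_left_mono dist_bounded) auto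
      finally show "norm (v s (exp (2 * L * s) *\<^sub>R apply_bcontfun z s) - v s (exp (2 * L * s) *\<^sub>R apply_bcontfun z' s))
        \<le> L * exp (2 * L * s) * ?d" by (simp add: mult.assoc)
    qed
    also have "\<dots> = (exp (2 * L * ?\<tau>) - 1) / 2 * ?d"
      using integral_unique[OF hi] by (simp add: field_simps)
    also have "\<dots> \<le> exp (2 * L * ?\<tau>) / 2 * ?d" by (intro mult_right_mono) auto
    finally have "norm (I z ?\<tau> - I z' ?\<tau>) \<le> exp (2 * L * ?\<tau>) / 2 * ?d" .
    then have "exp (- (2 * L * ?\<tau>)) * norm (I z ?\<tau> - I z' ?\<tau>)
        \<le> exp (- (2 * L * ?\<tau>)) * (exp (2 * L * ?\<tau>) / 2 * ?d)" by (intro mult_left_mono) auto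
    also have "\<dots> = 1/2 * ?d" by (simp add: exp_minus)
    finally show "dist (apply_bcontfun (F z) t) (apply_bcontfun (F z') t) \<le> 1/2 * ?d"
      unfolding F G_def dist_norm by (simp flip: scaleR_diff_right)
  qed
  obtain z where z: "F z = z" using banach_fix_type[of "1/2" F] contr by auto
  define x where "x t = exp (2 * L * t) *\<^sub>R apply_bcontfun z t" for t
  have Iz: "I z t = integral {0..t} (\<lambda>s. v s (x s))" for t by (simp add: I_def x_def)
  have xt: "x t = y + integral {0..t} (\<lambda>s. v s (x s))" if "t \<in> {0..T}" for t
  proof -
    have "c t = t" using that by (auto simp: c_def)
    then have "apply_bcontfun z t = exp (- (2 * L * t)) *\<^sub>R (y + I z t)"
      using F[of z] z unfolding G_def by metis
    then show ?thesis unfolding Iz[symmetric] by (simp add: x_def exp_minus)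
  qed
  have "(x has_vector_derivative v t (x t)) (at t within {0..T})" if t: "t \<in> {0..T}" for t
  proof -
    have "((\<lambda>t. y + integral {0..t} (\<lambda>s. v s (x s))) has_vector_derivative 0 + v t (x t)) (at t within {0..T})"
      by (intro has_vector_derivative_add has_vector_derivative_const integral_has_vector_derivative t)
         (use cz[of z] in \<open>simp add: x_def\<close>)
    then have "((\<lambda>t. y + integral {0..t} (\<lambda>s. v s (x s))) has_vector_derivative v t (x t)) (at t within {0..T})"
      by simp
    then show ?thesis
      using has_vector_derivative_transform[OF t, of x "\<lambda>t. y + integral {0..t} (\<lambda>s. v s (x s))"] xt by blast
  qed
  moreover have "x 0 = y" using xt[of 0] T_pos by simp
  ultimately show ?thesis unfolding solution_def by blast
qed

lemma solution_continuous: "solution y x \<Longrightarrow> continuous_on {0..T} x"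
  unfolding solution_def by (rule continuous_on_vector_derivative[of "{0..T}"]) blast

text \<open>The squared distance of two solutions, damped by \<open>exp (- 2 l t)\<close>, is nonincreasing.\<close>

lemma solution_distance:
  assumes x: "solution y x" and x': "solution y' x'" and t: "t \<in> {0..T}"
    and l: "\<And>s. s \<in> {0..t} \<Longrightarrow> norm (v s (x s) - v s (x' s)) \<le> l * norm (x s - x' s)"
  shows "norm (x t - x' t) \<le> exp (l * t) * norm (y - y')"
proof -
  \<comment> \<open>The squared norm stays differentiable where the trajectories meet. The constant
    \<open>l\<close> is only required along the two trajectories up to time \<open>t\<close>, which
    is what the bootstrap below can supply.\<close>
  define d where "d s = exp (- 2 * l * s) * ((x s - x' s) \<bullet> (x s - x' s))" for s
  define d' where "d' s = exp (- 2 * l * s) * (2 * ((x s - x' s) \<bullet> (v s (x s) - v s (x' s)))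
      - 2 * l * ((x s - x' s) \<bullet> (x s - x' s)))" for s
  have der: "(d has_real_derivative d' s) (at s within {0..t})" if "s \<in> {0..t}" for s
  proof -
    have xs: "(x has_vector_derivative v s (x s)) (at s within {0..t})"
      "(x' has_vector_derivative v s (x' s)) (at s within {0..t})"
      using x x' that t unfolding solution_def
      by (auto intro: has_vector_derivative_within_subset[where S = "{0..T}"])
    have xd: "((\<lambda>s. x s - x' s) has_vector_derivative (v s (x s) - v s (x' s))) (at s within {0..t})"
      by (intro has_vector_derivative_diff xs)
    have "((\<lambda>s. (x s - x' s) \<bullet> (x s - x' s)) has_real_derivative
       (2 * ((x s - x' s) \<bullet> (v s (x s) - v s (x' s))))) (at s within {0..t})"
      unfolding has_field_derivative_def
      using has_derivative_inner[OF xd[unfolded has_vector_derivative_def] xd[unfolded has_vector_derivative_def]]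
      by (rule has_derivative_eq_rhs) (auto simp: inner_commute algebra_simps fun_eq_iff)
    moreover have "((\<lambda>s. exp (- 2 * l * s)) has_real_derivative exp (- 2 * l * s) * (- 2 * l)) (at s within {0..t})"
      by (auto intro!: derivative_eq_intros)
    ultimately have "((\<lambda>s. exp (- 2 * l * s) * ((x s - x' s) \<bullet> (x s - x' s))) has_real_derivative
       exp (- 2 * l * s) * (- 2 * l) * ((x s - x' s) \<bullet> (x s - x' s))
       + 2 * ((x s - x' s) \<bullet> (v s (x s) - v s (x' s))) * exp (- 2 * l * s)) (at s within {0..t})"
      by (rule DERIV_mult[rotated])
    then show ?thesis unfolding d_def d'_def
      by (rule DERIV_cong) (simp add: algebra_simps)
  qed
  have neg: "d' s \<le> 0" if "s \<in> {0..t}" for s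
  proof -
    have "(x s - x' s) \<bullet> (v s (x s) - v s (x' s)) \<le> norm (x s - x' s) * norm (v s (x s) - v s (x' s))"
      by (rule norm_cauchy_schwarz)
    also have "\<dots> \<le> norm (x s - x' s) * (l * norm (x s - x' s))"
      by (intro mult_left_mono l that) auto
    also have "\<dots> = l * ((x s - x' s) \<bullet> (x s - x' s))"
      by (simp add: power2_norm_eq_inner[symmetric] power2_eq_square)
    finally show ?thesis unfolding d'_def by (auto simp: mult_le_0_iff)
  qed
  have "d t \<le> d 0"
  proof (cases "t = 0")
    case False
    then have "0 < t" using t by auto
    then obtain s where "s \<in> {0<..<t}" "d t - d 0 = (t - 0) * d' s"
      using mvt_simple[of 0 t d "\<lambda>s. (*) (d' s)"] der unfolding has_field_derivative_def
      by (auto simp: mult.commute intro: has_derivative_subset)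
    then show ?thesis using neg[of s] \<open>0 < t\<close>
      by (auto simp: mult_le_0_iff) (smt (verit) mult_nonneg_nonpos)
  qed simp
  then have "exp (- 2 * l * t) * (norm (x t - x' t))\<^sup>2 \<le> (norm (y - y'))\<^sup>2"
    using x x' by (simp add: d_def solution_def power2_norm_eq_inner)
  then have "exp (2 * l * t) * (exp (- 2 * l * t) * (norm (x t - x' t))\<^sup>2)
     \<le> exp (2 * l * t) * (norm (y - y'))\<^sup>2" by (intro mult_left_mono) auto
  then have "(norm (x t - x' t))\<^sup>2 \<le> (exp (l * t) * norm (y - y'))\<^sup>2"
    by (simp add: power_mult_distrib exp_double[symmetric] mult.assoc flip: mult.assoc[of "exp _" "exp _"] exp_add)
  then show ?thesis by (rule power2_le_imp_le) auto
qed

lemma solution_unique: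
  "solution y x \<Longrightarrow> solution y x' \<Longrightarrow> t \<in> {0..T} \<Longrightarrow> x t = x' t"
  using solution_distance[of y x y x' t L] lip by auto

text \<open>Solutions are determined on \<open>{0..T}\<close> only; at other times the chosen
  function is arbitrary, so statements about \<open>flow y t\<close> carry
  \<open>t \<in> {0..T}\<close>.\<close>

definition flow :: "'a \<Rightarrow> real \<Rightarrow> 'a" where "flow y = (SOME x. solution y x)"

lemma flow_solution: "solution y (flow y)"
  unfolding flow_def using solution_exists by (rule someI_ex)

lemma flow_0 [simp]: "flow y 0 = y"
  using flow_solution by (auto simp: solution_def)

lemma flow_deriv:
  "t \<in> {0..T} \<Longrightarrow> (flow y has_vector_derivative v t (flow y t)) (at t within {0..T})"
  using flow_solution by (auto simp: solution_def)

lemma flow_continuous: "continuous_on {0..T} (flow y)"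
  using flow_solution solution_continuous by blast

lemma flow_lipschitz:
  "t \<in> {0..T} \<Longrightarrow> norm (flow y t - flow z t) \<le> exp (L * t) * norm (y - z)"
  using solution_distance[OF flow_solution flow_solution, of t y z L] lip by auto

lemma continuous_flow_initial:
  assumes "t \<in> {0..T}" shows "continuous_on UNIV (\<lambda>y. flow y t)"
proof -
  have "(exp (L * t))-lipschitz_on UNIV (\<lambda>y. flow y t)"
    by (rule lipschitz_onI) (use flow_lipschitz[OF assms] in \<open>auto simp: dist_norm\<close>)
  then show ?thesis by (rule lipschitz_on_continuous_on)
qed

lemma flow_speed:
  assumes "0 \<le> s" "s \<le> t" "t \<le> T"
  shows "norm (flow y t - flow y s) \<le> V * (t - s)"
proof -
  have "norm (flow y t - flow y s) \<le> V * norm (t - s)"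
  proof (rule differentiable_bound)
    show "convex {s..t}" by simp
    fix r assume "r \<in> {s..t}"
    then have r: "r \<in> {0..T}" using assms by auto
    show "(flow y has_derivative (\<lambda>h. h *\<^sub>R v r (flow y r))) (at r within {s..t})"
      using flow_deriv[OF r, of y] assms unfolding has_vector_derivative_def
      by (auto intro: has_derivative_subset)
    show "onorm (\<lambda>h. h *\<^sub>R v r (flow y r)) \<le> V"
      by (rule onorm_le) (use bound[OF r, of "flow y r"] in
          \<open>simp add: mult.commute[of V] mult_left_mono\<close>)
  qed (use assms in auto)
  then show ?thesis using assms by simp
qed

text \<open>A Lipschitz bound that is only available as long as the trajectories in question stay
  \<open>\<rho>\<close>-close propagates over the whole interval: since speeds are bounded by \<open>V\<close>, closeness persists
  over time steps of fixed length.\<close>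

lemma flow_bootstrap:
  assumes A: "\<And>y z. (y, z) \<in> A \<Longrightarrow> norm (y - z) \<le> r"
    and r: "r * exp (l * T) < \<rho>" "0 \<le> r" and l: "0 \<le> l"
    and step: "\<And>s y z. s \<in> {0..T} \<Longrightarrow> (\<And>y z. (y, z) \<in> A \<Longrightarrow> norm (flow y s - flow z s) \<le> \<rho>) \<Longrightarrow>
        (y, z) \<in> A \<Longrightarrow> norm (v s (flow y s) - v s (flow z s)) \<le> l * norm (flow y s - flow z s)"
    and t: "t \<in> {0..T}" and yz: "(y, z) \<in> A"
  shows "norm (flow y t - flow z t) \<le> r * exp (l * T)"
proof -
  define close where
    "close t \<longleftrightarrow> (\<forall>s\<in>{0..t}. \<forall>(y, z)\<in>A. norm (flow y s - flow z s) \<le> \<rho>)" for t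
  have est: "norm (flow y s - flow z s) \<le> r * exp (l * T)"
    if "close s" "s \<in> {0..T}" "(y, z) \<in> A" for s y z
  proof -
    have "norm (flow y s - flow z s) \<le> exp (l * s) * norm (y - z)"
    proof (rule solution_distance[OF flow_solution flow_solution \<open>s \<in> {0..T}\<close>])
      fix q assume q: "q \<in> {0..s}"
      show "norm (v q (flow y q) - v q (flow z q)) \<le> l * norm (flow y q - flow z q)"
        by (rule step[OF _ _ \<open>(y, z) \<in> A\<close>]) (use q that(1,2) in \<open>auto simp: close_def\<close>)
    qed
    also have "\<dots> \<le> exp (l * T) * r"
      by (intro mult_mono A) (use that l r in \<open>auto intro: mult_left_mono\<close>)
    finally show ?thesis by (simp add: mult.commute)
  qed
  \<comment> \<open>In time \<open>\<tau>\<close> two particles change their distance by at most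
    \<open>2 * V * \<tau>\<close>, which fits into the gap between \<open>r * exp (l * T)\<close>
    and \<open>\<rho>\<close>. The added 1 covers \<open>V = 0\<close>.\<close>
  define \<tau> where "\<tau> = (\<rho> - r * exp (l * T)) / (2 * V + 1)"
  have \<tau>: "0 < \<tau>" unfolding \<tau>_def using r V_nonneg by auto
  have V\<tau>: "2 * V * \<tau> \<le> \<rho> - r * exp (l * T)"
  proof -
    have "2 * V * \<tau> \<le> (2 * V + 1) * \<tau>" using \<tau> by (auto intro: mult_right_mono)
    also have "\<dots> = \<rho> - r * exp (l * T)" unfolding \<tau>_def using V_nonneg by simp
    finally show ?thesis .
  qed
  have ext: "close (min T (a + \<tau>))" if a: "close a" "a \<in> {0..T}" for a
    unfolding close_def
  proof (intro ballI, clarify)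
    fix s y z assume s: "s \<in> {0..min T (a + \<tau>)}" and yz: "(y, z) \<in> A"
    show "norm (flow y s - flow z s) \<le> \<rho>"
    proof (cases "s \<le> a")
      case True then show ?thesis using a s yz unfolding close_def by auto
    next
      case False
      have 1: "norm (flow y' s - flow y' a) \<le> V * \<tau>" for y'
      proof -
        have "norm (flow y' s - flow y' a) \<le> V * (s - a)" by (rule flow_speed) (use False s a in auto)
        also have "\<dots> \<le> V * \<tau>" using s V_nonneg by (auto intro: mult_left_mono)
        finally show ?thesis .
      qed
      have "norm (flow y s - flow z s) = norm ((flow y s - flow y a) + (flow y a - flow z a) - (flow z s - flow z a))"
        by simp
      also have "\<dots> \<le> norm (flow y s - flow y a) + norm (flow y a - flow z a) + norm (flow z s - flow z a)"
        by (intro order_trans[OF norm_triangle_ineq4] add_mono norm_triangle_ineq order_refl)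
      also have "\<dots> \<le> V * \<tau> + r * exp (l * T) + V * \<tau>" by (intro add_mono 1 est a yz)
      also have "\<dots> \<le> \<rho>" using V\<tau> by simp
      finally show ?thesis .
    qed
  qed
  have cl: "close (min T (real n * \<tau>))" for n
  proof (induction n)
    case 0
    have "norm (y - z) \<le> \<rho>" if "(y, z) \<in> A" for y z
    proof -
      have "norm (y - z) \<le> r * exp (l * T)"
        using A[OF that] r(2) l T_pos mult_left_mono[of 1 "exp (l * T)" r] by simp
      then show ?thesis using r by simp
    qed
    then show ?case using T_pos by (auto simp: close_def)
  next
    case (Suc n)
    have "close (min T (min T (real n * \<tau>) + \<tau>))" by (rule ext[OF Suc]) (use \<tau> T_pos in auto)
    moreover have "min T (min T (real n * \<tau>) + \<tau>) = min T (real (Suc n) * \<tau>)"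
      using \<tau> by (auto simp: min_def algebra_simps)
    ultimately show ?case by simp
  qed
  obtain n where "T < real n * \<tau>" using reals_Archimedean3[OF \<tau>] by blast
  then have "close T" using cl[of n] by simp
  then have "close t" using t by (auto simp: close_def)
  then show ?thesis by (rule est[OF _ t yz])
qed

end

section \<open>Area preservation\<close>

text \<open>Continuous functions of compact support; the radius formulation survives composition
  with maps of bounded displacement such as Euler steps and flows.\<close>

definition test_fun :: "(plane \<Rightarrow> real) \<Rightarrow> bool" where
  "test_fun f \<longleftrightarrow> continuous_on UNIV f \<and> (\<exists>R. \<forall>x. R < norm x \<longrightarrow> f x = 0)"

lemma test_fun_integrable:
  assumes "test_fun f" shows "integrable lborel f"
proof -
  obtain R where f: "continuous_on UNIV f" "\<And>x. R < norm x \<Longrightarrow> f x = 0"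
    using assms unfolding test_fun_def by blast
  have "integrable lborel (\<lambda>x. indicator (cball 0 R) x *\<^sub>R f x)"
    by (rule borel_integrable_compact) (use f in \<open>auto intro: continuous_on_subset\<close>)
  also have "(\<lambda>x. indicator (cball 0 R) x *\<^sub>R f x) = f"
    using f(2) by (auto simp: fun_eq_iff indicator_def not_le)
  finally show ?thesis .
qed

lemma test_fun_bounded:
  assumes "test_fun f" obtains B where "\<And>x. \<bar>f x\<bar> \<le> B" "0 \<le> B"
proof -
  obtain R where f: "continuous_on UNIV f" "\<And>x. R < norm x \<Longrightarrow> f x = 0"
    using assms unfolding test_fun_def by blast
  have "compact (f ` cball 0 R)"
    by (rule compact_continuous_image) (use f in \<open>auto intro: continuous_on_subset\<close>)
  then obtain B where B: "\<And>x. x \<in> cball 0 R \<Longrightarrow> \<bar>f x\<bar> \<le> B"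
    by (meson bounded_real compact_imp_bounded imageI)
  show ?thesis
  proof (rule that[of "max B 0"])
    show "\<bar>f x\<bar> \<le> max B 0" for x using B[of x] f(2)[of x] by (cases "norm x \<le> R") auto
  qed auto
qed

lemma test_fun_compose:
  assumes "test_fun f" "continuous_on UNIV S" "\<And>x. norm (S x - x) \<le> c"
  shows "test_fun (\<lambda>x. f (S x))"
proof -
  obtain R where f: "continuous_on UNIV f" "\<And>x. R < norm x \<Longrightarrow> f x = 0"
    using assms(1) unfolding test_fun_def by blast
  have "f (S x) = 0" if "R + c < norm x" for x
    using f(2)[of "S x"] that assms(3)[of x] norm_triangle_sub[of x "S x"] norm_minus_commute[of x "S x"]
    by force
  moreover have "continuous_on UNIV (\<lambda>x. f (S x))"
    by (rule continuous_on_compose2[OF f(1) assms(2)]) auto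
  ultimately show ?thesis unfolding test_fun_def by blast
qed

section \<open>One explicit step along a trace-free Lipschitz field\<close>

lemma has_derivative_bound_of_lipschitz:
  fixes f :: "'a::real_normed_vector \<Rightarrow> 'b::real_normed_vector"
  assumes D: "(f has_derivative D) (at x)" and lip: "\<And>y. norm (f y - f x) \<le> L * norm (y - x)"
  shows "norm (D h) \<le> L * norm h"
proof -
  interpret D: bounded_linear D using D by (rule has_derivative_bounded_linear)
  show ?thesis
  proof (cases "h = 0")
    case False
    have "norm (D h) / norm h \<le> L + e" if "0 < e" for e
    proof -
      obtain d where d: "0 < d" "\<And>y. norm (y - x) < d \<Longrightarrow> norm (f y - f x - D (y - x)) \<le> e * norm (y - x)"
        using D \<open>0 < e\<close> unfolding has_derivative_at_alt by blast
      define k where "k = (d / (2 * norm h)) *\<^sub>R h"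
      have k: "norm k = d / 2" using False d by (simp add: k_def)
      have "norm (D k) \<le> norm (f (x + k) - f x) + norm (f (x + k) - f x - D k)"
        using norm_triangle_sub[of "D k" "f (x + k) - f x"] by (simp add: norm_minus_commute)
      also have "\<dots> \<le> L * norm k + e * norm k"
        using d(2)[of "x + k"] lip[of "x + k"] k d(1) by (intro add_mono) auto
      finally have "norm (D k) \<le> (L + e) * norm k" by (simp add: algebra_simps)
      then have "norm (D k) / norm k \<le> L + e" using k d(1) by (subst pos_divide_le_eq) auto
      moreover have "norm (D k) / norm k = norm (D h) / norm h"
        using False d(1) by (simp add: k_def D.scaleR)
      ultimately show ?thesis by simp
    qed
    then have "norm (D h) / norm h \<le> L" by (rule field_le_epsilon)
    then show ?thesis using False by (simp add: field_simps)
  qed (simp add: D.zero)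
qed

text \<open>For a trace-free derivative the first-order term of \<open>det (I + \<tau> D)\<close> vanishes.\<close>

lemma det_perturbed_identity:
  fixes D :: "plane \<Rightarrow> plane"
  assumes D: "linear D" and bnd: "\<And>h. norm (D h) \<le> L * norm h" and tr: "trace (matrix D) = 0" and L: "0 \<le> L"
  shows "\<bar>det (matrix (\<lambda>h. h + \<tau> *\<^sub>R D h)) - 1\<bar> \<le> 2 * (\<tau> * L)\<^sup>2"
proof -
  define d where "d i j = D (axis j 1) $ i" for i j :: 2
  have d: "\<bar>d i j\<bar> \<le> L" for i j
  proof -
    have "\<bar>d i j\<bar> \<le> norm (D (axis j 1))" unfolding d_def by (rule component_le_norm_cart)
    also have "\<dots> \<le> L" using bnd[of "axis j 1"] by (simp add: norm_axis_1)
    finally show ?thesis .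
  qed
  have t: "d 1 1 + d 2 2 = 0" using tr by (simp add: trace_def sum_2 d_def matrix_def)
  have "det (matrix (\<lambda>h. h + \<tau> *\<^sub>R D h)) =
    (1 + \<tau> * d 1 1) * (1 + \<tau> * d 2 2) - (\<tau> * d 1 2) * (\<tau> * d 2 1)"
    by (simp add: det_2 matrix_def d_def axis_def)
  also have "\<dots> - 1 = \<tau> * (d 1 1 + d 2 2) + \<tau>\<^sup>2 * (d 1 1 * d 2 2 - d 1 2 * d 2 1)"
    by (simp add: algebra_simps power2_eq_square)
  finally have eq: "\<bar>det (matrix (\<lambda>h. h + \<tau> *\<^sub>R D h)) - 1\<bar> = \<tau>\<^sup>2 * \<bar>d 1 1 * d 2 2 - d 1 2 * d 2 1\<bar>"
    using t by (simp add: abs_mult)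
  have "\<bar>d 1 1 * d 2 2 - d 1 2 * d 2 1\<bar> \<le> \<bar>d 1 1\<bar> * \<bar>d 2 2\<bar> + \<bar>d 1 2\<bar> * \<bar>d 2 1\<bar>"
    by (metis abs_mult abs_triangle_ineq4)
  also have "\<dots> \<le> L * L + L * L" by (intro add_mono mult_mono d) (use L in auto)
  finally have "\<tau>\<^sup>2 * \<bar>d 1 1 * d 2 2 - d 1 2 * d 2 1\<bar> \<le> \<tau>\<^sup>2 * (L * L + L * L)"
    by (intro mult_left_mono) auto
  with eq show ?thesis by (simp add: power2_eq_square algebra_simps)
qed

lemma integral_change_of_variables_plane:
  fixes f :: "plane \<Rightarrow> real"
  assumes f: "integrable lborel f" and g: "\<And>x. (g has_derivative g' x) (at x)" and "bij g"
  shows "integrable lebesgue (\<lambda>x. \<bar>det (matrix (g' x))\<bar> * f (g x))"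
    and "(LINT x|lebesgue. \<bar>det (matrix (g' x))\<bar> * f (g x)) = (LINT x|lborel. f x)"
proof -
  \<comment> \<open>The substitution theorem is used for integrands with values in a space of
    vectors; the scalar \<open>f\<close> is carried along a unit vector and recovered
    afterwards.\<close>
  let ?e = "axis 1 1 :: plane"
  have fl: "integrable lebesgue f" using f by (rule integrable_completion[THEN iffD2, rotated]) (use f in auto)
  have fe: "integrable lebesgue (\<lambda>x. f x *\<^sub>R ?e)" using fl by simp
  then have a: "(\<lambda>x. f x *\<^sub>R ?e) absolutely_integrable_on UNIV" by (simp add: set_integrable_def)
  have b: "(\<lambda>x. \<bar>det (matrix (g' x))\<bar> *\<^sub>R (f (g x) *\<^sub>R ?e)) absolutely_integrable_on UNIV \<and>
     integral UNIV (\<lambda>x. \<bar>det (matrix (g' x))\<bar> *\<^sub>R (f (g x) *\<^sub>R ?e)) = integral UNIV (\<lambda>x. f x *\<^sub>R ?e)"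
    using has_absolute_integral_change_of_variables[of UNIV g g' "\<lambda>x. f x *\<^sub>R ?e" "integral UNIV (\<lambda>x. f x *\<^sub>R ?e)"]
      g \<open>bij g\<close> a by (auto simp: bij_def)
  then have i: "integrable lebesgue (\<lambda>x. (\<bar>det (matrix (g' x))\<bar> * f (g x)) *\<^sub>R ?e)"
    by (simp add: set_integrable_def)
  from integrable_inner_left[OF i, of ?e] 
  show c: "integrable lebesgue (\<lambda>x. \<bar>det (matrix (g' x))\<bar> * f (g x))"
    by (simp add: inner_axis_axis)
  have "(LINT x|lebesgue. (\<bar>det (matrix (g' x))\<bar> * f (g x)) *\<^sub>R ?e) = (LINT x|lebesgue. f x *\<^sub>R ?e)"
    using b set_lebesgue_integral_eq_integral(2)[OF a] set_lebesgue_integral_eq_integral(2)[of UNIV "\<lambda>x. \<bar>det (matrix (g' x))\<bar> *\<^sub>R (f (g x) *\<^sub>R ?e)"]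
    by (simp add: set_lebesgue_integral_def)
  then have "(LINT x|lebesgue. (\<bar>det (matrix (g' x))\<bar> * f (g x))) *\<^sub>R ?e = (LINT x|lebesgue. f x) *\<^sub>R ?e"
    using c fl by simp
  then have "(LINT x|lebesgue. (\<bar>det (matrix (g' x))\<bar> * f (g x))) = (LINT x|lebesgue. f x)"
    by (simp add: axis_eq_0_iff)
  then show "(LINT x|lebesgue. \<bar>det (matrix (g' x))\<bar> * f (g x)) = (LINT x|lborel. f x)"
    using f by (simp add: integral_completion)
qed

text \<open>Solving \<open>x + \<tau> *\<^sub>R u x = z\<close> is a fixed-point problem for
  \<open>z - \<tau> *\<^sub>R u x\<close>, a contraction with factor
  \<open>\<tau> * L < 1\<close>.\<close>

lemma bij_perturbed_identity:
  fixes u :: "'a::banach \<Rightarrow> 'a"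
  assumes lip: "\<And>x y. norm (u x - u y) \<le> L * norm (x - y)" and \<tau>: "0 \<le> \<tau>" "0 \<le> L" "\<tau> * L < 1"
  shows "bij (\<lambda>x. x + \<tau> *\<^sub>R u x)"
proof -
  have ex: "\<exists>!x. z - \<tau> *\<^sub>R u x = x" for z
  proof (rule banach_fix_type)
    show "0 \<le> \<tau> * L" "\<tau> * L < 1" using \<tau> by auto
    show "\<forall>x y. dist (z - \<tau> *\<^sub>R u x) (z - \<tau> *\<^sub>R u y) \<le> \<tau> * L * dist x y"
    proof (intro allI)
      fix x y
      have "dist (z - \<tau> *\<^sub>R u x) (z - \<tau> *\<^sub>R u y) = \<tau> * norm (u x - u y)"
        using \<tau> by (simp add: dist_norm norm_minus_commute flip: scaleR_diff_right)
      also have "\<dots> \<le> \<tau> * (L * norm (x - y))" by (intro mult_left_mono lip \<tau>)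
      finally show "dist (z - \<tau> *\<^sub>R u x) (z - \<tau> *\<^sub>R u y) \<le> \<tau> * L * dist x y" by (simp add: dist_norm)
    qed
  qed
  then have "\<exists>!x. x + \<tau> *\<^sub>R u x = z" for z
    using ex[of z] by (simp add: diff_eq_eq eq_commute[of z])
  then show ?thesis by (auto simp: bij_iff)
qed

text \<open>Substituting \<open>x + \<tau> *\<^sub>R u x\<close> costs a Jacobian within
  \<open>2 * (\<tau> * L)\<^sup>2\<close> of 1; nonnegativity of \<open>f\<close> allows the
  pointwise bounds on the determinant to be integrated. The error is quadratic in
  \<open>\<tau>\<close>, so its total over the steps of a partition vanishes in the limit.\<close>

lemma integral_perturbed_identity:
  fixes u :: "plane \<Rightarrow> plane"
  assumes lip: "\<And>x y. norm (u x - u y) \<le> L * norm (x - y)" and \<tau>: "0 \<le> \<tau>" "0 \<le> L" "\<tau> * L < 1"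
    and D: "\<And>x. \<exists>D. (u has_derivative D) (at x) \<and> trace (matrix D) = 0"
    and f: "test_fun f" "\<And>x. 0 \<le> f x" and fu: "test_fun (\<lambda>x. f (x + \<tau> *\<^sub>R u x))"
  shows "(1 - 2 * (\<tau> * L)\<^sup>2) * (LINT x|lborel. f (x + \<tau> *\<^sub>R u x)) \<le> (LINT x|lborel. f x)"
    and "(LINT x|lborel. f x) \<le> (1 + 2 * (\<tau> * L)\<^sup>2) * (LINT x|lborel. f (x + \<tau> *\<^sub>R u x))"
proof -
  obtain D where D: "\<And>x. (u has_derivative D x) (at x)" "\<And>x. trace (matrix (D x)) = 0"
    using D by metis
  let ?g = "\<lambda>x. x + \<tau> *\<^sub>R u x" and ?g' = "\<lambda>x h. h + \<tau> *\<^sub>R D x h"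
  have g: "(?g has_derivative ?g' x) (at x)" for x
    by (intro derivative_intros D)
  note cov = integral_change_of_variables_plane[OF test_fun_integrable[OF f(1)] g bij_perturbed_identity[OF lip \<tau>]]
  have det: "\<bar>det (matrix (?g' x)) - 1\<bar> \<le> 2 * (\<tau> * L)\<^sup>2" for x
    using D \<tau> lip has_derivative_bound_of_lipschitz[OF D(1)[of x] lip]
    by (intro det_perturbed_identity) (auto dest: has_derivative_linear)
  have fi: "integrable lebesgue (\<lambda>x. f (?g x))"
    using test_fun_integrable[OF fu] by (simp add: integrable_completion borel_measurable_integrable)
  have fe: "(LINT x|lebesgue. f (?g x)) = (LINT x|lborel. f (?g x))"
    using test_fun_integrable[OF fu] by (simp add: integral_completion)
  have fi': "integrable lebesgue (\<lambda>x. c * f (?g x))" for c using fi by simp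
  have det': "1 - 2 * (\<tau> * L)\<^sup>2 \<le> \<bar>det (matrix (?g' x))\<bar>" "\<bar>det (matrix (?g' x))\<bar> \<le> 1 + 2 * (\<tau> * L)\<^sup>2" for x
    using det[of x] by linarith+
  have "(LINT x|lebesgue. (1 - 2 * (\<tau> * L)\<^sup>2) * f (?g x)) \<le> (LINT x|lebesgue. \<bar>det (matrix (?g' x))\<bar> * f (?g x))"
    by (intro integral_mono cov(1) fi' mult_right_mono f det')
  then show "(1 - 2 * (\<tau> * L)\<^sup>2) * (LINT x|lborel. f (?g x)) \<le> (LINT x|lborel. f x)"
    unfolding cov(2) by (simp add: fe)
  have "(LINT x|lebesgue. \<bar>det (matrix (?g' x))\<bar> * f (?g x)) \<le> (LINT x|lebesgue. (1 + 2 * (\<tau> * L)\<^sup>2) * f (?g x))"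
    by (intro integral_mono cov(1) fi' mult_right_mono f det')
  then show "(LINT x|lborel. f x) \<le> (1 + 2 * (\<tau> * L)\<^sup>2) * (LINT x|lborel. f (?g x))"
    unfolding cov(2) by (simp add: fe)
qed

section \<open>Euler polygons and their limit\<close>

locale div_free_field = lipschitz_field v T L V
  for v :: "real \<Rightarrow> plane \<Rightarrow> plane" and T L V +
  assumes div_free: "\<And>t x. t \<in> {0..T} \<Longrightarrow> \<exists>D. (v t has_derivative D) (at x) \<and> trace (matrix D) = 0"
begin

primrec euler :: "real \<Rightarrow> nat \<Rightarrow> plane \<Rightarrow> plane" where
  "euler \<tau> 0 y = y"
| "euler \<tau> (Suc k) y = euler \<tau> k y + \<tau> *\<^sub>R v (real k * \<tau>) (euler \<tau> k y)"

lemma continuous_field: "t \<in> {0..T} \<Longrightarrow> continuous_on UNIV (v t)"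
  by (rule lipschitz_on_continuous_on[of L], rule lipschitz_onI)
     (use lip L_pos in \<open>auto simp: dist_norm\<close>)

lemma continuous_euler:
  assumes "0 \<le> \<tau>" "real k * \<tau> \<le> T" shows "continuous_on UNIV (euler \<tau> k)"
  using assms(2)
proof (induction k)
  case (Suc k)
  have k: "real k * \<tau> \<le> T" using Suc.prems assms(1) by (simp add: algebra_simps)
  have "continuous_on UNIV (\<lambda>y. v (real k * \<tau>) (euler \<tau> k y))"
    by (rule continuous_on_compose2[OF continuous_field Suc.IH[OF k]]) (use k assms in auto)
  then show ?case using Suc.IH[OF k] by (simp add: continuous_intros)
qed simp

lemma euler_displacement:
  assumes "0 \<le> \<tau>" "real k * \<tau> \<le> T" shows "norm (euler \<tau> k y - y) \<le> real k * \<tau> * V"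
  using assms(2)
proof (induction k)
  case (Suc k)
  have k: "real k * \<tau> \<le> T" using Suc.prems assms(1) by (simp add: algebra_simps)
  have "norm (euler \<tau> (Suc k) y - y) = norm ((euler \<tau> k y - y) + \<tau> *\<^sub>R v (real k * \<tau>) (euler \<tau> k y))"
    by (simp add: algebra_simps)
  also have "\<dots> \<le> real k * \<tau> * V + \<tau> * V"
    using Suc.IH[OF k] bound[of "real k * \<tau>" "euler \<tau> k y"] k assms(1)
    by (intro norm_triangle_le add_mono) (auto intro: mult_left_mono)
  finally show ?case by (simp add: algebra_simps)
qed simp

text \<open>\<open>\<eta>\<close> measures how much the velocity along the exact trajectory of
  \<open>y\<close> varies within one step. Each step thus adds an error
  \<open>\<eta> * \<tau>\<close>, and errors already present grow by
  \<open>1 + \<tau> * L\<close>.\<close>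

lemma euler_error:
  assumes "0 \<le> \<tau>" "real k * \<tau> \<le> T" "0 \<le> \<eta>"
    and mod: "\<And>s s'. s \<in> {0..T} \<Longrightarrow> s' \<in> {0..T} \<Longrightarrow> \<bar>s - s'\<bar> \<le> \<tau> \<Longrightarrow>
      norm (v s (flow y s) - v s' (flow y s')) \<le> \<eta>"
  shows "norm (euler \<tau> k y - flow y (real k * \<tau>)) \<le> real k * \<tau> * \<eta> * (1 + \<tau> * L) ^ k"
  using assms(2)
proof (induction k)
  case (Suc k)
  define a b where "a = real k * \<tau>" and "b = real (Suc k) * \<tau>"
  have ab: "0 \<le> a" "a \<le> b" "b \<le> T" "b - a = \<tau>"
    using Suc.prems assms(1) by (auto simp: a_def b_def algebra_simps)
  let ?g = "v a (flow y a)" and ?q = "1 + \<tau> * L"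
  have q: "1 \<le> ?q" using assms(1) L_pos by simp
  \<comment> \<open>Subtracting the motion with frozen velocity \<open>v a (flow y a)\<close> leaves
    a curve of speed at most \<open>\<eta>\<close>; the mean value inequality gives the local error
    of one step.\<close>
  have "norm ((flow y b - b *\<^sub>R ?g) - (flow y a - a *\<^sub>R ?g)) \<le> \<eta> * norm (b - a)"
  proof (rule differentiable_bound[where S = "{a..b}" and f' = "\<lambda>s h. h *\<^sub>R (v s (flow y s) - ?g)"])
    fix s assume s: "s \<in> {a..b}"
    have "((\<lambda>s. flow y s - s *\<^sub>R ?g) has_vector_derivative (v s (flow y s) - 1 *\<^sub>R ?g)) (at s within {a..b})"
      using s ab by (intro has_vector_derivative_diff has_vector_derivative_within_subset[OF flow_deriv])
        (auto intro!: derivative_eq_intros simp: has_vector_derivative_def)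
    then show "((\<lambda>s. flow y s - s *\<^sub>R ?g) has_derivative (\<lambda>h. h *\<^sub>R (v s (flow y s) - ?g))) (at s within {a..b})"
      by (simp add: has_vector_derivative_def)
    show "onorm (\<lambda>h. h *\<^sub>R (v s (flow y s) - ?g)) \<le> \<eta>"
      by (rule onorm_le) (use mod[of s a] s ab in \<open>simp add: mult.commute[of \<eta>] mult_left_mono\<close>)
  qed (use ab in auto)
  also have "(flow y b - b *\<^sub>R ?g) - (flow y a - a *\<^sub>R ?g) = flow y b - flow y a - \<tau> *\<^sub>R ?g"
    unfolding ab(4)[symmetric] by (simp add: scaleR_left_diff_distrib)
  finally have 1: "norm (flow y b - flow y a - \<tau> *\<^sub>R ?g) \<le> \<eta> * \<tau>" using ab assms(1) by simp
  have IH: "norm (euler \<tau> k y - flow y a) \<le> a * \<eta> * ?q ^ k"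
    unfolding a_def using Suc.IH ab by (simp add: a_def)
  have "norm (v a (euler \<tau> k y) - ?g) \<le> L * norm (euler \<tau> k y - flow y a)"
    by (rule lip) (use ab in auto)
  then have 2: "norm (\<tau> *\<^sub>R (v a (euler \<tau> k y) - ?g)) \<le> \<tau> * (L * norm (euler \<tau> k y - flow y a))"
    using assms(1) by (simp add: mult_left_mono)
  have "norm (euler \<tau> (Suc k) y - flow y b) =
      norm ((euler \<tau> k y - flow y a) + \<tau> *\<^sub>R (v a (euler \<tau> k y) - ?g) - (flow y b - flow y a - \<tau> *\<^sub>R ?g))"
    by (simp add: a_def algebra_simps)
  also have "\<dots> \<le> norm (euler \<tau> k y - flow y a) + norm (\<tau> *\<^sub>R (v a (euler \<tau> k y) - ?g))
      + norm (flow y b - flow y a - \<tau> *\<^sub>R ?g)"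
    by (intro order_trans[OF norm_triangle_ineq4] add_mono norm_triangle_ineq order_refl)
  also have "\<dots> \<le> ?q * norm (euler \<tau> k y - flow y a) + \<eta> * \<tau>"
    using 1 2 by (simp add: algebra_simps)
  also have "\<dots> \<le> ?q * (a * \<eta> * ?q ^ k) + \<eta> * \<tau> * ?q ^ Suc k"
  proof (intro add_mono mult_left_mono IH)
    show "\<eta> * \<tau> \<le> \<eta> * \<tau> * ?q ^ Suc k"
      using mult_left_mono[OF one_le_power[OF q, of "Suc k"], of "\<eta> * \<tau>"] assms(1,3) by simp
  qed (use q in auto)
  also have "\<dots> = b * \<eta> * ?q ^ Suc k" using ab(4) by (simp add: algebra_simps a_def b_def)
  finally show ?case by (simp add: b_def)
qed simp

lemma euler_tendsto:
  assumes t: "t \<in> {0..T}"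
  shows "(\<lambda>n. euler (t / real n) n y) \<longlonglongrightarrow> flow y t"
proof (rule metric_LIMSEQ_I)
  fix r :: real assume "0 < r"
  define c where "c = T * exp (L * T) + 1"
  have c: "0 < c" using T_pos by (auto simp: c_def intro: add_nonneg_pos)
  have "uniformly_continuous_on {0..T} (\<lambda>s. v s (flow y s))"
    by (intro compact_uniformly_continuous continuous_along flow_continuous) auto
  then obtain d where d: "0 < d" "\<And>s s'. s \<in> {0..T} \<Longrightarrow> s' \<in> {0..T} \<Longrightarrow> \<bar>s - s'\<bar> < d \<Longrightarrow>
      norm (v s (flow y s) - v s' (flow y s')) < r / c"
    using \<open>0 < r\<close> c unfolding uniformly_continuous_on_def dist_norm real_norm_def
    by (metis divide_pos_pos)
  obtain N :: nat where N: "T / d < real N" using reals_Archimedean2 by blast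
  show "\<exists>N. \<forall>n\<ge>N. dist (euler (t / real n) n y) (flow y t) < r"
  proof (intro exI[of _ "Suc N"] allI impI)
    fix n assume n: "Suc N \<le> n"
    let ?\<tau> = "t / real n"
    have "T / d < real n" using N n by linarith
    then have "T < d * real n" using d(1) by (simp add: field_simps)
    then have td: "?\<tau> < d" using t n by (simp add: field_simps)
    have "norm (euler ?\<tau> n y - flow y (real n * ?\<tau>)) \<le> real n * ?\<tau> * (r / c) * (1 + ?\<tau> * L) ^ n"
      by (rule euler_error) (use d(2) td t n \<open>0 < r\<close> c in \<open>auto intro!: less_imp_le\<close>)
    also have "real n * ?\<tau> = t" using n by simp
    also have "t * (r / c) * (1 + ?\<tau> * L) ^ n \<le> t * (r / c) * exp (t * L)"
    proof (rule mult_left_mono)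
      have "(1 + ?\<tau> * L) ^ n \<le> exp (?\<tau> * L) ^ n"
        using t L_pos by (intro power_mono exp_ge_add_one_self) auto
      also have "\<dots> = exp (t * L)" using n by (simp flip: exp_of_nat_mult)
      finally show "(1 + ?\<tau> * L) ^ n \<le> exp (t * L)" .
    qed (use t c \<open>0 < r\<close> in auto)
    also have "t * (r / c) * exp (t * L) \<le> T * (r / c) * exp (T * L)"
      using t \<open>0 < r\<close> c L_pos by (intro mult_mono) auto
    also have "\<dots> = r * (T * exp (L * T) / c)" by (simp add: mult.commute)
    also have "\<dots> < r * 1" using \<open>0 < r\<close> c by (intro mult_strict_left_mono) (auto simp: c_def)
    finally show "dist (euler ?\<tau> n y) (flow y t) < r"
      using t \<open>0 < r\<close> c L_pos by (simp add: dist_norm)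
  qed
qed

lemma test_fun_step:
  assumes "test_fun f" "s \<in> {0..T}" "0 \<le> \<tau>"
  shows "test_fun (\<lambda>x. f (x + \<tau> *\<^sub>R v s x))"
  by (rule test_fun_compose[OF assms(1), of _ "\<tau> * V"])
     (use assms bound in \<open>auto intro!: continuous_intros continuous_field mult_left_mono\<close>)

text \<open>The induction generalizes over \<open>f\<close>: the last Euler step is absorbed into
  the test function, leaving \<open>k\<close> steps for \<open>f\<close> composed with that
  step.\<close>

lemma integral_euler:
  assumes "test_fun f" "\<And>x. 0 \<le> f x" "0 \<le> \<tau>" "real k * \<tau> \<le> T" "2 * (\<tau> * L)\<^sup>2 < 1" "\<tau> * L < 1"
  shows "(1 - 2 * (\<tau> * L)\<^sup>2) ^ k * (LINT x|lborel. f (euler \<tau> k x)) \<le> (LINT x|lborel. f x) \<and>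
    (LINT x|lborel. f x) \<le> (1 + 2 * (\<tau> * L)\<^sup>2) ^ k * (LINT x|lborel. f (euler \<tau> k x))"
  using assms(1,2,4)
proof (induction k arbitrary: f)
  case (Suc k)
  define s where "s = real k * \<tau>"
  have s: "s \<in> {0..T}" using Suc.prems(3) assms(3) by (auto simp: s_def algebra_simps)
  let ?f = "\<lambda>x. f (x + \<tau> *\<^sub>R v s x)" and ?\<theta> = "2 * (\<tau> * L)\<^sup>2"
  have tf: "test_fun ?f" by (rule test_fun_step) (use Suc.prems s assms(3) in auto)
  have IH: "(1 - ?\<theta>) ^ k * (LINT x|lborel. ?f (euler \<tau> k x)) \<le> (LINT x|lborel. ?f x)"
    "(LINT x|lborel. ?f x) \<le> (1 + ?\<theta>) ^ k * (LINT x|lborel. ?f (euler \<tau> k x))"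
    using Suc.IH[OF tf] Suc.prems(2) s by (auto simp: s_def)
  have st: "(1 - ?\<theta>) * (LINT x|lborel. ?f x) \<le> (LINT x|lborel. f x)"
    "(LINT x|lborel. f x) \<le> (1 + ?\<theta>) * (LINT x|lborel. ?f x)"
    using integral_perturbed_identity[of "v s" L \<tau> f] lip[OF s] div_free[OF s] assms(3,6) L_pos Suc.prems(1,2) tf
    by auto
  have e: "?f (euler \<tau> k x) = f (euler \<tau> (Suc k) x)" for x by (simp add: s_def)
  have "(1 - ?\<theta>) ^ Suc k * (LINT x|lborel. f (euler \<tau> (Suc k) x)) = (1 - ?\<theta>) * ((1 - ?\<theta>) ^ k * (LINT x|lborel. ?f (euler \<tau> k x)))"
    unfolding e by simp
  also have "\<dots> \<le> (1 - ?\<theta>) * (LINT x|lborel. ?f x)" by (intro mult_left_mono IH) (use assms(5) in auto)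
  finally have 1: "(1 - ?\<theta>) ^ Suc k * (LINT x|lborel. f (euler \<tau> (Suc k) x)) \<le> (LINT x|lborel. f x)"
    using st by linarith
  have "(1 + ?\<theta>) * (LINT x|lborel. ?f x) \<le> (1 + ?\<theta>) * ((1 + ?\<theta>) ^ k * (LINT x|lborel. ?f (euler \<tau> k x)))"
    by (intro mult_left_mono IH) auto
  also have "\<dots> = (1 + ?\<theta>) ^ Suc k * (LINT x|lborel. f (euler \<tau> (Suc k) x))" unfolding e by simp
  finally show ?case using 1 st by linarith
qed simp

text \<open>With step t/n the accumulated Jacobian factors lie between 1 - n \<theta>(n), by
  Bernoulli, and exp (n \<theta>(n)), where n \<theta>(n) is of order 1/n. Both bounds tend to 1
  while the polygons converge pointwise to the flow.\<close>

theorem flow_preserves_integral_nonneg: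
  assumes t: "t \<in> {0..T}" and f: "test_fun f" "\<And>x. 0 \<le> f x"
  shows "(LINT y|lborel. f (flow y t)) = (LINT x|lborel. f x)"
proof -
  define \<theta> where "\<theta> n = 2 * (t / real n * L)\<^sup>2" for n
  define J where "J n = (LINT x|lborel. f (euler (t / real n) n x))" for n
  obtain B where B: "\<And>x. \<bar>f x\<bar> \<le> B" "0 \<le> B" using test_fun_bounded[OF f(1)] by blast
  obtain R where R: "\<And>x. R < norm x \<Longrightarrow> f x = 0" and fc: "continuous_on UNIV f"
    using f(1) unfolding test_fun_def by blast
  have fb [measurable]: "f \<in> borel_measurable borel" using fc by (rule borel_measurable_continuous_onI)
  have ev: "\<forall>\<^sub>F n in sequentially. 0 < n" by (rule eventually_gt_at_top)
  have J: "J \<longlonglongrightarrow> (LINT y|lborel. f (flow y t))" unfolding J_def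
  \<comment> \<open>The polygons move points by at most \<open>T * V\<close>, so all the
    compositions vanish outside one common ball.\<close>
  proof (rule integral_dominated_convergence[where w = "\<lambda>x. indicator (cball 0 (R + T * V)) x * B"])
    have "continuous_on UNIV (\<lambda>y. f (flow y t))"
      by (rule continuous_on_compose2[OF fc continuous_flow_initial[OF t]]) auto
    then show "(\<lambda>y. f (flow y t)) \<in> borel_measurable lborel"
      by (simp add: borel_measurable_continuous_onI)
    show "(\<lambda>x. f (euler (t / real n) n x)) \<in> borel_measurable lborel" for n
    proof -
      have "continuous_on UNIV (euler (t / real n) n)"
        by (rule continuous_euler) (use t T_pos in \<open>auto simp: zero_le_divide_iff\<close>)
      then have "continuous_on UNIV (\<lambda>x. f (euler (t / real n) n x))"
        by (intro continuous_on_compose2[OF fc]) auto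
      then show ?thesis by (simp add: borel_measurable_continuous_onI)
    qed
    show "integrable lborel (\<lambda>x::plane. indicator (cball 0 (R + T * V)) x * B)"
      by (intro integrable_mult_left integrable_real_indicator) (auto simp: emeasure_lborel_cball_finite[unfolded infinity_ennreal_def])
    show "AE x in lborel. (\<lambda>n. f (euler (t / real n) n x)) \<longlonglongrightarrow> f (flow x t)"
      using continuous_on_tendsto_compose[OF fc euler_tendsto[OF t]] by auto
    show "AE x in lborel. norm (f (euler (t / real n) n x)) \<le> indicator (cball 0 (R + T * V)) x * B" for n
    proof (rule AE_I2)
      fix x
      \<comment> \<open>For \<open>n = 0\<close> the left side is 0 by division by zero, hence only
        an inequality.\<close>
      have k: "real n * (t / real n) \<le> t" using t by (cases "n = 0") auto
      have "norm (euler (t / real n) n x - x) \<le> real n * (t / real n) * V"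
        by (rule euler_displacement) (use t k in auto)
      also have "\<dots> \<le> T * V" using k t V_nonneg by (intro mult_right_mono) auto
      finally have "norm x \<le> norm (euler (t / real n) n x) + T * V"
        using norm_triangle_sub[of x "euler (t / real n) n x"] by (simp add: norm_minus_commute)
      then show "norm (f (euler (t / real n) n x)) \<le> indicator (cball 0 (R + T * V)) x * B"
        using R[of "euler (t / real n) n x"] B by (auto simp: indicator_def not_le)
    qed
  qed
  have n\<theta>: "(\<lambda>n. real n * \<theta> n) \<longlonglongrightarrow> 0"
  proof (rule Lim_transform_eventually)
    show "(\<lambda>n. 2 * (t * L)\<^sup>2 * inverse (real n)) \<longlonglongrightarrow> 0"
      by (intro tendsto_mult_right_zero lim_inverse_n)
    show "\<forall>\<^sub>F n in sequentially. 2 * (t * L)\<^sup>2 * inverse (real n) = real n * \<theta> n"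
      using ev by eventually_elim (simp add: \<theta>_def power2_eq_square field_simps)
  qed
  have \<theta>0: "\<theta> \<longlonglongrightarrow> 0" 
  proof (rule Lim_null_comparison[OF _ n\<theta>])
    show "\<forall>\<^sub>F n in sequentially. norm (\<theta> n) \<le> real n * \<theta> n"
      using ev by eventually_elim (simp add: \<theta>_def mult_le_cancel_right1)
  qed
  have "(\<lambda>n. t / real n * L) \<longlonglongrightarrow> 0"
    using tendsto_mult_right_zero[OF lim_inverse_n, of "t * L"] by (simp add: divide_inverse mult_ac)
  then have ev1: "\<forall>\<^sub>F n in sequentially. t / real n * L < 1" by (rule order_tendstoD) simp
  have ev2: "\<forall>\<^sub>F n in sequentially. \<theta> n < 1" by (rule order_tendstoD[OF \<theta>0]) simp
  have est: "\<forall>\<^sub>F n in sequentially. (1 - real n * \<theta> n) * J n \<le> (LINT x|lborel. f x) \<and>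
      (LINT x|lborel. f x) \<le> exp (real n * \<theta> n) * J n"
    using ev ev1 ev2
  proof eventually_elim
    case (elim n)
    have J0: "0 \<le> J n" unfolding J_def by (rule Bochner_Integration.integral_nonneg) (use f in auto)
    have th0: "0 \<le> \<theta> n" by (simp add: \<theta>_def)
    have a: "(1 - \<theta> n) ^ n * J n \<le> (LINT x|lborel. f x)" "(LINT x|lborel. f x) \<le> (1 + \<theta> n) ^ n * J n"
      using integral_euler[of f "t / real n" n] f t elim by (auto simp: J_def \<theta>_def)
    have "1 - real n * \<theta> n \<le> (1 - \<theta> n) ^ n"
      using Bernoulli_inequality[of "- \<theta> n" n] elim by simp
    then have b: "(1 - real n * \<theta> n) * J n \<le> (1 - \<theta> n) ^ n * J n" using J0 by (rule mult_right_mono)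
    have "(1 + \<theta> n) ^ n \<le> exp (\<theta> n) ^ n" using th0 by (intro power_mono exp_ge_add_one_self) auto
    then have "(1 + \<theta> n) ^ n * J n \<le> exp (real n * \<theta> n) * J n"
      using J0 by (simp add: exp_of_nat_mult mult_right_mono)
    then show ?case using a b by linarith
  qed
  have "(\<lambda>n. (1 - real n * \<theta> n) * J n) \<longlonglongrightarrow> (1 - 0) * (LINT y|lborel. f (flow y t))"
    by (intro tendsto_intros n\<theta> J)
  then have 1: "(1 - 0) * (LINT y|lborel. f (flow y t)) \<le> (LINT x|lborel. f x)"
    by (rule tendsto_upperbound) (use est in \<open>auto elim: eventually_mono\<close>)
  have "(\<lambda>n. exp (real n * \<theta> n) * J n) \<longlonglongrightarrow> exp 0 * (LINT y|lborel. f (flow y t))"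
    by (intro tendsto_intros n\<theta> J)
  then have 2: "(LINT x|lborel. f x) \<le> exp 0 * (LINT y|lborel. f (flow y t))"
    by (rule tendsto_lowerbound) (use est in \<open>auto elim: eventually_mono\<close>)
  show ?thesis using 1 2 by simp
qed

lemma test_fun_flow:
  assumes "t \<in> {0..T}" "test_fun f" shows "test_fun (\<lambda>y. f (flow y t))"
  by (rule test_fun_compose[OF assms(2) continuous_flow_initial[OF assms(1)], where c = "V * t"])
     (use flow_speed[of 0 t] assms in auto)

theorem flow_preserves_integral:
  assumes t: "t \<in> {0..T}" and f: "test_fun f"
  shows "(LINT y|lborel. f (flow y t)) = (LINT x|lborel. f x)"
proof -
  let ?p = "\<lambda>x. max (f x) 0" and ?n = "\<lambda>x. max (- f x) 0"
  have p: "test_fun ?p" and n: "test_fun ?n"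
    using f unfolding test_fun_def by (fastforce intro!: continuous_intros)+
  have e: "f = (\<lambda>x. ?p x - ?n x)" by auto
  have "(LINT y|lborel. f (flow y t)) = (LINT y|lborel. ?p (flow y t) - ?n (flow y t))"
    by (rule Bochner_Integration.integral_cong) auto
  also have "\<dots> = (LINT y|lborel. ?p (flow y t)) - (LINT y|lborel. ?n (flow y t))"
    using test_fun_integrable[OF test_fun_flow[OF t p]] test_fun_integrable[OF test_fun_flow[OF t n]]
    by (rule Bochner_Integration.integral_diff)
  also have "\<dots> = (LINT y|lborel. ?p y) - (LINT y|lborel. ?n y)"
    using flow_preserves_integral_nonneg[OF t p] flow_preserves_integral_nonneg[OF t n] by simp
  also have "\<dots> = (LINT y|lborel. ?p y - ?n y)"
    using test_fun_integrable[OF p] test_fun_integrable[OF n] by simp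
  also have "\<dots> = (LINT y|lborel. f y)" by (rule Bochner_Integration.integral_cong) auto
  finally show ?thesis .
qed

text \<open>A continuous cutoff between a ball and its double replaces the indicator function, at the cost
  of a factor 4.\<close>

lemma emeasure_flow_vimage_cball:
  assumes t: "t \<in> {0..T}" and r: "0 < r"
  shows "emeasure lborel {y. flow y t \<in> cball x r} \<le> ennreal (4 * pi * r\<^sup>2)"
proof -
  define f where "f z = max 0 (min 1 (2 - dist x z / r))" for z :: plane
  have fc: "continuous_on UNIV f" unfolding f_def by (intro continuous_intros) (use r in auto)
  have f2: "f z \<le> indicator (cball x (2 * r)) z" for z
    using r by (auto simp: f_def indicator_def field_simps)
  have f0: "0 \<le> f z" for z by (simp add: f_def)
  have f1: "f z = 1" if "z \<in> cball x r" for z using that r by (simp add: f_def field_simps)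
  have "f z = 0" if "norm x + 2 * r < norm z" for z
    using that f2[of z] f0[of z] norm_triangle_sub[of z x] by (auto simp: indicator_def dist_norm norm_minus_commute split: if_splits)
  then have tf: "test_fun f" using fc unfolding test_fun_def by blast
  have m: "{y. flow y t \<in> cball x r} \<in> sets borel"
    by (intro borel_closed) (use continuous_closed_vimage[of "cball x r" "\<lambda>y. flow y t"]
        continuous_flow_initial[OF t] in \<open>auto simp: continuous_on_eq_continuous_at vimage_def\<close>)
  have "emeasure lborel {y. flow y t \<in> cball x r} = (\<integral>\<^sup>+ y. indicator {y. flow y t \<in> cball x r} y \<partial>lborel)"
    using m by simp
  also have "\<dots> \<le> (\<integral>\<^sup>+ y. ennreal (f (flow y t)) \<partial>lborel)"
    by (intro nn_integral_mono) (auto simp: indicator_def f1)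
  also have "\<dots> = ennreal (LINT y|lborel. f (flow y t))"
    using test_fun_integrable[OF test_fun_flow[OF t tf]] f0 by (intro nn_integral_eq_integral) auto
  finally have 1: "emeasure lborel {y. flow y t \<in> cball x r} \<le> ennreal (LINT y|lborel. f (flow y t))" .
  have "(LINT y|lborel. f (flow y t)) = (LINT y|lborel. f y)" by (rule flow_preserves_integral[OF t tf])
  also have "\<dots> \<le> (LINT y|lborel. indicator (cball x (2 * r)) y)"
    by (intro integral_mono f2 test_fun_integrable[OF tf] integrable_real_indicator) (auto simp: emeasure_lborel_cball_finite[unfolded infinity_ennreal_def])
  also have "\<dots> = pi * (2 * r)\<^sup>2"
    using r by (simp add: content_ball content_cball unit_ball_vol_2)
  finally have "(LINT y|lborel. f (flow y t)) \<le> 4 * pi * r\<^sup>2" by (simp add: power_mult_distrib mult_ac)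
  then show ?thesis by (rule order_trans[OF 1 ennreal_leI])
qed

end

section \<open>The regularized Biot-Savart kernel\<close>

lemma norm_plane: "norm (x::plane) = sqrt ((x$1)\<^sup>2 + (x$2)\<^sup>2)"
  by (simp add: norm_vec_def L2_set_def sum_2)

lemma cball_in_borel [measurable]: "cball x r \<in> sets borel"
  by simp

lemma norm_perp: "norm (vector [- (x $ 2), x $ 1] :: plane) = norm (x :: plane)"
  by (simp add: norm_plane add.commute)

lemma norm_K: "norm (K x) = 1 / (2 * pi * norm x)"
  by (cases "x = 0") (simp_all add: K_def norm_perp power2_eq_square field_simps)

text \<open>Up to the factor 1/(2 pi) and a quarter turn, \<open>K\<close> is the inversion x /
  |x|^2, which divides distances by \<open>norm a * norm b\<close>. Being an exact identity, it
  holds even if the segment from \<open>a\<close> to \<open>b\<close> runs through the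
  singularity.\<close>

lemma norm_K_diff:
  assumes "a \<noteq> 0" "b \<noteq> 0"
  shows "norm (K a - K b) = norm (a - b) / (2 * pi * norm a * norm b)"
proof -
  let ?J = "\<lambda>x::plane. vector [- (x $ 2), x $ 1] :: plane"
  have "K a - K b = (1 / (2 * pi)) *\<^sub>R ?J (a /\<^sub>R (norm a)\<^sup>2 - b /\<^sub>R (norm b)\<^sup>2)"
    by (simp add: K_def vec_eq_iff forall_2 diff_divide_distrib algebra_simps)
  then have n: "norm (K a - K b) = norm (a /\<^sub>R (norm a)\<^sup>2 - b /\<^sub>R (norm b)\<^sup>2) / (2 * pi)"
    by (simp only: norm_scaleR norm_perp) simp
  have "(norm (a /\<^sub>R (norm a)\<^sup>2 - b /\<^sub>R (norm b)\<^sup>2))\<^sup>2 = (norm (a - b) / (norm a * norm b))\<^sup>2"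
  proof -
    have "(norm (a /\<^sub>R (norm a)\<^sup>2 - b /\<^sub>R (norm b)\<^sup>2))\<^sup>2 =
       (norm a)\<^sup>2 / ((norm a)\<^sup>2)\<^sup>2 - 2 * (a \<bullet> b) / ((norm a)\<^sup>2 * (norm b)\<^sup>2) + (norm b)\<^sup>2 / ((norm b)\<^sup>2)\<^sup>2"
    proof -
      have "(norm (s *\<^sub>R a - t *\<^sub>R b))\<^sup>2 = s\<^sup>2 * (norm a)\<^sup>2 - 2 * s * t * (a \<bullet> b) + t\<^sup>2 * (norm b)\<^sup>2" for s t
        unfolding power2_norm_eq_inner
        by (simp add: inner_diff_left inner_diff_right inner_commute power2_eq_square algebra_simps)
      then show ?thesis by (simp add: divide_inverse power_mult_distrib power_inverse mult_ac)
    qed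
    also have "\<dots> = ((norm b)\<^sup>2 - 2 * (a \<bullet> b) + (norm a)\<^sup>2) / ((norm a)\<^sup>2 * (norm b)\<^sup>2)"
      using assms by (simp add: field_simps power2_eq_square)
    also have "(norm b)\<^sup>2 - 2 * (a \<bullet> b) + (norm a)\<^sup>2 = (norm (a - b))\<^sup>2"
      by (simp add: power2_norm_eq_inner inner_diff_left inner_diff_right inner_commute)
    finally show ?thesis by (simp add: power_divide power_mult_distrib)
  qed
  then have "norm (a /\<^sub>R (norm a)\<^sup>2 - b /\<^sub>R (norm b)\<^sup>2) = norm (a - b) / (norm a * norm b)"
    by (rule power2_eq_imp_eq) auto
  then show ?thesis using n by (simp add: mult_ac)
qed

lemma borel_measurable_K [measurable]: "K \<in> borel_measurable borel"
proof -
  have "continuous_on UNIV (\<lambda>x::plane. vector [- (x $ 2), x $ 1] :: plane)"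
    by (rule linear_continuous_on, rule linear_linear[THEN iffD2], rule linearI)
       (auto simp: vec_eq_iff forall_2)
  then have [measurable]: "(\<lambda>x::plane. vector [- (x $ 2), x $ 1] :: plane) \<in> borel_measurable borel"
    by (rule borel_measurable_continuous_onI)
  show ?thesis unfolding K_def[abs_def] by measurable
qed

lemma emeasure_cball_plane:
  "0 \<le> r \<Longrightarrow> emeasure lborel (cball x r :: plane set) = ennreal (pi * r\<^sup>2)"
  by (simp add: emeasure_cball unit_ball_vol_2)

text \<open>Dyadic discs instead of polar coordinates: the disc of radius r / 2^k carries weight
  2^(k+1) / r on area pi r^2 / 4^k, and the geometric series sums to 4 pi r, twice the exact
  value.\<close>

lemma nn_integral_inverse_norm_cball_0:
  assumes r: "0 < r"
  shows "(\<integral>\<^sup>+ (y::plane). ennreal (1 / norm y) * indicator (cball 0 r) y \<partial>lborel) \<le> ennreal (4 * pi * r)"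
proof -
  have "ennreal (1 / norm y) * indicator (cball 0 r) y
      \<le> (\<Sum>k. ennreal (2 ^ Suc k / r) * indicator (cball 0 (r / 2 ^ k)) y)" for y :: plane
  proof (cases "y \<in> cball 0 r \<and> y \<noteq> 0")
    case True
    have "\<exists>n. r / 2 ^ n < norm y"
    proof -
      obtain n :: nat where "r / norm y < 2 ^ n" using real_arch_pow[of 2 "r / norm y"] by auto
      then show ?thesis using True by (intro exI[of _ n]) (simp add: field_simps)
    qed
    \<comment> \<open>At the first dyadic radius below \<open>norm y\<close> the preceding disc
      still contains \<open>y\<close>, and its weight dominates \<open>1 / norm y\<close>.\<close>
    define n where "n = (LEAST n. r / 2 ^ n < norm y)"
    have n: "r / 2 ^ n < norm y" unfolding n_def by (rule LeastI_ex) fact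
    then have "n \<noteq> 0" using True by (intro notI) auto
    then obtain k where k: "n = Suc k" by (cases n) auto
    have "norm y \<le> r / 2 ^ k" using not_less_Least[of k "\<lambda>n. r / 2 ^ n < norm y"] k by (simp add: n_def[symmetric] not_less)
    moreover have "1 / norm y \<le> 2 ^ Suc k / r"
      using n k True r by (simp add: field_simps)
    ultimately have "ennreal (1 / norm y) * indicator (cball 0 r) y \<le> ennreal (2 ^ Suc k / r) * indicator (cball 0 (r / 2 ^ k)) y"
      using True by (simp add: ennreal_leI indicator_def)
    also have "\<dots> \<le> (\<Sum>k. ennreal (2 ^ Suc k / r) * indicator (cball 0 (r / 2 ^ k)) y)"
    proof -
      define f where "f k = ennreal (2 ^ Suc k / r) * indicator (cball 0 (r / 2 ^ k)) y" for k
      have "sum f {k} \<le> suminf f" by (rule sum_le_suminf) auto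
      then have "f k \<le> suminf f" by simp
      then show ?thesis by (simp only: f_def[abs_def])
    qed
    finally show ?thesis .
  qed auto
  then have "(\<integral>\<^sup>+ (y::plane). ennreal (1 / norm y) * indicator (cball 0 r) y \<partial>lborel) \<le>
     (\<integral>\<^sup>+ (y::plane). (\<Sum>k. ennreal (2 ^ Suc k / r) * indicator (cball 0 (r / 2 ^ k)) y) \<partial>lborel)"
    by (intro nn_integral_mono) auto
  also have "\<dots> = (\<Sum>k. \<integral>\<^sup>+ (y::plane). ennreal (2 ^ Suc k / r) * indicator (cball 0 (r / 2 ^ k)) y \<partial>lborel)"
    by (rule nn_integral_suminf) auto
  also have "\<dots> = (\<Sum>k. ennreal (2 * pi * r * (1/2) ^ k))"
  proof (intro suminf_cong)
    fix k
    have "(\<integral>\<^sup>+ (y::plane). ennreal (2 ^ Suc k / r) * indicator (cball 0 (r / 2 ^ k)) y \<partial>lborel)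
       = ennreal (2 ^ Suc k / r) * ennreal (pi * (r / 2 ^ k)\<^sup>2)"
      using r by (simp add: nn_integral_cmult_indicator emeasure_cball_plane)
    also have "\<dots> = ennreal (2 ^ Suc k / r * (pi * (r / 2 ^ k)\<^sup>2))"
      using r by (intro ennreal_mult[symmetric]) auto
    also have "2 ^ Suc k / r * (pi * (r / 2 ^ k)\<^sup>2) = 2 * pi * r * (1/2) ^ k"
      using r by (simp add: power2_eq_square field_simps)
    finally show "(\<integral>\<^sup>+ (y::plane). ennreal (2 ^ Suc k / r) * indicator (cball 0 (r / 2 ^ k)) y \<partial>lborel)
       = ennreal (2 * pi * r * (1/2) ^ k)" .
  qed
  also have "\<dots> = ennreal (4 * pi * r)"
  proof -
    have "(\<lambda>k. 2 * pi * r * (1/2) ^ k) sums (2 * pi * r * (1 / (1 - 1/2)))"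
      by (intro sums_mult geometric_sums) auto
    then have "(\<lambda>k. ennreal (2 * pi * r * (1/2) ^ k)) sums ennreal (2 * pi * r * (1 / (1 - 1/2)))"
      using r by (subst sums_ennreal) auto
    then show ?thesis by (simp add: sums_iff mult_ac)
  qed
  finally show ?thesis .
qed

text \<open>The disc may have any centre. Within distance \<open>r\<close> of the origin the
  previous estimate applies; elsewhere \<open>1 / norm y \<le> 1 / r\<close> on area at most pi r^2.
  Together (4 pi r + pi r) / (2 pi) = 5 r / 2.\<close>

lemma nn_integral_K_cball:
  assumes r: "0 < r"
  shows "(\<integral>\<^sup>+ y. ennreal (norm (K y)) * indicator (cball x r) y \<partial>lborel) \<le> ennreal (5 / 2 * r)"
proof -
  have "(\<integral>\<^sup>+ y. ennreal (norm (K y)) * indicator (cball x r) y \<partial>lborel) \<le>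
    (\<integral>\<^sup>+ y. ennreal (1 / (2 * pi)) * (ennreal (1 / norm y) * indicator (cball 0 r) y
        + ennreal (1 / r) * indicator (cball x r) y) \<partial>lborel)"
  proof (rule nn_integral_mono)
    fix y :: plane
    have K: "ennreal (norm (K y)) = ennreal (1 / (2 * pi)) * ennreal (1 / norm y)"
      by (subst ennreal_mult[symmetric]) (simp_all add: norm_K)
    have "1 / norm y \<le> 1 / r" if "y \<notin> cball 0 r" using that r by (auto intro!: divide_left_mono mult_pos_pos)
    then have "ennreal (1 / norm y) * indicator (cball x r) y \<le>
       ennreal (1 / norm y) * indicator (cball 0 r) y + ennreal (1 / r) * indicator (cball x r) y"
      by (cases "y \<in> cball 0 r"; cases "y \<in> cball x r") (auto simp: ennreal_leI add_increasing2)
    then show "ennreal (norm (K y)) * indicator (cball x r) y \<le> ennreal (1 / (2 * pi)) * (ennreal (1 / norm y) * indicator (cball 0 r) y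
        + ennreal (1 / r) * indicator (cball x r) y)"
      unfolding K mult.assoc by (rule mult_left_mono) simp
  qed
  also have "\<dots> = ennreal (1 / (2 * pi)) * ((\<integral>\<^sup>+ (y::plane). ennreal (1 / norm y) * indicator (cball 0 r) y \<partial>lborel)
      + ennreal (1 / r) * ennreal (pi * r\<^sup>2))"
    using r by (subst nn_integral_cmult, measurable, subst nn_integral_add, measurable)
      (simp add: nn_integral_cmult_indicator emeasure_cball_plane)
  also have "\<dots> \<le> ennreal (1 / (2 * pi)) * (ennreal (4 * pi * r) + ennreal (1 / r) * ennreal (pi * r\<^sup>2))"
    by (intro mult_left_mono add_right_mono nn_integral_inverse_norm_cball_0 r) auto
  also have "\<dots> = ennreal (1 / (2 * pi) * (4 * pi * r + 1 / r * (pi * r\<^sup>2)))"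
  proof -
    have "ennreal a * (ennreal b + ennreal c * ennreal d) = ennreal (a * (b + c * d))"
      if "0 \<le> a" "0 \<le> b" "0 \<le> c" "0 \<le> d" for a b c d
      using that by (simp add: ennreal_mult)
    then show ?thesis using r by simp
  qed
  also have "1 / (2 * pi) * (4 * pi * r + 1 / r * (pi * r\<^sup>2)) = 5 / 2 * r"
    using r by (simp add: field_simps power2_eq_square)
  finally show ?thesis .
qed

text \<open>Two discs, since the weights to come are differences of translates of a bump; a single
  translate is covered with \<open>a = b\<close>. The constant is twice 5/2.\<close>

lemma integral_against_K:
  fixes g :: "plane \<Rightarrow> real"
  assumes g [measurable]: "g \<in> borel_measurable borel" and r: "0 < r" and c: "0 \<le> c"
    and bnd: "\<And>y. \<bar>g y\<bar> \<le> c * (indicator (cball a r) y + indicator (cball b r) y)"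
  shows "integrable lborel (\<lambda>y. g y *\<^sub>R K y)" "norm (LINT y|lborel. g y *\<^sub>R K y) \<le> 5 * r * c"
proof -
  have "(\<integral>\<^sup>+ y. ennreal (norm (g y *\<^sub>R K y)) \<partial>lborel) \<le> (\<integral>\<^sup>+ y. ennreal c *
       (ennreal (norm (K y)) * indicator (cball a r) y + ennreal (norm (K y)) * indicator (cball b r) y) \<partial>lborel)"
  proof (rule nn_integral_mono)
    fix y
    have "norm (g y *\<^sub>R K y) \<le> c * (indicator (cball a r) y + indicator (cball b r) y) * norm (K y)"
      using mult_right_mono[OF bnd[of y], of "norm (K y)"] by simp
    then have "ennreal (norm (g y *\<^sub>R K y)) \<le> ennreal (c * (indicator (cball a r) y + indicator (cball b r) y) * norm (K y))"
      by (rule ennreal_leI)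
    also have "\<dots> = ennreal c *
       (ennreal (norm (K y)) * indicator (cball a r) y + ennreal (norm (K y)) * indicator (cball b r) y)"
      using c by (cases "y \<in> cball a r"; cases "y \<in> cball b r")
        (simp_all add: ennreal_mult distrib_left flip: ennreal_plus ennreal_mult)
    finally show "ennreal (norm (g y *\<^sub>R K y)) \<le> ennreal c *
       (ennreal (norm (K y)) * indicator (cball a r) y + ennreal (norm (K y)) * indicator (cball b r) y)" .
  qed
  also have "\<dots> = ennreal c * ((\<integral>\<^sup>+ y. ennreal (norm (K y)) * indicator (cball a r) y \<partial>lborel)
      + (\<integral>\<^sup>+ y. ennreal (norm (K y)) * indicator (cball b r) y \<partial>lborel))"
    by (subst nn_integral_cmult, measurable, subst nn_integral_add, measurable)
  also have "\<dots> \<le> ennreal c * (ennreal (5 / 2 * r) + ennreal (5 / 2 * r))"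
    by (intro mult_left_mono add_mono nn_integral_K_cball r) auto
  also have "\<dots> = ennreal (5 * r * c)"
    using r c by (simp add: mult.commute flip: ennreal_plus ennreal_mult)
  finally have n: "(\<integral>\<^sup>+ y. ennreal (norm (g y *\<^sub>R K y)) \<partial>lborel) \<le> ennreal (5 * r * c)" .
  then show i: "integrable lborel (\<lambda>y. g y *\<^sub>R K y)"
    by (intro integrableI_bounded) (auto intro: le_less_trans simp: top_unique)
  have "norm (LINT y|lborel. g y *\<^sub>R K y) \<le> (LINT y|lborel. norm (g y *\<^sub>R K y))" by (rule integral_norm_bound)
  also have "\<dots> \<le> 5 * r * c"
    by (rule integral_real_bounded) (use n r c in auto)
  finally show "norm (LINT y|lborel. g y *\<^sub>R K y) \<le> 5 * r * c" .
qed

section \<open>Smoothing the kernel by a compactly supported bump\<close>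

lemma lborel_integral_affine:
  fixes F :: "'a::euclidean_space \<Rightarrow> 'b::{banach, second_countable_topology}"
  assumes [measurable]: "F \<in> borel_measurable borel" and c: "c \<noteq> 0"
  shows "(LINT x|lborel. F x) = \<bar>c\<bar> ^ DIM('a) *\<^sub>R (LINT x|lborel. F (t + c *\<^sub>R x))"
    and "integrable lborel F \<longleftrightarrow> integrable lborel (\<lambda>x. F (t + c *\<^sub>R x))"
proof -
  show "(LINT x|lborel. F x) = \<bar>c\<bar> ^ DIM('a) *\<^sub>R (LINT x|lborel. F (t + c *\<^sub>R x))"
    by (subst lborel_affine[OF c, of t]) (simp add: integral_density integral_distr)
  have "integrable lborel F \<longleftrightarrow> integrable lborel (\<lambda>x. \<bar>c\<bar> ^ DIM('a) *\<^sub>R F (t + c *\<^sub>R x))"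
    by (subst lborel_affine[OF c, of t]) (simp add: integrable_density integrable_distr_eq)
  then show "integrable lborel F \<longleftrightarrow> integrable lborel (\<lambda>x. F (t + c *\<^sub>R x))"
    using c integrable_scaleR_right[of "inverse (\<bar>c\<bar> ^ DIM('a))" lborel "\<lambda>x. \<bar>c\<bar> ^ DIM('a) *\<^sub>R F (t + c *\<^sub>R x)"]
    by auto
qed

lemma lborel_integral_reflect:
  fixes F :: "'a::euclidean_space \<Rightarrow> 'b::{banach, second_countable_topology}"
  assumes "F \<in> borel_measurable borel"
  shows "(LINT x|lborel. F (t - x)) = (LINT x|lborel. F x)"
    and "integrable lborel (\<lambda>x. F (t - x)) \<longleftrightarrow> integrable lborel F"
  using lborel_integral_affine[OF assms, of "-1" t] by auto

lemma conv_lborel: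
  assumes [measurable]: "f \<in> borel_measurable borel" "g \<in> borel_measurable borel"
  shows "conv f g x = (LINT y|lborel. f (x - y) *\<^sub>R g y)"
  unfolding conv_def by (rule integral_completion) measurable

text \<open>The derivative is continuous for each fixed direction, the form in which
  \<open>Ck_on\<close> provides it. The instance of interest is
  \<open>\<psi> = rescale \<phi> \<epsilon>\<close> with \<open>r = \<epsilon>\<close>.\<close>

locale c1_bump =
  fixes \<psi> :: "plane \<Rightarrow> real" and \<psi>' :: "plane \<Rightarrow> plane \<Rightarrow> real" and r :: real
  assumes r_pos: "0 < r"
    and deriv: "\<And>z. (\<psi> has_derivative \<psi>' z) (at z)"
    and deriv_cont: "\<And>h. continuous_on UNIV (\<lambda>z. \<psi>' z h)"
    and vanish: "\<And>z. r < norm z \<Longrightarrow> \<psi> z = 0"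
begin

lemma linear_deriv: "linear (\<psi>' z)"
  using deriv has_derivative_linear by blast

lemma continuous: "continuous_on UNIV \<psi>"
  using deriv by (intro has_derivative_continuous_on) auto

lemma deriv_vanish: "r < norm z \<Longrightarrow> \<psi>' z h = 0"
proof -
  assume z: "r < norm z"
  have "open {z::plane. r < norm z}" by (intro open_Collect_less continuous_intros)
  then have "((\<lambda>_. 0) has_derivative \<psi>' z) (at z)"
    using has_derivative_transform_within_open[OF deriv[of z], of "{z. r < norm z}" "\<lambda>_. 0"] z vanish by auto
  then have "\<psi>' z = (\<lambda>_. 0)" using has_derivative_unique has_derivative_const by blast
  then show ?thesis by simp
qed

lemma test_fun: "test_fun \<psi>" and test_fun_deriv: "test_fun (\<lambda>z. \<psi>' z h)"
  using continuous vanish deriv_cont deriv_vanish unfolding test_fun_def by blast+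

lemma measurable_bump [measurable]: "\<psi> \<in> borel_measurable borel"
  using continuous by (rule borel_measurable_continuous_onI)

lemma deriv_components: "\<psi>' z h = h $ 1 * \<psi>' z (axis 1 1) + h $ 2 * \<psi>' z (axis 2 1)"
proof -
  have h: "h = h $ 1 *\<^sub>R axis 1 1 + h $ 2 *\<^sub>R axis 2 1"
    by (simp add: vec_eq_iff forall_2 axis_def)
  show ?thesis
    by (subst h) (simp add: linear_add[OF linear_deriv] linear_scale[OF linear_deriv])
qed

lemma bump_mvt: "\<exists>s\<in>{0<..<1}. \<psi> (z + h) - \<psi> z = \<psi>' (z + s *\<^sub>R h) h"
proof -
  have "((\<lambda>s. \<psi> (z + s *\<^sub>R h)) has_derivative (\<lambda>k. \<psi>' (z + s *\<^sub>R h) (k *\<^sub>R h))) (at s within {0..1})" for s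
    by (rule has_derivative_compose[where g=\<psi> and f="\<lambda>s. z + s *\<^sub>R h"]) (auto intro!: derivative_eq_intros deriv)
  from mvt_simple[of 0 1 "\<lambda>s. \<psi> (z + s *\<^sub>R h)", OF _ this] show ?thesis by auto
qed

lemma lipschitz_bump: obtains \<Lambda> where "0 \<le> \<Lambda>" "\<And>x y. \<bar>\<psi> x - \<psi> y\<bar> \<le> \<Lambda> * norm (x - y)"
proof -
  obtain B1 where B1: "\<And>z. \<bar>\<psi>' z (axis 1 1)\<bar> \<le> B1" "0 \<le> B1" using test_fun_bounded[OF test_fun_deriv] by blast
  obtain B2 where B2: "\<And>z. \<bar>\<psi>' z (axis 2 1)\<bar> \<le> B2" "0 \<le> B2" using test_fun_bounded[OF test_fun_deriv] by blast
  have d: "\<bar>\<psi>' z h\<bar> \<le> (B1 + B2) * norm h" for z h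
  proof -
    have "\<bar>\<psi>' z h\<bar> \<le> \<bar>h $ 1\<bar> * \<bar>\<psi>' z (axis 1 1)\<bar> + \<bar>h $ 2\<bar> * \<bar>\<psi>' z (axis 2 1)\<bar>"
      unfolding deriv_components[of z h] by (metis abs_mult abs_triangle_ineq)
    also have "\<dots> \<le> norm h * B1 + norm h * B2"
      by (intro add_mono mult_mono component_le_norm_cart B1 B2) auto
    finally show ?thesis by (simp add: algebra_simps)
  qed
  have "\<bar>\<psi> x - \<psi> y\<bar> \<le> (B1 + B2) * norm (x - y)" for x y
    using bump_mvt[of y "x - y"] d[of _ "x - y"] by force
  then show ?thesis using B1(2) B2(2) by (intro that[of "B1 + B2"]) auto
qed

text \<open>Uniformity in \<open>z\<close> is what allows the remainder to be estimated under the
  singular integral in \<open>kernel_has_derivative\<close>. It comes from uniform continuity of two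
  directional derivatives on a compact ball and their vanishing beyond radius
  \<open>r\<close>.\<close>

lemma uniformly_differentiable:
  assumes "0 < e"
  obtains d where "0 < d" "\<And>z h. norm h < d \<Longrightarrow> \<bar>\<psi> (z + h) - \<psi> z - \<psi>' z h\<bar> \<le> e * norm h"
proof -
  have uc: "\<exists>d>0. \<forall>z w. norm (w - z) < d \<longrightarrow> \<bar>\<psi>' w k - \<psi>' z k\<bar> < e / 2" for k
  proof -
    have "uniformly_continuous_on (cball 0 (r + 1)) (\<lambda>z. \<psi>' z k)"
      by (intro compact_uniformly_continuous continuous_on_subset[OF deriv_cont]) auto
    then obtain d where d: "0 < d" "\<And>z w. z \<in> cball 0 (r + 1) \<Longrightarrow> w \<in> cball 0 (r + 1) \<Longrightarrow> norm (w - z) < d \<Longrightarrow>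
        \<bar>\<psi>' w k - \<psi>' z k\<bar> < e / 2"
      using assms unfolding uniformly_continuous_on_def dist_norm real_norm_def by (metis half_gt_zero)
    show ?thesis
    \<comment> \<open>Distances below 1 keep both points in the ball of radius \<open>r + 1\<close>
      as soon as one of them has norm at most \<open>r\<close>.\<close>
    proof (intro exI[of _ "min d 1"] conjI allI impI)
      fix z w :: plane assume wz: "norm (w - z) < min d 1"
      show "\<bar>\<psi>' w k - \<psi>' z k\<bar> < e / 2"
      proof (cases "norm z \<le> r \<or> norm w \<le> r")
        case True
        then have "z \<in> cball 0 (r + 1)" "w \<in> cball 0 (r + 1)"
          using wz norm_triangle_sub[of z w] norm_triangle_sub[of w z] by (auto simp: norm_minus_commute)
        then show ?thesis using d wz by auto
      next
        case False then show ?thesis using deriv_vanish[of z] deriv_vanish[of w] assms by auto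
      qed
    qed (use d in auto)
  qed
  obtain d1 where d1: "0 < d1" "\<And>z w. norm (w - z) < d1 \<Longrightarrow> \<bar>\<psi>' w (axis 1 1) - \<psi>' z (axis 1 1)\<bar> < e / 2" using uc by blast
  obtain d2 where d2: "0 < d2" "\<And>z w. norm (w - z) < d2 \<Longrightarrow> \<bar>\<psi>' w (axis 2 1) - \<psi>' z (axis 2 1)\<bar> < e / 2" using uc by blast
  show ?thesis
  proof (rule that[of "min d1 d2"])
    fix z h :: plane assume h: "norm h < min d1 d2"
    obtain s where s: "s \<in> {0<..<1}" "\<psi> (z + h) - \<psi> z = \<psi>' (z + s *\<^sub>R h) h" using bump_mvt by blast
    let ?w = "z + s *\<^sub>R h"
    have "norm (?w - z) \<le> norm h" using s by (simp add: mult_left_le_one_le)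
    then have w: "norm (?w - z) < d1" "norm (?w - z) < d2" using h by auto
    have "\<psi> (z + h) - \<psi> z - \<psi>' z h = h $ 1 * (\<psi>' ?w (axis 1 1) - \<psi>' z (axis 1 1)) + h $ 2 * (\<psi>' ?w (axis 2 1) - \<psi>' z (axis 2 1))"
      unfolding s deriv_components[of _ h] by (simp add: algebra_simps)
    then have "\<bar>\<psi> (z + h) - \<psi> z - \<psi>' z h\<bar> \<le> \<bar>h $ 1\<bar> * \<bar>\<psi>' ?w (axis 1 1) - \<psi>' z (axis 1 1)\<bar> + \<bar>h $ 2\<bar> * \<bar>\<psi>' ?w (axis 2 1) - \<psi>' z (axis 2 1)\<bar>"
      by (metis abs_mult abs_triangle_ineq)
    also have "\<dots> \<le> norm h * (e / 2) + norm h * (e / 2)"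
      using d1(2)[OF w(1)] d2(2)[OF w(2)] by (intro add_mono mult_mono component_le_norm_cart) auto
    finally show "\<bar>\<psi> (z + h) - \<psi> z - \<psi>' z h\<bar> \<le> e * norm h" by (simp add: mult.commute)
  qed (use d1 d2 in auto)
qed

definition kernel :: "plane \<Rightarrow> plane" where "kernel x = (LINT y|lborel. \<psi> (x - y) *\<^sub>R K y)"

lemma conv_K: "conv \<psi> K = kernel"
  by (simp add: fun_eq_iff conv_lborel kernel_def)

lemma integrable_kernel: "integrable lborel (\<lambda>y. \<psi> (x - y) *\<^sub>R K y)"
  and kernel_bounded: "(\<And>z. \<bar>\<psi> z\<bar> \<le> B) \<Longrightarrow> norm (kernel x) \<le> 5 * r * B"
proof -
  have b: "\<bar>\<psi> (x - y)\<bar> \<le> B * (indicator (cball x r) y + indicator (cball x r) y)"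
    if "\<And>z. \<bar>\<psi> z\<bar> \<le> B" for B y
    using vanish[of "x - y"] that[of "x - y"] by (auto simp: indicator_def dist_norm)
  obtain C where "\<And>z. \<bar>\<psi> z\<bar> \<le> C" "0 \<le> C" using test_fun_bounded[OF test_fun] by blast
  then show "integrable lborel (\<lambda>y. \<psi> (x - y) *\<^sub>R K y)"
    by (intro integral_against_K(1)[OF _ r_pos _ b]) auto
  assume B: "\<And>z. \<bar>\<psi> z\<bar> \<le> B"
  then show "norm (kernel x) \<le> 5 * r * B"
    unfolding kernel_def using order_trans[OF abs_ge_zero B]
    by (intro integral_against_K(2)[OF _ r_pos _ b]) auto
qed

lemma kernel_lipschitz:
  assumes \<Lambda>: "\<And>x y. \<bar>\<psi> x - \<psi> y\<bar> \<le> \<Lambda> * norm (x - y)" "0 \<le> \<Lambda>"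
  shows "norm (kernel x - kernel x') \<le> 5 * r * \<Lambda> * norm (x - x')"
proof -
  have "kernel x - kernel x' = (LINT y|lborel. (\<psi> (x - y) - \<psi> (x' - y)) *\<^sub>R K y)"
    unfolding kernel_def scaleR_left_diff_distrib
    by (rule Bochner_Integration.integral_diff[symmetric]) (rule integrable_kernel)+
  also have "norm \<dots> \<le> 5 * r * (\<Lambda> * norm (x - x'))"
  proof (rule integral_against_K(2)[OF _ r_pos])
    fix y
    show "\<bar>\<psi> (x - y) - \<psi> (x' - y)\<bar> \<le> \<Lambda> * norm (x - x') * (indicator (cball x r) y + indicator (cball x' r) y)"
      using \<Lambda>(1)[of "x - y" "x' - y"] \<Lambda>(2) vanish[of "x - y"] vanish[of "x' - y"]
      by (auto simp: indicator_def dist_norm)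
  qed (use \<Lambda> in auto)
  finally show ?thesis by simp
qed

text \<open>After reflecting the convolution, \<open>kernel x\<close> averages \<open>K\<close> over
  points at distance at least \<open>\<rho> - r\<close> from the origin, and the exact difference
  formula for \<open>K\<close> compares the two averages point by point.\<close>

lemma kernel_far:
  assumes nn: "\<And>z. 0 \<le> \<psi> z" and one: "(LINT z|lborel. \<psi> z) = 1" and \<rho>: "r < \<rho>" "\<rho> \<le> norm x" "\<rho> \<le> norm x'"
  shows "norm (kernel x - kernel x') \<le> norm (x - x') / (2 * pi * (\<rho> - r)\<^sup>2)"
proof -
  have k: "kernel x = (LINT z|lborel. \<psi> z *\<^sub>R K (x - z))" "integrable lborel (\<lambda>z. \<psi> z *\<^sub>R K (x - z))" for x
    using lborel_integral_reflect[of "\<lambda>y. \<psi> (x - y) *\<^sub>R K y" x] integrable_kernel[of x] by (auto simp: kernel_def)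
  let ?c = "norm (x - x') / (2 * pi * (\<rho> - r)\<^sup>2)"
  have pt: "norm (\<psi> z *\<^sub>R (K (x - z) - K (x' - z))) \<le> \<psi> z * ?c" for z
  proof (cases "norm z \<le> r")
    case True
    have n: "\<rho> - r \<le> norm (x - z)" "\<rho> - r \<le> norm (x' - z)"
      using \<rho> True norm_triangle_sub[of x z] norm_triangle_sub[of x' z] by linarith+
    then have "x - z \<noteq> 0" "x' - z \<noteq> 0" using \<rho>(1) by auto
    from norm_K_diff[OF this] have "norm (K (x - z) - K (x' - z)) = norm (x - x') / (2 * pi * (norm (x - z) * norm (x' - z)))"
      by (simp add: mult.assoc)
    also have "\<dots> \<le> ?c"
      unfolding power2_eq_square using n \<rho>(1) by (intro divide_left_mono mult_left_mono mult_mono mult_pos_pos) auto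
    finally show ?thesis
      by (simp only: norm_scaleR real_norm_def abs_of_nonneg[OF nn]) (rule mult_left_mono[OF _ nn])
  qed (simp add: vanish)
  have "norm (kernel x - kernel x') = norm (LINT z|lborel. \<psi> z *\<^sub>R (K (x - z) - K (x' - z)))"
    unfolding k(1) scaleR_diff_right by (subst Bochner_Integration.integral_diff[OF k(2) k(2)]) simp
  also have "\<dots> \<le> (LINT z|lborel. \<psi> z * ?c)"
  proof (rule order_trans[OF integral_norm_bound integral_mono[OF _ _ pt]])
    show "integrable lborel (\<lambda>z. norm (\<psi> z *\<^sub>R (K (x - z) - K (x' - z))))"
      unfolding scaleR_diff_right by (intro integrable_norm Bochner_Integration.integrable_diff k(2))
    show "integrable lborel (\<lambda>z. \<psi> z * ?c)" using test_fun_integrable[OF test_fun] by simp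
  qed
  also have "\<dots> = ?c" using one by simp
  finally show ?thesis .
qed

lemma kernel_has_derivative:
  "(kernel has_derivative (\<lambda>h. LINT y|lborel. \<psi>' (x - y) h *\<^sub>R K y)) (at x)"
proof -
  have [measurable]: "(\<lambda>z. \<psi>' z h) \<in> borel_measurable borel" for h
    using deriv_cont by (rule borel_measurable_continuous_onI)
  let ?D = "\<lambda>h. LINT y|lborel. \<psi>' (x - y) h *\<^sub>R K y"
  have i: "integrable lborel (\<lambda>y. \<psi>' (x - y) h *\<^sub>R K y)" for h
  proof -
    obtain B where B: "\<And>z. \<bar>\<psi>' z h\<bar> \<le> B" "0 \<le> B" using test_fun_bounded[OF test_fun_deriv] by blast
    show ?thesis
    proof (rule integral_against_K(1)[OF _ r_pos B(2)])
      show "\<bar>\<psi>' (x - y) h\<bar> \<le> B * (indicator (cball x r) y + indicator (cball x r) y)" for y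
        using deriv_vanish[of "x - y" h] B(1)[of "x - y"] B(2) by (auto simp: indicator_def dist_norm)
    qed measurable
  qed
  have lin: "linear ?D"
  proof (rule linearI)
    fix h k
    show "?D (h + k) = ?D h + ?D k"
      unfolding linear_add[OF linear_deriv] scaleR_left_distrib
      by (rule Bochner_Integration.integral_add) (rule i)+
  next
    fix c h
    show "?D (c *\<^sub>R h) = c *\<^sub>R ?D h"
      unfolding linear_scale[OF linear_deriv] real_scaleR_def scaleR_scaleR[symmetric]
      by (rule integral_scaleR_right)
  qed
  show ?thesis
    unfolding has_derivative_at_alt
  proof (intro conjI allI impI)
    show "bounded_linear ?D" using lin by (simp add: linear_linear)
    fix e :: real assume "0 < e"
    \<comment> \<open>Cancels the factor \<open>5 * r\<close> of
      \<open>integral_against_K\<close>.\<close>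
    define e' where "e' = e / (5 * r)"
    have e': "0 < e'" using \<open>0 < e\<close> r_pos by (simp add: e'_def)
    obtain d where d: "0 < d" "\<And>z h. norm h < d \<Longrightarrow> \<bar>\<psi> (z + h) - \<psi> z - \<psi>' z h\<bar> \<le> e' * norm h"
      using uniformly_differentiable[OF e'] by blast
    show "\<exists>d>0. \<forall>y. norm (y - x) < d \<longrightarrow> norm (kernel y - kernel x - ?D (y - x)) \<le> e * norm (y - x)"
    proof (intro exI[of _ d] conjI allI impI d)
      fix x' assume x': "norm (x' - x) < d"
      let ?h = "x' - x"
      have "kernel x' - kernel x - ?D ?h = (LINT y|lborel. (\<psi> (x' - y) - \<psi> (x - y) - \<psi>' (x - y) ?h) *\<^sub>R K y)"
        unfolding kernel_def scaleR_left_diff_distrib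
        by (simp only: Bochner_Integration.integral_diff[OF Bochner_Integration.integrable_diff[OF
            integrable_kernel integrable_kernel] i] Bochner_Integration.integral_diff[OF integrable_kernel integrable_kernel])
      also have "norm \<dots> \<le> 5 * r * (e' * norm ?h)"
      proof (rule integral_against_K(2)[OF _ r_pos])
        fix y
        have "x - y + ?h = x' - y" by simp
        then show "\<bar>\<psi> (x' - y) - \<psi> (x - y) - \<psi>' (x - y) ?h\<bar> \<le> e' * norm ?h * (indicator (cball x r) y + indicator (cball x' r) y)"
          using d(2)[OF x', of "x - y"] e' vanish[of "x' - y"] vanish[of "x - y"] deriv_vanish[of "x - y" ?h]
          by (auto simp: indicator_def dist_norm)
      qed (use e' in \<open>measurable, auto\<close>)
      also have "\<dots> = e * norm ?h" using r_pos by (simp add: e'_def)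
      finally show "norm (kernel x' - kernel x - ?D (x' - x)) \<le> e * norm (x' - x)" .
    qed
  qed
qed

end

section \<open>Reflection symmetry and the vanishing divergence\<close>

lemma lborel_integral_orthogonal:
  fixes F S :: "plane \<Rightarrow> plane"
  assumes F: "integrable lborel F" and S: "orthogonal_transformation S"
  shows "(LINT x|lborel. F (S x)) = (LINT x|lborel. F x)"
proof -
  have lin: "linear S" and bij: "bij S"
    by (intro orthogonal_transformation_linear orthogonal_transformation_bij S)+
  have det: "\<bar>det (matrix S)\<bar> = 1" using S by (simp add: orthogonal_transformation_det)
  have [measurable]: "S \<in> borel_measurable borel"
    using lin by (intro borel_measurable_continuous_onI linear_continuous_on) (simp add: linear_linear)
  have [measurable]: "F \<in> borel_measurable borel" using F by auto
  have "integrable lebesgue F" using F by (simp add: integrable_completion)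
  then have a: "F absolutely_integrable_on UNIV" by (simp add: set_integrable_def)
  have "(\<lambda>x. \<bar>det (matrix S)\<bar> *\<^sub>R F (S x)) absolutely_integrable_on UNIV \<and>
     integral UNIV (\<lambda>x. \<bar>det (matrix S)\<bar> *\<^sub>R F (S x)) = integral UNIV F"
    using has_absolute_integral_change_of_variables[of UNIV S "\<lambda>_. S" F "integral UNIV F"]
      linear_imp_has_derivative[OF lin] bij a by (auto simp: bij_def)
  then have "(\<lambda>x. F (S x)) absolutely_integrable_on UNIV" "integral UNIV (\<lambda>x. F (S x)) = integral UNIV F"
    by (simp_all add: det)
  then have "(LINT x|lebesgue. F (S x)) = (LINT x|lebesgue. F x)"
    using set_lebesgue_integral_eq_integral(2)[OF a] set_lebesgue_integral_eq_integral(2)[of UNIV "\<lambda>x. F (S x)"]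
    by (simp add: set_lebesgue_integral_def)
  then show ?thesis by (simp add: integral_completion)
qed

text \<open>For \<open>a\<^sup>2 + b\<^sup>2 = 1\<close>, with (a, b) = (cos s, sin s), this is the
  reflection in the line through the origin at angle s/2.\<close>

definition reflection :: "real \<Rightarrow> real \<Rightarrow> plane \<Rightarrow> plane" where
  "reflection a b x = vector [a * x $ 1 + b * x $ 2, b * x $ 1 - a * x $ 2]"

lemma linear_reflection: "linear (reflection a b)"
  by (rule linearI) (auto simp: reflection_def vec_eq_iff forall_2 algebra_simps)

lemma norm_reflection:
  assumes "a\<^sup>2 + b\<^sup>2 = 1" shows "norm (reflection a b x) = norm x"
proof -
  have "(a * x $ 1 + b * x $ 2)\<^sup>2 + (b * x $ 1 - a * x $ 2)\<^sup>2 = (a\<^sup>2 + b\<^sup>2) * ((x$1)\<^sup>2 + (x$2)\<^sup>2)"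
    by (simp add: power2_eq_square algebra_simps)
  then show ?thesis using assms by (simp add: norm_plane reflection_def)
qed

lemma orthogonal_reflection: "a\<^sup>2 + b\<^sup>2 = 1 \<Longrightarrow> orthogonal_transformation (reflection a b)"
  by (simp add: orthogonal_transformation linear_reflection norm_reflection)

text \<open>The sign arises because a reflection anticommutes with the quarter turn that builds
  \<open>K\<close> from a radial field.\<close>

lemma K_reflection:
  assumes "a\<^sup>2 + b\<^sup>2 = 1" shows "K (reflection a b x) = - reflection a b (K x)"
  unfolding K_def norm_reflection[OF assms]
  by (simp add: vec_eq_iff forall_2 reflection_def algebra_simps add_divide_distrib diff_divide_distrib)

text \<open>The line through the origin and \<open>x\<close> is the mirror: \<open>a\<close> and
  \<open>b\<close> are cosine and sine of twice the polar angle of \<open>x\<close>, written without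
  angles.\<close>

lemma reflection_fixing:
  obtains a b where "a\<^sup>2 + b\<^sup>2 = 1" "reflection a b x = x"
proof (cases "x = 0")
  case True then show ?thesis by (intro that[of 1 0]) (auto simp: reflection_def vec_eq_iff forall_2)
next
  case False
  define n where "n = (x$1)\<^sup>2 + (x$2)\<^sup>2"
  have n: "n \<noteq> 0" using False by (simp add: n_def vec_eq_iff forall_2 sum_power2_eq_zero_iff)
  define a where "a = ((x$1)\<^sup>2 - (x$2)\<^sup>2) / n"
  define b where "b = 2 * x$1 * x$2 / n"
  have ab: "a * n = (x$1)\<^sup>2 - (x$2)\<^sup>2" "b * n = 2 * x$1 * x$2" using n by (simp_all add: a_def b_def)
  have "(a\<^sup>2 + b\<^sup>2) * n\<^sup>2 = (a * n)\<^sup>2 + (b * n)\<^sup>2" by (simp add: algebra_simps power2_eq_square)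
  also have "\<dots> = 1 * n\<^sup>2" unfolding ab by (simp add: n_def algebra_simps power2_eq_square)
  finally have 1: "a\<^sup>2 + b\<^sup>2 = 1" using n by simp
  have "(a * x$1 + b * x$2) * n = (a * n) * x$1 + (b * n) * x$2" by (simp add: algebra_simps)
  also have "\<dots> = x$1 * n" unfolding ab by (simp add: n_def algebra_simps power2_eq_square)
  finally have 2: "a * x$1 + b * x$2 = x$1" using n by simp
  have "(b * x$1 - a * x$2) * n = (b * n) * x$1 - (a * n) * x$2" by (simp add: algebra_simps)
  also have "\<dots> = x$2 * n" unfolding ab by (simp add: n_def algebra_simps power2_eq_square)
  finally have 3: "b * x$1 - a * x$2 = x$2" using n by simp
  show ?thesis using 1 2 3 by (intro that[of a b]) (auto simp: reflection_def vec_eq_iff forall_2)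
qed

text \<open>Conjugating by the reflection turns \<open>D\<close> into its negative, while the trace
  is invariant under conjugation; the proof reads this off the matrix entries.\<close>

lemma trace_zero_of_reflection:
  assumes D: "linear D" and ab: "a\<^sup>2 + b\<^sup>2 = 1" and anti: "\<And>h. D (reflection a b h) = - reflection a b (D h)"
  shows "trace (matrix D) = 0"
proof -
  define p q s t where "p = D (axis 1 1) $ 1" and "q = D (axis 1 1) $ 2"
    and "s = D (axis 2 1) $ 1" and "t = D (axis 2 1) $ 2"
  have e1: "reflection a b (axis 1 1) = a *\<^sub>R axis 1 1 + b *\<^sub>R axis 2 1"
    and e2: "reflection a b (axis 2 1) = b *\<^sub>R axis 1 1 - a *\<^sub>R axis 2 1"
    by (simp_all add: reflection_def vec_eq_iff forall_2 axis_def)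
  have "a *\<^sub>R D (axis 1 1) + b *\<^sub>R D (axis 2 1) = - reflection a b (D (axis 1 1))"
    using anti[of "axis 1 1"] unfolding e1 by (simp add: linear_add[OF D] linear_scale[OF D])
  then have 1: "a * p + b * s = - (a * p + b * q)" "a * q + b * t = - (b * p - a * q)"
    by (simp_all add: vec_eq_iff forall_2 reflection_def p_def q_def s_def t_def)
  have "b *\<^sub>R D (axis 1 1) - a *\<^sub>R D (axis 2 1) = - reflection a b (D (axis 2 1))"
    using anti[of "axis 2 1"] unfolding e2 by (simp add: linear_diff[OF D] linear_scale[OF D])
  then have 2: "b * q - a * t = - (b * s - a * t)"
    by (simp_all add: vec_eq_iff forall_2 reflection_def p_def q_def s_def t_def)
  have "b * (p + t) = 0" "a * (p + t) = 0" using 1 2 by (simp_all add: algebra_simps)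
  then have "p + t = 0" using ab by (auto simp: power2_eq_square)
  then show ?thesis by (simp add: trace_def sum_2 matrix_def p_def t_def)
qed

context c1_bump begin

text \<open>Substitute \<open>y\<close> by its mirror image: the radial bump is unchanged and
  \<open>K\<close> picks up the sign.\<close>

lemma kernel_reflection:
  assumes radial: "\<And>x y. norm x = norm y \<Longrightarrow> \<psi> x = \<psi> y" and ab: "a\<^sup>2 + b\<^sup>2 = 1"
  shows "kernel (reflection a b x) = - reflection a b (kernel x)"
proof -
  let ?S = "reflection a b"
  have bl: "bounded_linear ?S" using linear_reflection linear_linear by blast
  have "kernel (?S x) = (LINT y|lborel. \<psi> (?S x - ?S y) *\<^sub>R K (?S y))"
    unfolding kernel_def
    by (rule lborel_integral_orthogonal[OF integrable_kernel orthogonal_reflection[OF ab], symmetric])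
  also have "\<dots> = (LINT y|lborel. - ?S (\<psi> (x - y) *\<^sub>R K y))"
  proof (rule Bochner_Integration.integral_cong[OF refl])
    fix y
    have "\<psi> (?S x - ?S y) = \<psi> (x - y)"
      by (rule radial) (simp add: norm_reflection[OF ab] flip: linear_diff[OF linear_reflection])
    then show "\<psi> (?S x - ?S y) *\<^sub>R K (?S y) = - ?S (\<psi> (x - y) *\<^sub>R K y)"
      by (simp add: K_reflection[OF ab] linear_scale[OF linear_reflection])
  qed
  also have "\<dots> = - ?S (kernel x)"
    unfolding kernel_def using integral_bounded_linear[OF bl integrable_kernel] by simp
  finally show ?thesis .
qed

text \<open>At a point fixed by a reflection \<open>S\<close>, differentiating \<open>kernel \<circ> S = - (S \<circ> kernel)\<close> shows that the
  derivative anticommutes with \<open>S\<close>; no explicit formula for the kernel is needed.\<close>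

lemma kernel_div_free:
  assumes radial: "\<And>x y. norm x = norm y \<Longrightarrow> \<psi> x = \<psi> y"
  shows "\<exists>D. (kernel has_derivative D) (at x) \<and> trace (matrix D) = 0"
proof -
  obtain D where D: "(kernel has_derivative D) (at x)" using kernel_has_derivative by blast
  obtain a b where ab: "a\<^sup>2 + b\<^sup>2 = 1" and fix_x: "reflection a b x = x" by (rule reflection_fixing)
  let ?S = "reflection a b"
  have S: "(?S has_derivative ?S) (at y)" for y by (rule linear_imp_has_derivative[OF linear_reflection])
  have "((\<lambda>y. kernel (?S y)) has_derivative (\<lambda>h. D (?S h))) (at x)"
    by (rule has_derivative_compose[OF S]) (simp add: fix_x D)
  then have "((\<lambda>y. - ?S (kernel y)) has_derivative (\<lambda>h. D (?S h))) (at x)"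
    by (simp only: kernel_reflection[OF radial ab])
  moreover have "((\<lambda>y. - ?S (kernel y)) has_derivative (\<lambda>h. - ?S (D h))) (at x)"
    by (intro has_derivative_minus has_derivative_compose[OF D S])
  ultimately have "(\<lambda>h. D (?S h)) = (\<lambda>h. - ?S (D h))"
    by (rule has_derivative_unique)
  then have "trace (matrix D) = 0"
    by (intro trace_zero_of_reflection[OF has_derivative_linear[OF D] ab]) metis
  then show ?thesis using D by blast
qed

end

section \<open>Mollified vorticities and lattice squares\<close>

lemma mollifierD:
  assumes "mollifier \<phi>"
  shows "smooth_on \<phi> UNIV" "0 \<le> \<phi> x" "norm x = norm y \<Longrightarrow> \<phi> x = \<phi> y"
    "fsupport \<phi> \<subseteq> cball 0 1" "(LINT x|lebesgue. \<phi> x) = 1"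
proof -
  note m = assms[unfolded mollifier_def]
  show "smooth_on \<phi> UNIV" by (rule m[THEN conjunct1])
  show "0 \<le> \<phi> x" by (rule m[THEN conjunct2, THEN conjunct1, rule_format])
  show "fsupport \<phi> \<subseteq> cball 0 1" by (rule m[THEN conjunct2, THEN conjunct2, THEN conjunct2, THEN conjunct1])
  show "(LINT x|lebesgue. \<phi> x) = 1" by (rule m[THEN conjunct2, THEN conjunct2, THEN conjunct2, THEN conjunct2])
  show "norm x = norm y \<Longrightarrow> \<phi> x = \<phi> y"
    by (rule m[THEN conjunct2, THEN conjunct2, THEN conjunct1, rule_format])
qed

lemma mollifier_vanish:
  assumes "mollifier \<phi>" "1 < norm x" shows "\<phi> x = 0"
proof (rule ccontr)
  assume "\<phi> x \<noteq> 0"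
  then have "x \<in> fsupport \<phi>" unfolding fsupport_def using closure_subset[of "{x. \<phi> x \<noteq> 0}"] by auto
  then show False using mollifierD(4)[OF assms(1)] assms(2) by auto
qed

lemma mollifier_derivative:
  assumes "mollifier \<phi>"
  obtains \<phi>' where "\<And>z. (\<phi> has_derivative \<phi>' z) (at z)" "\<And>h. continuous_on UNIV (\<lambda>z. \<phi>' z h)"
proof -
  have "Ck_on (Suc 0) \<phi> UNIV" using mollifierD(1)[OF assms] unfolding smooth_on_def by blast
  then show ?thesis using that by auto
qed

lemma mollifier_bump:
  assumes "mollifier \<phi>" "0 < \<epsilon>" shows "\<exists>\<psi>'. c1_bump (rescale \<phi> \<epsilon>) \<psi>' \<epsilon>"
proof -
  obtain \<phi>' where \<phi>': "\<And>z. (\<phi> has_derivative \<phi>' z) (at z)" "\<And>h. continuous_on UNIV (\<lambda>z. \<phi>' z h)"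
    using mollifier_derivative[OF assms(1)] by blast
  have "c1_bump (rescale \<phi> \<epsilon>) (\<lambda>z h. \<phi>' (z /\<^sub>R \<epsilon>) (h /\<^sub>R \<epsilon>) / \<epsilon>\<^sup>2) \<epsilon>"
  proof
    fix z h :: plane
    have "((\<lambda>z. z /\<^sub>R \<epsilon>) has_derivative (\<lambda>h. h /\<^sub>R \<epsilon>)) (at z)"
      by (auto intro!: derivative_eq_intros)
    from has_derivative_compose[OF this \<phi>'(1)]
    have "((\<lambda>z. \<phi> (z /\<^sub>R \<epsilon>) / \<epsilon>\<^sup>2) has_derivative (\<lambda>h. \<phi>' (z /\<^sub>R \<epsilon>) (h /\<^sub>R \<epsilon>) / \<epsilon>\<^sup>2)) (at z)"
      by (rule bounded_linear.has_derivative[OF bounded_linear_divide])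
    then show "(rescale \<phi> \<epsilon> has_derivative (\<lambda>h. \<phi>' (z /\<^sub>R \<epsilon>) (h /\<^sub>R \<epsilon>) / \<epsilon>\<^sup>2)) (at z)"
      by (simp add: rescale_def[abs_def])
    show "continuous_on UNIV (\<lambda>z. \<phi>' (z /\<^sub>R \<epsilon>) (h /\<^sub>R \<epsilon>) / \<epsilon>\<^sup>2)"
      using assms(2) by (intro continuous_intros continuous_on_compose2[OF \<phi>'(2)]) auto
    show "rescale \<phi> \<epsilon> z = 0" if "\<epsilon> < norm z"
    proof -
      have "1 < norm (z /\<^sub>R \<epsilon>)" using that assms(2) by (simp add: field_simps)
      then show ?thesis unfolding rescale_def by (simp add: mollifier_vanish[OF assms(1)])
    qed
  qed (rule assms(2))
  then show ?thesis by blast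
qed

lemma rescale_1: "rescale \<phi> 1 = \<phi>"
  by (simp add: rescale_def fun_eq_iff)

lemma mollifier_test_fun: "mollifier \<phi> \<Longrightarrow> test_fun \<phi>"
  using mollifier_bump[of \<phi> 1] c1_bump.test_fun by (auto simp: rescale_1)

lemma mollifier_lipschitz:
  assumes "mollifier \<phi>" obtains \<Lambda> where "0 \<le> \<Lambda>" "\<And>x y. \<bar>\<phi> x - \<phi> y\<bar> \<le> \<Lambda> * norm (x - y)"
proof -
  obtain \<psi>' where "c1_bump (rescale \<phi> 1) \<psi>' 1" using mollifier_bump[OF assms, of 1] by auto
  then show ?thesis using c1_bump.lipschitz_bump that unfolding rescale_1 by blast
qed

lemma rescale_nonneg: "mollifier \<phi> \<Longrightarrow> 0 \<le> rescale \<phi> \<epsilon> x"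
  by (simp add: rescale_def mollifierD(2))

lemma rescale_radial: "mollifier \<phi> \<Longrightarrow> norm x = norm y \<Longrightarrow> rescale \<phi> \<epsilon> x = rescale \<phi> \<epsilon> y"
  unfolding rescale_def using mollifierD(3)[of \<phi> "x /\<^sub>R \<epsilon>" "y /\<^sub>R \<epsilon>"] by simp

lemma rescale_lipschitz:
  assumes "\<And>x y. \<bar>\<phi> x - \<phi> y\<bar> \<le> \<Lambda> * norm (x - y)" "0 < \<epsilon>"
  shows "\<bar>rescale \<phi> \<epsilon> x - rescale \<phi> \<epsilon> y\<bar> \<le> \<Lambda> / \<epsilon> ^ 3 * norm (x - y)"
proof -
  have "\<bar>rescale \<phi> \<epsilon> x - rescale \<phi> \<epsilon> y\<bar> = \<bar>\<phi> (x /\<^sub>R \<epsilon>) - \<phi> (y /\<^sub>R \<epsilon>)\<bar> / \<epsilon>\<^sup>2"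
    by (simp add: rescale_def flip: diff_divide_distrib)
  also have "\<dots> \<le> \<Lambda> * norm (x /\<^sub>R \<epsilon> - y /\<^sub>R \<epsilon>) / \<epsilon>\<^sup>2" by (intro divide_right_mono assms) auto
  also have "\<dots> = \<Lambda> / \<epsilon> ^ 3 * norm (x - y)"
  proof -
    have "norm (x /\<^sub>R \<epsilon> - y /\<^sub>R \<epsilon>) = norm (x - y) / \<epsilon>"
      using assms(2) by (simp only: scaleR_diff_right[symmetric] norm_scaleR) (simp add: divide_inverse)
    then show ?thesis using assms(2) by (simp add: power2_eq_square power3_eq_cube field_simps)
  qed
  finally show ?thesis .
qed

lemma rescale_integral:
  assumes "mollifier \<phi>" "0 < \<epsilon>" shows "(LINT x|lborel. rescale \<phi> \<epsilon> x) = 1"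
proof -
  obtain \<psi>' where "c1_bump (rescale \<phi> \<epsilon>) \<psi>' \<epsilon>" using mollifier_bump assms by blast
  then interpret c1_bump "rescale \<phi> \<epsilon>" \<psi>' \<epsilon> .
  have [measurable]: "\<phi> \<in> borel_measurable borel"
    using test_fun_integrable[OF mollifier_test_fun[OF assms(1)]] by auto
  have "(LINT x|lborel. rescale \<phi> \<epsilon> x) = \<epsilon>\<^sup>2 *\<^sub>R (LINT x|lborel. rescale \<phi> \<epsilon> (0 + \<epsilon> *\<^sub>R x))"
    using lborel_integral_affine(1)[of "rescale \<phi> \<epsilon>" \<epsilon> 0] assms(2) by simp
  also have "\<dots> = (LINT x|lborel. \<phi> x)" using assms(2) by (simp add: rescale_def)
  also have "\<dots> = (LINT x|lebesgue. \<phi> x)" by (rule integral_completion[symmetric]) measurable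
  finally show ?thesis using mollifierD(5)[OF assms(1)] by simp
qed

lemma rescale_measurable:
  assumes "mollifier \<phi>" "0 < \<epsilon>" shows "rescale \<phi> \<epsilon> \<in> borel_measurable borel"
  using mollifier_bump[OF assms] c1_bump.measurable_bump by blast

lemma rescale_nn_integral:
  assumes "mollifier \<phi>" "0 < \<epsilon>" shows "(\<integral>\<^sup>+x. ennreal (rescale \<phi> \<epsilon> x) \<partial>lborel) = 1"
proof -
  obtain \<psi>' where "c1_bump (rescale \<phi> \<epsilon>) \<psi>' \<epsilon>" using mollifier_bump assms by blast
  then interpret c1_bump "rescale \<phi> \<epsilon>" \<psi>' \<epsilon> .
  show ?thesis
    using nn_integral_eq_integral[OF test_fun_integrable[OF test_fun]] rescale_nonneg[OF assms(1)]
      rescale_integral[OF assms] by auto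
qed

section \<open>Masses of mollified densities, uniformly in the mollification radius\<close>

lemma lborel_nn_integral_reflect:
  fixes F :: "'a::euclidean_space \<Rightarrow> ennreal"
  assumes [measurable]: "F \<in> borel_measurable borel"
  shows "(\<integral>\<^sup>+x. F (t - x) \<partial>lborel) = (\<integral>\<^sup>+x. F x \<partial>lborel)"
  by (subst (2) lborel_affine[of "-1" t]) (simp_all add: nn_integral_density nn_integral_distr)

lemma lborel_nn_integral_translate:
  fixes F :: "'a::euclidean_space \<Rightarrow> ennreal"
  assumes [measurable]: "F \<in> borel_measurable borel"
  shows "(\<integral>\<^sup>+x. F (x - t) \<partial>lborel) = (\<integral>\<^sup>+x. F x \<partial>lborel)"
  by (subst (2) lborel_affine[of 1 "- t"]) (simp_all add: nn_integral_density nn_integral_distr)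

text \<open>Splitting the density at height \<open>M\<close>: the bounded part has a mollification bounded by \<open>M\<close>, the
  rest keeps its mass.  This is uniform in the mollification parameter.\<close>

lemma mollified_mass_split:
  assumes j: "mollifier j" and \<delta>: "0 < \<delta>" and g: "integrable lborel g" and M: "0 \<le> M"
    and B [measurable]: "B \<in> sets borel"
  shows "(\<integral>\<^sup>+x. ennreal \<bar>LINT y|lborel. rescale j \<delta> (x - y) *\<^sub>R g y\<bar> * indicator B x \<partial>lborel) \<le>
    ennreal M * emeasure lborel B + (\<integral>\<^sup>+y. ennreal \<bar>g y\<bar> * indicator {y. M < \<bar>g y\<bar>} y \<partial>lborel)"
proof -
  note [measurable] = rescale_measurable[OF j \<delta>]
  have [measurable]: "g \<in> borel_measurable borel" using g by auto
  let ?k = "rescale j \<delta>" and ?G = "\<lambda>y. ennreal \<bar>g y\<bar> * indicator {y. M < \<bar>g y\<bar>} y"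
  note k0 = rescale_nonneg[OF j]
  have one: "(\<integral>\<^sup>+y. ennreal (?k (x - y)) \<partial>lborel) = 1" "(\<integral>\<^sup>+x. ennreal (?k (x - y)) \<partial>lborel) = 1" for x y
    using lborel_nn_integral_reflect[of "\<lambda>y. ennreal (?k y)" x] lborel_nn_integral_translate[of "\<lambda>y. ennreal (?k y)" y]
      rescale_nn_integral[OF j \<delta>] by auto
  have pt: "ennreal \<bar>LINT y|lborel. ?k (x - y) *\<^sub>R g y\<bar> \<le> ennreal M + (\<integral>\<^sup>+y. ennreal (?k (x - y)) * ?G y \<partial>lborel)" for x
  proof -
    have "ennreal \<bar>LINT y|lborel. ?k (x - y) *\<^sub>R g y\<bar> \<le> (\<integral>\<^sup>+y. ennreal (norm (?k (x - y) *\<^sub>R g y)) \<partial>lborel)"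
    \<comment> \<open>A non-integrable integrand has integral 0 by convention, so the bound is
      trivial there.\<close>
    proof (cases "integrable lborel (\<lambda>y. ?k (x - y) *\<^sub>R g y)")
      case True then show ?thesis using integral_norm_bound_ennreal[OF True] by simp
    qed (simp add: not_integrable_integral_eq)
    also have "\<dots> \<le> (\<integral>\<^sup>+y. ennreal M * ennreal (?k (x - y)) + ennreal (?k (x - y)) * ?G y \<partial>lborel)"
    proof (rule nn_integral_mono)
      fix y
      have "ennreal (norm (?k (x - y) *\<^sub>R g y)) = ennreal (?k (x - y)) * ennreal \<bar>g y\<bar>"
        using k0 by (simp add: abs_mult ennreal_mult)
      also have "\<dots> \<le> ennreal (?k (x - y)) * (ennreal M + ?G y)"
        by (intro mult_left_mono) (auto simp: indicator_def not_less ennreal_leI)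
      finally show "ennreal (norm (?k (x - y) *\<^sub>R g y)) \<le> ennreal M * ennreal (?k (x - y)) + ennreal (?k (x - y)) * ?G y"
        by (simp add: distrib_left mult.commute)
    qed
    also have "\<dots> = ennreal M + (\<integral>\<^sup>+y. ennreal (?k (x - y)) * ?G y \<partial>lborel)"
      by (subst nn_integral_add, measurable, subst nn_integral_cmult, measurable) (simp add: one)
    finally show ?thesis .
  qed
  have "(\<integral>\<^sup>+x. ennreal \<bar>LINT y|lborel. ?k (x - y) *\<^sub>R g y\<bar> * indicator B x \<partial>lborel) \<le>
     (\<integral>\<^sup>+x. ennreal M * indicator B x + (\<integral>\<^sup>+y. ennreal (?k (x - y)) * ?G y \<partial>lborel) \<partial>lborel)"
    by (rule nn_integral_mono) (use pt in \<open>auto simp: indicator_def\<close>)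
  also have "\<dots> = ennreal M * emeasure lborel B + (\<integral>\<^sup>+x. (\<integral>\<^sup>+y. ennreal (?k (x - y)) * ?G y \<partial>lborel) \<partial>lborel)"
    by (subst nn_integral_add, measurable) (simp add: nn_integral_cmult_indicator)
  also have "(\<integral>\<^sup>+x. (\<integral>\<^sup>+y. ennreal (?k (x - y)) * ?G y \<partial>lborel) \<partial>lborel) =
      (\<integral>\<^sup>+y. (\<integral>\<^sup>+x. ennreal (?k (x - y)) * ?G y \<partial>lborel) \<partial>lborel)"
    by (rule lborel_pair.Fubini') measurable
  also have "\<dots> = (\<integral>\<^sup>+y. ?G y \<partial>lborel)"
    by (subst nn_integral_multc, measurable) (simp add: one)
  finally show ?thesis .
qed

lemma integral_tail_small:
  fixes g :: "'a \<Rightarrow> real"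
  assumes g: "integrable A g" and "0 < \<eta>"
  obtains M where "0 \<le> M" "(\<integral>\<^sup>+y. ennreal \<bar>g y\<bar> * indicator {y. M < \<bar>g y\<bar>} y \<partial>A) \<le> ennreal \<eta>"
proof -
  have [measurable]: "g \<in> borel_measurable A" using g by auto
  let ?f = "\<lambda>(n::nat) y. \<bar>g y\<bar> * indicator {y. real n < \<bar>g y\<bar>} y"
  have "(\<lambda>n. LINT y|A. ?f n y) \<longlonglongrightarrow> (LINT y|A. 0)"
  proof (rule integral_dominated_convergence[where w = "\<lambda>y. \<bar>g y\<bar>"])
    show "AE y in A. (\<lambda>n. ?f n y) \<longlonglongrightarrow> 0"
    proof (rule AE_I2)
      fix y
      obtain m :: nat where m: "\<bar>g y\<bar> < real m" using reals_Archimedean2 by blast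
      have "\<forall>\<^sub>F n in sequentially. 0 = ?f n y"
        using eventually_ge_at_top[of m] by eventually_elim (use m in \<open>auto simp: indicator_def\<close>)
      then show "(\<lambda>n. ?f n y) \<longlonglongrightarrow> 0" by (rule Lim_transform_eventually[OF tendsto_const])
    qed
    show "AE y in A. norm (?f n y) \<le> \<bar>g y\<bar>" for n by (auto simp: indicator_def)
  qed (use g in auto)
  then have "\<forall>\<^sub>F n in sequentially. (LINT y|A. ?f n y) < \<eta>"
    by (rule order_tendstoD) (use \<open>0 < \<eta>\<close> in simp)
  then obtain n where n: "(LINT y|A. ?f n y) < \<eta>" by (auto simp: eventually_sequentially)
  have i: "integrable A (?f n)"
    by (rule Bochner_Integration.integrable_bound[OF integrable_abs[OF g]]) (auto simp: indicator_def)
  have "(\<integral>\<^sup>+y. ennreal \<bar>g y\<bar> * indicator {y. real n < \<bar>g y\<bar>} y \<partial>A) = (\<integral>\<^sup>+y. ennreal (?f n y) \<partial>A)"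
    by (intro nn_integral_cong) (auto simp: indicator_def)
  also have "\<dots> = ennreal (LINT y|A. ?f n y)" by (rule nn_integral_eq_integral[OF i]) auto
  also have "\<dots> \<le> ennreal \<eta>" using n by (simp add: ennreal_leI)
  finally show ?thesis by (intro that[of "real n"]) auto
qed

text \<open>\<open>\<omega>\<close> is merely Lebesgue measurable. A Borel representative changes no
  convolution with a Borel function at any point and makes Fubini's theorem for
  \<open>lborel\<close> applicable.\<close>

lemma conv_borel_version:
  fixes \<omega> :: "plane \<Rightarrow> real"
  assumes \<omega>: "integrable lebesgue \<omega>"
  obtains g where "integrable lborel g" "(\<integral>\<^sup>+y. ennreal \<bar>g y\<bar> \<partial>lborel) = (\<integral>\<^sup>+y. ennreal \<bar>\<omega> y\<bar> \<partial>lebesgue)"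
    "\<And>f x. f \<in> borel_measurable borel \<Longrightarrow> conv f \<omega> x = (LINT y|lborel. f (x - y) *\<^sub>R g y)"
proof -
  obtain g where [measurable]: "g \<in> borel_measurable lborel" and ae: "AE y in lborel. \<omega> y = g y"
    using completion_ex_borel_measurable_real[of \<omega> lborel] \<omega> by auto
  have ae': "AE y in lebesgue. \<omega> y = g y" using ae by (rule AE_completion)
  have gl: "integrable lebesgue g"
    by (rule integrable_cong_AE_imp[OF \<omega> _ ae']) (simp add: measurable_completion)
  show ?thesis
  proof (rule that[of g])
    show "integrable lborel g" using gl by (simp add: integrable_completion)
    have "(\<integral>\<^sup>+y. ennreal \<bar>\<omega> y\<bar> \<partial>lebesgue) = (\<integral>\<^sup>+y. ennreal \<bar>g y\<bar> \<partial>lebesgue)"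
      using ae' by (intro nn_integral_cong_AE) auto
    then show "(\<integral>\<^sup>+y. ennreal \<bar>g y\<bar> \<partial>lborel) = (\<integral>\<^sup>+y. ennreal \<bar>\<omega> y\<bar> \<partial>lebesgue)"
      by (simp add: nn_integral_completion)
    fix f :: "plane \<Rightarrow> real" and x assume [measurable]: "f \<in> borel_measurable borel"
    have [measurable]: "\<omega> \<in> borel_measurable lebesgue" using \<omega> by auto
    have m: "(\<lambda>y. f (x - y)) \<in> borel_measurable lebesgue" by (rule measurable_completion) measurable
    have m2: "(\<lambda>y. f (x - y) *\<^sub>R g y) \<in> borel_measurable lborel" by measurable
    have "conv f \<omega> x = (LINT y|lebesgue. f (x - y) *\<^sub>R g y)"
      unfolding conv_def
      by (rule integral_cong_AE) (use ae' m measurable_completion[OF m2] in \<open>auto intro!: borel_measurable_scaleR\<close>)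
    also have "\<dots> = (LINT y|lborel. f (x - y) *\<^sub>R g y)" by (rule integral_completion[OF m2])
    finally show "conv f \<omega> x = (LINT y|lborel. f (x - y) *\<^sub>R g y)" .
  qed
qed

text \<open>The height \<open>M\<close> is fixed before \<open>\<delta>\<close>; this matters
  because the mollification radius is an arbitrary function of the scale.\<close>

lemma mollified_equiintegrable:
  assumes j: "mollifier j" and \<omega>: "integrable lebesgue \<omega>" and "0 < \<eta>"
  obtains M where "0 \<le> M"
    "\<And>\<delta> B. 0 < \<delta> \<Longrightarrow> B \<in> sets borel \<Longrightarrow>
      (\<integral>\<^sup>+x. ennreal \<bar>conv (rescale j \<delta>) \<omega> x\<bar> * indicator B x \<partial>lborel) \<le> ennreal M * emeasure lborel B + ennreal \<eta>"
proof -
  obtain g where g: "integrable lborel g" "(\<integral>\<^sup>+y. ennreal \<bar>g y\<bar> \<partial>lborel) = (\<integral>\<^sup>+y. ennreal \<bar>\<omega> y\<bar> \<partial>lebesgue)"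
    "\<And>f x. f \<in> borel_measurable borel \<Longrightarrow> conv f \<omega> x = (LINT y|lborel. f (x - y) *\<^sub>R g y)"
    by (rule conv_borel_version[OF \<omega>]) blast
  obtain M where M: "0 \<le> M" "(\<integral>\<^sup>+y. ennreal \<bar>g y\<bar> * indicator {y. M < \<bar>g y\<bar>} y \<partial>lborel) \<le> ennreal \<eta>"
    using integral_tail_small[OF g(1) \<open>0 < \<eta>\<close>] by blast
  show ?thesis
  proof (rule that[OF M(1)])
    fix \<delta> :: real and B :: "plane set" assume "0 < \<delta>" "B \<in> sets borel"
    then show "(\<integral>\<^sup>+x. ennreal \<bar>conv (rescale j \<delta>) \<omega> x\<bar> * indicator B x \<partial>lborel) \<le> ennreal M * emeasure lborel B + ennreal \<eta>"
      unfolding g(3)[OF rescale_measurable[OF j \<open>0 < \<delta>\<close>]]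
      by (rule order_trans[OF mollified_mass_split[OF j _ g(1) M(1)] add_left_mono[OF M(2)]])
  qed
qed

lemma Lp_norm_1:
  assumes "integrable lebesgue \<omega>"
  shows "(\<integral>\<^sup>+y. ennreal \<bar>\<omega> y\<bar> \<partial>lebesgue) = ennreal (enn2real (Lp_norm 1 \<omega>))"
proof -
  have f: "(\<integral>\<^sup>+y. ennreal \<bar>\<omega> y\<bar> \<partial>lebesgue) = ennreal (LINT y|lebesgue. \<bar>\<omega> y\<bar>)"
    by (rule nn_integral_eq_integral) (use assms in auto)
  have "(1::ennreal) \<noteq> \<infinity>" by simp
  then have "Lp_norm 1 \<omega> = ennreal (LINT y|lebesgue. \<bar>\<omega> y\<bar>)"
    unfolding Lp_norm_def using f by (simp add: Let_def)
  then show ?thesis using f by simp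
qed

lemma mollified_mass:
  assumes j: "mollifier j" and \<omega>: "integrable lebesgue \<omega>" and "0 < \<delta>"
  shows "(\<integral>\<^sup>+x. ennreal \<bar>conv (rescale j \<delta>) \<omega> x\<bar> \<partial>lborel) \<le> ennreal (enn2real (Lp_norm 1 \<omega>))"
proof -
  obtain g where g: "integrable lborel g" "(\<integral>\<^sup>+y. ennreal \<bar>g y\<bar> \<partial>lborel) = (\<integral>\<^sup>+y. ennreal \<bar>\<omega> y\<bar> \<partial>lebesgue)"
    "\<And>f x. f \<in> borel_measurable borel \<Longrightarrow> conv f \<omega> x = (LINT y|lborel. f (x - y) *\<^sub>R g y)"
    by (rule conv_borel_version[OF \<omega>]) blast
  \<comment> \<open>Height 0 on the whole plane: the first summand of the split is 0 times infinity,
    which is 0 in \<open>ennreal\<close>.\<close>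
  have "(\<integral>\<^sup>+x. ennreal \<bar>conv (rescale j \<delta>) \<omega> x\<bar> \<partial>lborel) \<le>
     (\<integral>\<^sup>+y. ennreal \<bar>g y\<bar> * indicator {y. 0 < \<bar>g y\<bar>} y \<partial>lborel)"
    using mollified_mass_split[OF j \<open>0 < \<delta>\<close> g(1), of 0 UNIV]
    unfolding g(3)[OF rescale_measurable[OF j \<open>0 < \<delta>\<close>]] by simp
  also have "\<dots> \<le> (\<integral>\<^sup>+y. ennreal \<bar>g y\<bar> \<partial>lborel)" by (intro nn_integral_mono) (auto simp: indicator_def)
  finally show ?thesis unfolding g(2) Lp_norm_1[OF \<omega>] .
qed

lemma mollified_support:
  assumes j: "mollifier j" and \<delta>: "0 < \<delta>" "\<delta> < 1"
    and \<omega>: "AE y in lebesgue. R < norm y \<longrightarrow> \<omega> y = 0" and x: "R + 1 < norm x"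
  shows "conv (rescale j \<delta>) \<omega> x = 0"
proof -
  have "AE y in lebesgue. rescale j \<delta> (x - y) *\<^sub>R \<omega> y = 0"
    using \<omega>
  proof eventually_elim
    case (elim y)
    show ?case
    proof (cases "R < norm y")
      case False
      then have "1 < norm (x - y)" using x norm_triangle_sub[of x y] by simp
      then have "\<delta> < norm (x - y)" using \<delta> by simp
      then have "1 < norm ((x - y) /\<^sub>R \<delta>)" using \<delta> by (simp only: norm_scaleR) (simp add: field_simps)
      then show ?thesis unfolding rescale_def by (simp only: mollifier_vanish[OF j]) simp
    qed (use elim in simp)
  qed
  then show ?thesis unfolding conv_def by (rule integral_eq_zero_AE)
qed

section \<open>Lattice cells, and sums over vortices as integrals\<close>

definition tile :: "real \<Rightarrow> plane \<Rightarrow> plane" where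
  "tile h y = (\<chi> i. h * of_int \<lfloor>y $ i / h + 1 / 2\<rfloor>)"

lemma tile_lattice: "tile h y \<in> lattice h"
  by (auto simp: tile_def lattice_def)

lemma tile_component:
  assumes "0 < h" shows "\<bar>y $ i - tile h y $ i\<bar> \<le> h / 2"
proof -
  let ?k = "\<lfloor>y $ i / h + 1 / 2\<rfloor>"
  have "of_int ?k \<le> y $ i / h + 1 / 2" "y $ i / h + 1 / 2 < of_int ?k + 1" by linarith+
  then have "\<bar>y $ i / h - of_int ?k\<bar> \<le> 1 / 2" by linarith
  then have "\<bar>h * (y $ i / h - of_int ?k)\<bar> \<le> h * (1 / 2)" using assms by (simp add: abs_mult)
  then show ?thesis using assms by (simp add: tile_def algebra_simps)
qed

lemma tile_square: "0 < h \<Longrightarrow> y \<in> square h (tile h y)"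
  using tile_component[of h y] by (simp add: square_def)

lemma norm_tile: assumes "0 < h" shows "norm (tile h y - y) \<le> h"
proof -
  have "norm (tile h y - y) \<le> \<bar>(tile h y - y) $ 1\<bar> + \<bar>(tile h y - y) $ 2\<bar>"
    using norm_le_l1_cart[of "tile h y - y"] by (simp add: sum_2)
  also have "\<dots> \<le> h / 2 + h / 2"
    using tile_component[OF assms, of y] by (intro add_mono) (simp_all add: abs_minus_commute)
  finally show ?thesis by simp
qed

lemma tile_measurable [measurable]: "tile h \<in> borel_measurable borel"
proof (rule borel_measurable_euclidean_space[THEN iffD2], rule ballI)
  fix b :: plane assume "b \<in> Basis"
  then obtain i where b: "b = axis i 1" by (auto simp: Basis_vec_def)
  have [measurable]: "(\<lambda>y::plane. y $ i) \<in> borel_measurable borel"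
    by (intro borel_measurable_continuous_onI continuous_intros)
  have "(\<lambda>y::plane. h * real_of_int \<lfloor>y $ i / h + 1 / 2\<rfloor>) \<in> borel_measurable borel" by measurable
  then show "(\<lambda>y. tile h y \<bullet> b) \<in> borel_measurable borel" by (simp add: b inner_axis tile_def)
qed

text \<open>\<open>tile\<close> rounds ties upward, so its cells are half-open: the cell of
  \<open>\<alpha>\<close> is \<open>square h \<alpha>\<close> without the edges
  \<open>y $ i = \<alpha> $ i + h / 2\<close>.\<close>

lemma square_tile:
  assumes "0 < h" "\<alpha> \<in> lattice h" "y \<in> square h \<alpha>" "\<And>i. y $ i \<noteq> \<alpha> $ i + h / 2"
  shows "tile h y = \<alpha>"
proof (rule vec_eq_iff[THEN iffD2], rule allI)
  fix i
  obtain k :: int where k: "\<alpha> $ i = h * of_int k" using assms(2) by (auto simp: lattice_def)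
  have "\<bar>y $ i - \<alpha> $ i\<bar> \<le> h / 2" using assms(3) by (simp add: square_def)
  then have "\<alpha> $ i - h / 2 \<le> y $ i" "y $ i < \<alpha> $ i + h / 2" using assms(4)[of i] by linarith+
  then have "of_int k \<le> y $ i / h + 1 / 2" "y $ i / h + 1 / 2 < of_int k + 1"
    using assms(1) unfolding k by (simp_all add: field_simps)
  then have "\<lfloor>y $ i / h + 1 / 2\<rfloor> = k" by (rule floor_unique)
  then show "tile h y $ i = \<alpha> $ i" by (simp add: tile_def k)
qed

lemma finite_centers:
  assumes h: "0 < h" and w: "\<And>x. R < norm x \<Longrightarrow> w x = 0"
  shows "finite (centers h w)"
proof -
  define n where "n = \<lceil>R / h + 1\<rceil>"
  have sup: "fsupport w \<subseteq> cball 0 R"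
    unfolding fsupport_def using w by (intro closure_minimal) (auto simp: not_less[symmetric])
  have "centers h w \<subseteq> (\<lambda>(k, l). vector [h * of_int k, h * of_int l]) ` ({-n..n} \<times> {-n..n})"
  proof
    fix \<alpha> assume "\<alpha> \<in> centers h w"
    then obtain y where \<alpha>: "\<alpha> \<in> lattice h" "y \<in> square h \<alpha>" "norm y \<le> R" using sup by (force simp: centers_def)
    have "\<forall>i. \<exists>k::int. \<alpha> $ i = h * of_int k" using \<alpha>(1) by (simp add: lattice_def)
    then obtain k :: "2 \<Rightarrow> int" where k: "\<And>i. \<alpha> $ i = h * of_int (k i)" by metis
    have "k i \<in> {-n..n}" for i
    proof -
      have "\<bar>y $ i - \<alpha> $ i\<bar> \<le> h / 2" using \<alpha>(2) by (simp add: square_def)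
      then have "\<bar>\<alpha> $ i\<bar> \<le> R + h" using component_le_norm_cart[of y i] \<alpha>(3) h by linarith
      then have "\<bar>of_int (k i)\<bar> \<le> R / h + 1" unfolding k using h by (simp add: abs_mult field_simps)
      then show ?thesis unfolding n_def by (simp add: abs_le_iff) linarith
    qed
    moreover have "\<alpha> = vector [h * of_int (k 1), h * of_int (k 2)]" by (simp add: vec_eq_iff forall_2 k)
    ultimately show "\<alpha> \<in> (\<lambda>(k, l). vector [h * of_int k, h * of_int l]) ` ({-n..n} \<times> {-n..n})"
      by (intro image_eqI[of _ _ "(k 1, k 2)"]) simp_all
  qed
  then show ?thesis by (rule finite_subset) auto
qed

text \<open>The closed square and the half-open cell differ by parts of two lines, a null set.
  Closed squares share edges, whereas cells form a genuine partition.\<close>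

lemma circulation_tile:
  assumes h: "0 < h" and \<alpha>: "\<alpha> \<in> lattice h" and w [measurable]: "w \<in> borel_measurable borel"
  shows "circulation h w \<alpha> = (LINT y|lborel. indicator {y. tile h y = \<alpha>} y * w y)"
proof -
  have cl: "closed (square h \<alpha>)"
    unfolding square_def by (intro closed_Collect_all closed_Collect_le continuous_intros)
  then have [measurable]: "square h \<alpha> \<in> sets borel" by (rule borel_closed)
  have nul: "AE y in lborel. y $ i \<noteq> \<alpha> $ i + h / 2" for i
  proof -
    have "negligible {y::plane. y $ i = \<alpha> $ i + h / 2}"
      using negligible_standard_hyperplane[of "axis i 1 :: plane" "\<alpha> $ i + h / 2"] by (simp add: inner_axis)
    then have "AE y in lebesgue. \<not> y $ i = \<alpha> $ i + h / 2"
      unfolding negligible_iff_null_sets by (drule_tac AE_not_in) simp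
    then show ?thesis by (simp add: AE_completion_iff)
  qed
  have "circulation h w \<alpha> = (LINT y|lborel. indicator (square h \<alpha>) y * w y)"
    unfolding circulation_def set_lebesgue_integral_def real_scaleR_def by (rule integral_completion) measurable
  also have "\<dots> = (LINT y|lborel. indicator {y. tile h y = \<alpha>} y * w y)"
  proof (rule integral_cong_AE)
    show "AE y in lborel. indicator (square h \<alpha>) y * w y = indicator {y. tile h y = \<alpha>} y * w y"
      using nul[of 1] nul[of 2]
    proof eventually_elim
      case (elim y)
      have "y $ i \<noteq> \<alpha> $ i + h / 2" for i using elim exhaust_2[of i] by auto
      then have "y \<in> square h \<alpha> \<longleftrightarrow> tile h y = \<alpha>"
        using square_tile[OF h \<alpha>, of y] tile_square[OF h, of y] by auto
      then show ?case by (simp add: indicator_def)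
    qed
  qed measurable
  finally show ?thesis .
qed

text \<open>Every sum over vortices becomes an integral of \<open>w\<close> against \<open>F\<close>
  at the rounded point. Discrete and continuous expressions can thus be subtracted under one
  integral and bounded through the mass of \<open>w\<close>.\<close>

lemma sum_centers:
  fixes F :: "plane \<Rightarrow> 'b::{banach, second_countable_topology}"
  assumes h: "0 < h" and w: "test_fun w"
  shows "(\<Sum>\<alpha>\<in>centers h w. circulation h w \<alpha> *\<^sub>R F \<alpha>) = (LINT y|lborel. w y *\<^sub>R F (tile h y))"
    and "integrable lborel (\<lambda>y. w y *\<^sub>R F (tile h y))"
proof -
  obtain R where "\<And>x. R < norm x \<Longrightarrow> w x = 0" using w unfolding test_fun_def by blast
  then have fin: "finite (centers h w)" by (rule finite_centers[OF h])
  have wi: "integrable lborel w" using w by (rule test_fun_integrable)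
  have [measurable]: "w \<in> borel_measurable borel" using wi by auto
  let ?f = "\<lambda>\<alpha> y. (indicator {y. tile h y = \<alpha>} y * w y) *\<^sub>R F \<alpha>"
  have i: "integrable lborel (\<lambda>y. indicator {y. tile h y = \<alpha>} y * w y)" for \<alpha>
    by (rule Bochner_Integration.integrable_bound[OF wi]) (auto simp: indicator_def)
  have i2: "integrable lborel (?f \<alpha>)" for \<alpha> by (rule integrable_scaleR_left) (rule i)
  have pt: "(\<Sum>\<alpha>\<in>centers h w. ?f \<alpha> y) = w y *\<^sub>R F (tile h y)" for y
  proof (cases "w y = 0")
    case False
    then have "y \<in> fsupport w" unfolding fsupport_def using closure_subset[of "{x. w x \<noteq> 0}"] by auto
    then have c: "tile h y \<in> centers h w"
      using tile_lattice tile_square[OF h, of y] unfolding centers_def by blast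
    have "(\<Sum>\<alpha>\<in>centers h w. ?f \<alpha> y) = (\<Sum>\<alpha>\<in>centers h w. if \<alpha> = tile h y then w y *\<^sub>R F \<alpha> else 0)"
      by (intro sum.cong refl) (auto simp: indicator_def)
    then show ?thesis using c fin by simp
  qed simp
  have "(\<Sum>\<alpha>\<in>centers h w. circulation h w \<alpha> *\<^sub>R F \<alpha>) = (\<Sum>\<alpha>\<in>centers h w. LINT y|lborel. ?f \<alpha> y)"
  proof (intro sum.cong refl)
    fix \<alpha> assume "\<alpha> \<in> centers h w"
    then have "\<alpha> \<in> lattice h" by (simp add: centers_def)
    then show "circulation h w \<alpha> *\<^sub>R F \<alpha> = (LINT y|lborel. ?f \<alpha> y)"
      by (simp add: circulation_tile[OF h] integral_scaleR_left i)
  qed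
  also have "\<dots> = (LINT y|lborel. (\<Sum>\<alpha>\<in>centers h w. ?f \<alpha> y))"
    by (rule Bochner_Integration.integral_sum[symmetric]) (rule i2)
  finally show "(\<Sum>\<alpha>\<in>centers h w. circulation h w \<alpha> *\<^sub>R F \<alpha>) = (LINT y|lborel. w y *\<^sub>R F (tile h y))"
    by (simp only: pt)
  have "integrable lborel (\<lambda>y. \<Sum>\<alpha>\<in>centers h w. ?f \<alpha> y)"
    by (rule Bochner_Integration.integrable_sum) (rule i2)
  then show "integrable lborel (\<lambda>y. w y *\<^sub>R F (tile h y))" by (simp only: pt)
qed

section \<open>The error of the vortex-blob approximation\<close>

lemma regularized_kernel_bounded:
  assumes "mollifier \<phi>" "0 < \<epsilon>" obtains C where "0 \<le> C" "\<And>x. norm (conv (rescale \<phi> \<epsilon>) K x) \<le> C"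
proof -
  obtain \<psi>' where "c1_bump (rescale \<phi> \<epsilon>) \<psi>' \<epsilon>" using mollifier_bump assms by blast
  then interpret c1_bump "rescale \<phi> \<epsilon>" \<psi>' \<epsilon> .
  obtain B where B: "\<And>z. \<bar>rescale \<phi> \<epsilon> z\<bar> \<le> B" "0 \<le> B" using test_fun_bounded[OF test_fun] by blast
  then show ?thesis using kernel_bounded[OF B(1)] assms(2) by (intro that[of "5 * \<epsilon> * B"]) (auto simp: conv_K)
qed

text \<open>Integration against \<open>K\<close> on discs of radius \<open>\<epsilon>\<close>
  contributes \<open>5 * \<epsilon>\<close>, the Lipschitz constant of the rescaled mollifier
  \<open>\<Lambda> / \<epsilon> ^ 3\<close>.\<close>

lemma regularized_kernel_lipschitz:
  assumes "mollifier \<phi>" "0 < \<epsilon>" and \<Lambda>: "\<And>x y. \<bar>\<phi> x - \<phi> y\<bar> \<le> \<Lambda> * norm (x - y)" "0 \<le> \<Lambda>"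
  shows "norm (conv (rescale \<phi> \<epsilon>) K x - conv (rescale \<phi> \<epsilon>) K x') \<le> 5 * \<Lambda> / \<epsilon>\<^sup>2 * norm (x - x')"
proof -
  obtain \<psi>' where "c1_bump (rescale \<phi> \<epsilon>) \<psi>' \<epsilon>" using mollifier_bump assms by blast
  then interpret c1_bump "rescale \<phi> \<epsilon>" \<psi>' \<epsilon> .
  have "norm (kernel x - kernel x') \<le> 5 * \<epsilon> * (\<Lambda> / \<epsilon> ^ 3) * norm (x - x')"
    by (rule kernel_lipschitz) (use rescale_lipschitz[OF \<Lambda>(1)] assms in auto)
  also have "5 * \<epsilon> * (\<Lambda> / \<epsilon> ^ 3) = 5 * \<Lambda> / \<epsilon>\<^sup>2"
    using assms(2) by (simp add: power2_eq_square power3_eq_cube)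
  finally show ?thesis by (simp add: conv_K)
qed

lemma regularized_kernel_far:
  assumes "mollifier \<phi>" "0 < \<epsilon>" "\<epsilon> < \<rho>" "\<rho> \<le> norm x" "\<rho> \<le> norm x'"
  shows "norm (conv (rescale \<phi> \<epsilon>) K x - conv (rescale \<phi> \<epsilon>) K x') \<le> norm (x - x') / (2 * pi * (\<rho> - \<epsilon>)\<^sup>2)"
proof -
  obtain \<psi>' where "c1_bump (rescale \<phi> \<epsilon>) \<psi>' \<epsilon>" using mollifier_bump assms by blast
  then interpret c1_bump "rescale \<phi> \<epsilon>" \<psi>' \<epsilon> .
  show ?thesis unfolding conv_K
    by (rule kernel_far) (use rescale_nonneg rescale_integral assms in auto)
qed

lemma regularized_kernel_div_free:
  assumes "mollifier \<phi>" "0 < \<epsilon>"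
  shows "\<exists>D. (conv (rescale \<phi> \<epsilon>) K has_derivative D) (at x) \<and> trace (matrix D) = 0"
proof -
  obtain \<psi>' where "c1_bump (rescale \<phi> \<epsilon>) \<psi>' \<epsilon>" using mollifier_bump assms by blast
  then interpret c1_bump "rescale \<phi> \<epsilon>" \<psi>' \<epsilon> .
  show ?thesis unfolding conv_K by (rule kernel_div_free) (rule rescale_radial[OF assms(1)])
qed

text \<open>\<open>\<bar>f x\<bar> powr q\<close> is at most the supremum bound to the power q - 1
  times \<open>\<bar>f x\<bar>\<close>, so its integral is at most C^q \<epsilon>^(q + 2), whose
  q-th root is C \<epsilon>^(1 + 2/q). Sharing one \<open>C\<close> in both bounds keeps the
  constant free of \<open>p\<close>.\<close>

lemma Lp_norm_interpolation:
  assumes [measurable]: "f \<in> borel_measurable borel" and \<epsilon>: "0 < \<epsilon>" and C: "0 < C"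
    and sup: "\<And>x. \<bar>f x\<bar> \<le> C * \<epsilon>" and L1: "(\<integral>\<^sup>+x. ennreal \<bar>f x\<bar> \<partial>lborel) \<le> ennreal (C * \<epsilon> ^ 3)"
    and p: "1 \<le> p"
  shows "Lp_norm p f \<le> ennreal (C * \<epsilon> powr (1 + enn2real (2 / p)))"
proof (cases "p = \<infinity>")
  case True
  have "(\<lambda>x. ennreal \<bar>f x\<bar>) \<in> borel_measurable lebesgue" by (rule measurable_completion) measurable
  then have "esssup lebesgue (\<lambda>x. ennreal \<bar>f x\<bar>) \<le> ennreal (C * \<epsilon>)"
    using sup by (intro esssup_I) (auto intro!: ennreal_leI)
  then show ?thesis using True \<epsilon> by (simp add: Lp_norm_def)
next
  case False
  define q where "q = enn2real p"
  have pq: "p = ennreal q" using False by (simp add: q_def less_top[symmetric])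
  have q: "1 \<le> q" using p unfolding pq by simp
  define I where "I = (\<integral>\<^sup>+x. ennreal (\<bar>f x\<bar> powr q) \<partial>lebesgue)"
  have "I = (\<integral>\<^sup>+x. ennreal (\<bar>f x\<bar> powr q) \<partial>lborel)" unfolding I_def by (rule nn_integral_completion)
  also have "\<dots> \<le> (\<integral>\<^sup>+x. ennreal ((C * \<epsilon>) powr (q - 1)) * ennreal \<bar>f x\<bar> \<partial>lborel)"
  proof (rule nn_integral_mono)
    fix x
    have "\<bar>f x\<bar> powr q \<le> (C * \<epsilon>) powr (q - 1) * \<bar>f x\<bar>"
    proof (cases "f x = 0")
      case False
      have "\<bar>f x\<bar> powr q = \<bar>f x\<bar> powr (q - 1) * \<bar>f x\<bar> powr 1"
        by (subst powr_add[symmetric]) simp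
      also have "\<dots> \<le> (C * \<epsilon>) powr (q - 1) * \<bar>f x\<bar>"
        using sup[of x] q by (auto intro!: mult_right_mono powr_mono2)
      finally show ?thesis .
    qed simp
    then show "ennreal (\<bar>f x\<bar> powr q) \<le> ennreal ((C * \<epsilon>) powr (q - 1)) * ennreal \<bar>f x\<bar>"
      by (simp add: ennreal_leI flip: ennreal_mult)
  qed
  also have "\<dots> = ennreal ((C * \<epsilon>) powr (q - 1)) * (\<integral>\<^sup>+x. ennreal \<bar>f x\<bar> \<partial>lborel)"
    by (rule nn_integral_cmult) measurable
  also have "\<dots> \<le> ennreal ((C * \<epsilon>) powr (q - 1)) * ennreal (C * \<epsilon> ^ 3)"
    by (rule mult_left_mono[OF L1]) simp
  also have "\<dots> = ennreal (C powr q * \<epsilon> powr (q + 2))"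
  proof -
    have "(C * \<epsilon>) powr (q - 1) * (C * \<epsilon> ^ 3) = (C powr (q - 1) * C powr 1) * (\<epsilon> powr (q - 1) * \<epsilon> powr 3)"
      using C \<epsilon> by (simp add: powr_mult powr_numeral)
    also have "\<dots> = C powr q * \<epsilon> powr (q + 2)" by (simp only: powr_add[symmetric]) (simp add: add.commute)
    finally show ?thesis using C \<epsilon> by (simp flip: ennreal_mult)
  qed
  finally have I: "I \<le> ennreal (C powr q * \<epsilon> powr (q + 2))" .
  then have fin: "I \<noteq> \<infinity>" by (auto simp: top_unique)
  have "enn2real I \<le> C powr q * \<epsilon> powr (q + 2)" using I by (intro enn2real_leI) auto
  then have "enn2real I powr (1 / q) \<le> (C powr q * \<epsilon> powr (q + 2)) powr (1 / q)"
    using q by (intro powr_mono2) auto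
  also have "\<dots> = C powr (q * (1 / q)) * \<epsilon> powr ((q + 2) * (1 / q))"
    by (simp only: powr_mult powr_powr powr_ge_zero)
  also have "q * (1 / q) = 1" using q by simp
  also have "(q + 2) * (1 / q) = 1 + 2 / q" using q by (simp add: field_simps)
  also have "C powr 1 = C" using C by simp
  also have "2 / q = enn2real (2 / p)"
  proof -
    have "(2::ennreal) / p = ennreal 2 / ennreal q" by (simp add: pq)
    also have "\<dots> = ennreal (2 / q)" using q by (intro divide_ennreal) auto
    finally show ?thesis using q by simp
  qed
  finally have "enn2real I powr (1 / q) \<le> C * \<epsilon> powr (1 + enn2real (2 / p))" .
  moreover have "Lp_norm p f = ennreal (enn2real I powr (1 / q))"
    using False fin by (simp add: Lp_norm_def Let_def I_def q_def)
  ultimately show ?thesis by (simp add: ennreal_leI)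
qed

text \<open>A single scale is fixed. \<open>N\<close> bounds the mass of \<open>w\<close> and will
  be the L^1 norm of the unmollified vorticity, hence independent of \<epsilon>;
  \<open>\<Lambda>\<close> is a Lipschitz constant of the unscaled mollifier.\<close>

locale blob_setup =
  fixes \<phi> w :: "plane \<Rightarrow> real" and \<epsilon> h T \<Lambda> N :: real
    and X :: "plane \<Rightarrow> real \<Rightarrow> plane" and u :: "real \<Rightarrow> plane \<Rightarrow> real"
  assumes T: "0 < T" and mol: "mollifier \<phi>" and eps: "0 < \<epsilon>" and h: "0 < h"
    and \<Lambda>: "\<And>x y. \<bar>\<phi> x - \<phi> y\<bar> \<le> \<Lambda> * norm (x - y)" "0 \<le> \<Lambda>"
    and w: "test_fun w" and mass: "(\<integral>\<^sup>+y. ennreal \<bar>w y\<bar> \<partial>lborel) \<le> ennreal N" and N: "0 \<le> N"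
    and traj: "blob_trajectories \<phi> \<epsilon> h w T X"
    and sol: "transport_solution T (blob_velocity \<phi> \<epsilon> h w X) w u"
begin

abbreviation "k \<equiv> conv (rescale \<phi> \<epsilon>) K"
abbreviation "vel \<equiv> blob_velocity \<phi> \<epsilon> h w X"

lemmas k_lipschitz = regularized_kernel_lipschitz[OF mol eps \<Lambda>]

lemma continuous_k: "continuous_on UNIV k"
  by (rule lipschitz_on_continuous_on[of "5 * \<Lambda> / \<epsilon>\<^sup>2"], rule lipschitz_onI)
     (use k_lipschitz \<Lambda>(2) in \<open>auto simp: dist_norm\<close>)

lemma measurable_w [measurable]: "w \<in> borel_measurable borel"
  using test_fun_integrable[OF w] by auto

text \<open>The split into near and far field: \<open>c1\<close> acts only on a set carrying mass
  \<open>m\<close> of \<open>w\<close>, \<open>c2\<close> everywhere. \<open>B = {}\<close> gives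
  the plain bound \<open>c2 * N\<close>. For a non-integrable integrand the integral is 0 by
  convention.\<close>

lemma weighted_integral:
  fixes G :: "plane \<Rightarrow> 'b::{banach, second_countable_topology}"
  assumes [measurable]: "B \<in> sets borel" and c: "0 \<le> c1" "0 \<le> c2" "0 \<le> m"
    and m: "(\<integral>\<^sup>+y. ennreal \<bar>w y\<bar> * indicator B y \<partial>lborel) \<le> ennreal m"
    and G: "\<And>y. norm (G y) \<le> c1 * indicator B y + c2"
  shows "norm (LINT y|lborel. w y *\<^sub>R G y) \<le> c1 * m + c2 * N"
proof (cases "integrable lborel (\<lambda>y. w y *\<^sub>R G y)")
  case True
  have "ennreal (norm (LINT y|lborel. w y *\<^sub>R G y)) \<le> (\<integral>\<^sup>+y. ennreal (norm (w y *\<^sub>R G y)) \<partial>lborel)"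
    by (rule integral_norm_bound_ennreal[OF True])
  also have "\<dots> \<le> (\<integral>\<^sup>+y. ennreal c1 * (ennreal \<bar>w y\<bar> * indicator B y) + ennreal c2 * ennreal \<bar>w y\<bar> \<partial>lborel)"
  proof (rule nn_integral_mono)
    fix y
    have "norm (w y *\<^sub>R G y) \<le> \<bar>w y\<bar> * (c1 * indicator B y + c2)"
      using G[of y] by (simp add: mult_left_mono)
    then have "ennreal (norm (w y *\<^sub>R G y)) \<le> ennreal (\<bar>w y\<bar> * (c1 * indicator B y + c2))" by (rule ennreal_leI)
    also have "\<dots> = ennreal c1 * (ennreal \<bar>w y\<bar> * indicator B y) + ennreal c2 * ennreal \<bar>w y\<bar>"
      using c by (cases "y \<in> B") (simp_all add: distrib_left distrib_right mult.commute ennreal_plus ennreal_mult)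
    finally show "ennreal (norm (w y *\<^sub>R G y)) \<le> ennreal c1 * (ennreal \<bar>w y\<bar> * indicator B y) + ennreal c2 * ennreal \<bar>w y\<bar>" .
  qed
  also have "\<dots> = ennreal c1 * (\<integral>\<^sup>+y. ennreal \<bar>w y\<bar> * indicator B y \<partial>lborel) + ennreal c2 * (\<integral>\<^sup>+y. ennreal \<bar>w y\<bar> \<partial>lborel)"
    by (subst nn_integral_add, measurable, subst nn_integral_cmult, measurable, subst nn_integral_cmult, measurable)
  also have "\<dots> \<le> ennreal c1 * ennreal m + ennreal c2 * ennreal N"
    by (intro add_mono mult_left_mono m mass) auto
  also have "\<dots> = ennreal (c1 * m + c2 * N)" using c N by (simp add: ennreal_mult)
  finally show ?thesis using c N by (subst (asm) ennreal_le_iff) auto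
qed (use c N in \<open>simp add: not_integrable_integral_eq\<close>)

lemma velocity_diff:
  "vel t x - vel t x' = (LINT y|lborel. w y *\<^sub>R (k (x - X (tile h y) t) - k (x' - X (tile h y) t)))"
  unfolding blob_velocity_def
  using sum_centers(1)[OF h w, of "\<lambda>\<alpha>. k (x - X \<alpha> t) - k (x' - X \<alpha> t)"]
  by (simp add: scaleR_diff_right sum_subtractf)

lemma velocity_lipschitz: "norm (vel t x - vel t x') \<le> (5 * \<Lambda> * N / \<epsilon>\<^sup>2) * norm (x - x')"
proof -
  have "norm (vel t x - vel t x') \<le> 0 * 0 + (5 * \<Lambda> / \<epsilon>\<^sup>2 * norm (x - x')) * N"
    unfolding velocity_diff
  proof (rule weighted_integral[of "{}"])
    fix y
    show "norm (k (x - X (tile h y) t) - k (x' - X (tile h y) t)) \<le> 0 * indicator {} y + 5 * \<Lambda> / \<epsilon>\<^sup>2 * norm (x - x')"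
      using k_lipschitz[of "x - X (tile h y) t" "x' - X (tile h y) t"] by simp
  qed (use \<Lambda>(2) in auto)
  then show ?thesis by (simp add: mult_ac)
qed

lemma velocity_div_free: "\<exists>D. (vel t has_derivative D) (at x) \<and> trace (matrix D) = 0"
proof -
  have "\<forall>z. \<exists>D. (k has_derivative D) (at z) \<and> trace (matrix D) = 0"
    using regularized_kernel_div_free[OF mol eps] by blast
  then obtain D where D: "\<And>z. (k has_derivative D z) (at z)" "\<And>z. trace (matrix (D z)) = 0" by metis
  let ?D = "\<lambda>d. \<Sum>\<alpha>\<in>centers h w. circulation h w \<alpha> *\<^sub>R D (x - X \<alpha> t) d"
  have kd: "((\<lambda>x. k (x - X \<alpha> t)) has_derivative D (x - X \<alpha> t)) (at x)" for \<alpha>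
  proof -
    have "((\<lambda>x. x - X \<alpha> t) has_derivative (\<lambda>d. d)) (at x)" by (auto intro!: derivative_eq_intros)
    from has_derivative_compose[OF this D(1)] show ?thesis by simp
  qed
  have "(vel t has_derivative ?D) (at x)"
    unfolding blob_velocity_def[abs_def] by (intro has_derivative_sum has_derivative_scaleR_right kd)
  moreover have "trace (matrix ?D) = (\<Sum>\<alpha>\<in>centers h w. circulation h w \<alpha> * trace (matrix (D (x - X \<alpha> t))))"
    by (simp add: trace_def matrix_def sum_2 distrib_left sum.distrib)
  ultimately show ?thesis using D(2) by auto
qed

lemma trajectory_continuous: "\<alpha> \<in> centers h w \<Longrightarrow> continuous_on {0..T} (X \<alpha>)"
  using traj unfolding blob_trajectories_def
  by (intro continuous_on_vector_derivative[of "{0..T}"]) blast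

lemma velocity_field: "\<exists>V. div_free_field vel T (5 * \<Lambda> * N / \<epsilon>\<^sup>2 + 1) V"
proof -
  obtain C where C: "0 \<le> C" "\<And>x. norm (k x) \<le> C" using regularized_kernel_bounded[OF mol eps] by blast
  have "div_free_field vel T (5 * \<Lambda> * N / \<epsilon>\<^sup>2 + 1) (\<Sum>\<alpha>\<in>centers h w. \<bar>circulation h w \<alpha>\<bar> * C)"
  proof
    show "0 < T" by (rule T)
    \<comment> \<open>The added 1 keeps the Lipschitz constant positive when
      \<open>\<Lambda> * N = 0\<close>.\<close>
    show "0 < 5 * \<Lambda> * N / \<epsilon>\<^sup>2 + 1" using \<Lambda>(2) N by (intro add_nonneg_pos) auto
    have "continuous_on ({0..T} \<times> UNIV) (\<lambda>p. \<Sum>\<alpha>\<in>centers h w. circulation h w \<alpha> *\<^sub>R k (snd p - X \<alpha> (fst p)))"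
      by (intro continuous_on_sum continuous_on_scaleR continuous_on_const
          continuous_on_compose2[OF continuous_k] continuous_on_diff continuous_on_snd continuous_on_id
          continuous_on_compose2[OF trajectory_continuous] continuous_on_fst) auto
    then show "continuous_on ({0..T} \<times> UNIV) (\<lambda>(t, x). vel t x)"
      by (simp add: blob_velocity_def case_prod_unfold)
    show "norm (vel t x) \<le> (\<Sum>\<alpha>\<in>centers h w. \<bar>circulation h w \<alpha>\<bar> * C)" for t x
      unfolding blob_velocity_def by (rule sum_norm_le) (simp add: C mult_left_mono)
    show "norm (vel t x - vel t y) \<le> (5 * \<Lambda> * N / \<epsilon>\<^sup>2 + 1) * norm (x - y)" for t x y
      using velocity_lipschitz[of t x y] by (simp add: distrib_right add_increasing2)
    show "\<exists>D. (vel t has_derivative D) (at x) \<and> trace (matrix D) = 0" for t x by (rule velocity_div_free)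
  qed
  then show ?thesis by blast
qed

end

section \<open>Separation of a particle from the vortex of its lattice cell\<close>

locale blob_flow = blob_setup \<phi> w \<epsilon> h T \<Lambda> N X u
    + div_free_field "blob_velocity \<phi> \<epsilon> h w X" T "5 * \<Lambda> * N / \<epsilon>\<^sup>2 + 1" V
  for \<phi> w \<epsilon> h T \<Lambda> N X u V
begin

text \<open>The blob velocity is generated by the vortices themselves; once their paths are given it
  is a field like any other, and uniqueness identifies them with its orbits.\<close>

lemma trajectory_flow:
  assumes "\<alpha> \<in> centers h w" "t \<in> {0..T}" shows "X \<alpha> t = flow \<alpha> t"
proof (rule solution_unique[OF _ flow_solution assms(2)])
  show "solution \<alpha> (X \<alpha>)" using traj assms(1) unfolding solution_def blob_trajectories_def by blast
qed

text \<open>\<open>X\<close> is unspecified away from the centers, so it is replaced by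
  \<open>flow\<close> inside the finite sum, before passing to the integral over all
  \<open>y\<close>.\<close>

lemma velocity_diff_flow:
  assumes "t \<in> {0..T}"
  shows "vel t x - vel t x' = (LINT y|lborel. w y *\<^sub>R (k (x - flow (tile h y) t) - k (x' - flow (tile h y) t)))"
proof -
  have v: "vel t z = (\<Sum>\<alpha>\<in>centers h w. circulation h w \<alpha> *\<^sub>R k (z - flow \<alpha> t))" for z
    by (subst blob_velocity_def, rule sum.cong[OF refl]) (simp only: trajectory_flow[OF _ assms])
  have "vel t x - vel t x' = (\<Sum>\<alpha>\<in>centers h w. circulation h w \<alpha> *\<^sub>R (k (x - flow \<alpha> t) - k (x' - flow \<alpha> t)))"
    unfolding v[of x] v[of x'] scaleR_diff_right sum_subtractf ..
  then show ?thesis by (simp only: sum_centers(1)[OF h w])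
qed

text \<open>Few particles are near \<open>x\<close>, and their contribution is controlled by the mass of \<open>w\<close> on a small set,
  because the flow preserves area; the other particles act by the smoother far field.\<close>

lemma velocity_lipschitz_improved:
  assumes t: "t \<in> {0..T}" and A: "2 < A" and close: "\<And>y. norm (flow (tile h y) t - flow y t) \<le> \<epsilon>"
    and xx: "norm (x - x') \<le> \<epsilon>" and m: "0 \<le> m"
    and small: "\<And>B. B \<in> sets borel \<Longrightarrow> emeasure lborel B \<le> ennreal (4 * pi * ((A + 1) * \<epsilon>)\<^sup>2) \<Longrightarrow>
       (\<integral>\<^sup>+y. ennreal \<bar>w y\<bar> * indicator B y \<partial>lborel) \<le> ennreal m"
  shows "norm (vel t x - vel t x') \<le> (5 * \<Lambda> * m + N / (2 * pi * (A - 2)\<^sup>2)) / \<epsilon>\<^sup>2 * norm (x - x')"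
proof -
  \<comment> \<open>Bookkeeping of radii: a particle starting outside \<open>B\<close> is farther
    than (A + 1) \<epsilon> from \<open>x\<close>, the vortex of its cell farther than A \<epsilon>,
    and that vortex is farther than (A - 1) \<epsilon> from \<open>x'\<close>. Smoothing at radius
    \<epsilon> leaves (A - 2) \<epsilon> to the singularity.\<close>
  define B where "B = {y. flow y t \<in> cball x ((A + 1) * \<epsilon>)}"
  let ?d = "norm (x - x')"
  have B: "B \<in> sets borel"
    unfolding B_def
    by (intro borel_closed) (use continuous_closed_vimage[of "cball x ((A + 1) * \<epsilon>)" "\<lambda>y. flow y t"]
        continuous_flow_initial[OF t] in \<open>auto simp: continuous_on_eq_continuous_at vimage_def\<close>)
  have mB: "(\<integral>\<^sup>+y. ennreal \<bar>w y\<bar> * indicator B y \<partial>lborel) \<le> ennreal m"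
    by (rule small[OF B]) (unfold B_def, rule emeasure_flow_vimage_cball[OF t], use A eps in auto)
  have "norm (vel t x - vel t x') \<le> (5 * \<Lambda> / \<epsilon>\<^sup>2 * ?d) * m + (?d / (2 * pi * ((A - 1) * \<epsilon> - \<epsilon>)\<^sup>2)) * N"
    unfolding velocity_diff_flow[OF t]
  proof (rule weighted_integral[OF B _ _ m mB])
    fix y
    define p where "p = flow (tile h y) t"
    show "norm (k (x - flow (tile h y) t) - k (x' - flow (tile h y) t))
      \<le> 5 * \<Lambda> / \<epsilon>\<^sup>2 * ?d * indicator B y + ?d / (2 * pi * ((A - 1) * \<epsilon> - \<epsilon>)\<^sup>2)"
      unfolding p_def[symmetric]
    proof (cases "y \<in> B")
      case True
      have "norm (k (x - p) - k (x' - p)) \<le> 5 * \<Lambda> / \<epsilon>\<^sup>2 * ?d" using k_lipschitz[of "x - p" "x' - p"] by simp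
      then show "norm (k (x - p) - k (x' - p)) \<le> 5 * \<Lambda> / \<epsilon>\<^sup>2 * ?d * indicator B y + ?d / (2 * pi * ((A - 1) * \<epsilon> - \<epsilon>)\<^sup>2)"
        using True by (simp add: add_increasing2)
    next
      case False
      then have "(A + 1) * \<epsilon> < norm (x - flow y t)" by (simp add: B_def dist_norm)
      then have 1: "A * \<epsilon> < norm (x - p)"
        using close[of y] norm_triangle_sub[of "x - flow y t" "x - p"] by (simp add: p_def algebra_simps)
      then have 2: "(A - 1) * \<epsilon> < norm (x' - p)"
        using xx norm_triangle_sub[of "x - p" "x' - p"] by (simp add: algebra_simps)
      have "\<epsilon> < (A - 1) * \<epsilon>" using A eps by simp
      from regularized_kernel_far[OF mol eps this, of "x - p" "x' - p"]
      have "norm (k (x - p) - k (x' - p)) \<le> ?d / (2 * pi * ((A - 1) * \<epsilon> - \<epsilon>)\<^sup>2)"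
        using 1 2 eps by (simp add: algebra_simps)
      then show "norm (k (x - p) - k (x' - p)) \<le> 5 * \<Lambda> / \<epsilon>\<^sup>2 * ?d * indicator B y + ?d / (2 * pi * ((A - 1) * \<epsilon> - \<epsilon>)\<^sup>2)"
        using False by simp
    qed
  qed (use \<Lambda>(2) in auto)
  also have "(A - 1) * \<epsilon> - \<epsilon> = (A - 2) * \<epsilon>" by (simp add: algebra_simps)
  also have "(5 * \<Lambda> / \<epsilon>\<^sup>2 * ?d) * m + (?d / (2 * pi * ((A - 2) * \<epsilon>)\<^sup>2)) * N =
     (5 * \<Lambda> * m + N / (2 * pi * (A - 2)\<^sup>2)) / \<epsilon>\<^sup>2 * ?d"
  proof -
    have "(5 * \<Lambda> / e * ?d) * m + (?d / (2 * pi * (s * e))) * N = (5 * \<Lambda> * m + N / (2 * pi * s)) / e * ?d"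
      if "0 < e" "0 < s" for e s
      using that by (simp add: field_simps)
    from this[of "\<epsilon>\<^sup>2" "(A - 2)\<^sup>2"] show ?thesis using eps A by (simp add: power_mult_distrib)
  qed
  finally show ?thesis .
qed

text \<open>Serves the scales bounded away from 0, where this exponential has a bound independent of
  \<epsilon>, and the case of zero mass.\<close>

lemma tile_distance_crude:
  assumes "t \<in> {0..T}"
  shows "norm (flow (tile h y) t - flow y t) \<le> h * exp ((5 * \<Lambda> * N / \<epsilon>\<^sup>2 + 1) * T)"
proof -
  have "norm (flow (tile h y) t - flow y t) \<le> exp ((5 * \<Lambda> * N / \<epsilon>\<^sup>2 + 1) * t) * norm (tile h y - y)"
    by (rule flow_lipschitz[OF assms])
  also have "\<dots> \<le> exp ((5 * \<Lambda> * N / \<epsilon>\<^sup>2 + 1) * T) * h"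
    using assms L_pos by (intro mult_mono norm_tile h) (auto intro: mult_left_mono)
  finally show ?thesis by (simp add: mult.commute)
qed

lemma tile_distance_improved:
  assumes t: "t \<in> {0..T}" and A: "2 < A" and m: "0 \<le> m"
    and small: "\<And>B. B \<in> sets borel \<Longrightarrow> emeasure lborel B \<le> ennreal (4 * pi * ((A + 1) * \<epsilon>)\<^sup>2) \<Longrightarrow>
       (\<integral>\<^sup>+y. ennreal \<bar>w y\<bar> * indicator B y \<partial>lborel) \<le> ennreal m"
    and l: "(5 * \<Lambda> * m + N / (2 * pi * (A - 2)\<^sup>2)) / \<epsilon>\<^sup>2 \<le> l" "h * exp (l * T) < \<epsilon>"
  shows "norm (flow (tile h y) t - flow y t) \<le> h * exp (l * T)"
\<comment> \<open>All points are paired with their lattice points at once: the improved rate at one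
  pair presupposes that every vortex is still within \<epsilon> of the particles of its
  cell.\<close>
proof (rule flow_bootstrap[where A = "range (\<lambda>y. (tile h y, y))" and \<rho> = \<epsilon>])
  let ?l = "(5 * \<Lambda> * m + N / (2 * pi * (A - 2)\<^sup>2)) / \<epsilon>\<^sup>2"
  show "norm (y - z) \<le> h" if "(y, z) \<in> range (\<lambda>y. (tile h y, y))" for y z
    using that norm_tile[OF h] by auto
  have "0 \<le> ?l" using \<Lambda>(2) m N by auto
  then show "0 \<le> l" using l(1) by linarith
  fix s y z
  assume s: "s \<in> {0..T}" and cl: "\<And>y z. (y, z) \<in> range (\<lambda>y. (tile h y, y)) \<Longrightarrow> norm (flow y s - flow z s) \<le> \<epsilon>"
    and yz: "(y, z) \<in> range (\<lambda>y. (tile h y, y))"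
  have "norm (vel s (flow y s) - vel s (flow z s)) \<le> ?l * norm (flow y s - flow z s)"
    by (rule velocity_lipschitz_improved[OF s A _ _ m small]) (use cl yz in auto)
  also have "\<dots> \<le> l * norm (flow y s - flow z s)" by (intro mult_right_mono l) auto
  finally show "norm (vel s (flow y s) - vel s (flow z s)) \<le> l * norm (flow y s - flow z s)" .
qed (use h l t in auto)

text \<open>Constancy along characteristics. The equation speaks of a time derivative and a gradient
  separately; joint smoothness on the slab supplies the Frechet derivative \<open>F\<close> that
  combines them in the chain rule.\<close>

lemma transported:
  assumes t: "t \<in> {0..T}" shows "u t (flow y t) = w y"
proof -
  let ?S = "{0..T} \<times> (UNIV :: plane set)" and ?f = "\<lambda>(t, x). u t x"
  have "Ck_on (Suc 0) ?f ?S" using sol unfolding transport_solution_def smooth_on_def by blast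
  then obtain F where F: "\<And>p. p \<in> ?S \<Longrightarrow> (?f has_derivative F p) (at p within ?S)" by auto
  have comp: "((\<lambda>r. ?f (c r)) has_derivative (\<lambda>r. F (c s) (c' r))) (at s within A)"
    if "(c has_derivative c') (at s within A)" "c ` A \<subseteq> ?S" "s \<in> A" for c :: "'z::real_normed_vector \<Rightarrow> real \<times> plane" and c' s A
    by (rule has_derivative_in_compose[OF that(1) has_derivative_subset[OF F that(2)]]) (use that in auto)
  have "((\<lambda>s. u s (flow y s)) has_real_derivative 0) (at s within {0..T})" if s: "s \<in> {0..T}" for s
  proof -
    let ?x = "flow y s" and ?F = "F (s, flow y s)"
    have lin: "linear ?F" using F[of "(s, ?x)"] s by (auto dest: has_derivative_linear)
    obtain a g where a: "((\<lambda>r. u r ?x) has_real_derivative a) (at s within {0..T})"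
      and g: "GDERIV (u s) ?x :> g" and ag: "a + vel s ?x \<bullet> g = 0"
      using sol s unfolding transport_solution_def by blast
    have "((\<lambda>r. (r, ?x)) has_derivative (\<lambda>r. (r, 0))) (at s within {0..T})"
      by (intro has_derivative_Pair has_derivative_ident has_derivative_const)
    from comp[OF this] s
    have "((\<lambda>r. u r ?x) has_derivative (\<lambda>r. ?F (r, 0))) (at s within {0..T})" by auto
    moreover have "(\<lambda>r. ?F (r, 0)) = (\<lambda>r. r *\<^sub>R ?F (1, 0))"
    proof
      show "?F (r, 0) = r *\<^sub>R ?F (1, 0)" for r
        using linear_scale[OF lin, of r "(1, 0)"] by (simp only: scaleR_Pair scaleR_zero_right real_scaleR_def mult_1_right)
    qed
    ultimately have "((\<lambda>r. u r ?x) has_vector_derivative ?F (1, 0)) (at s within {0..T})"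
      unfolding has_vector_derivative_def by (simp only:)
    \<comment> \<open>At the ends of \<open>{0..T}\<close> the time derivative is one-sided; it is
      still unique because the interval has positive length.\<close>
    then have a': "?F (1, 0) = a"
      using a T s vector_derivative_unique_within_closed_interval[of 0 T s "\<lambda>r. u r ?x" "?F (1, 0)" a]
      by (simp add: has_real_derivative_iff_has_vector_derivative)
    have "(Pair s has_derivative Pair 0) (at ?x)"
      by (intro has_derivative_Pair has_derivative_ident has_derivative_const)
    from comp[OF this] s
    have "((\<lambda>z. ?f (s, z)) has_derivative (\<lambda>d. ?F (0, d))) (at ?x)" by (simp add: image_subset_iff)
    then have "(u s has_derivative (\<lambda>d. ?F (0, d))) (at ?x)" by simp
    then have g': "(\<lambda>d. ?F (0, d)) = (\<lambda>d. d \<bullet> g)"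
      using g unfolding gderiv_def by (rule has_derivative_unique)
    have "((\<lambda>r. (r, flow y r)) has_derivative (\<lambda>r. (r, r *\<^sub>R vel s ?x))) (at s within {0..T})"
      using flow_deriv[OF s, of y] unfolding has_vector_derivative_def
      by (intro has_derivative_Pair has_derivative_ident)
    from comp[OF this] s
    have "((\<lambda>r. u r (flow y r)) has_derivative (\<lambda>r. ?F (r, r *\<^sub>R vel s ?x))) (at s within {0..T})" by auto
    moreover have "?F (r, r *\<^sub>R vel s ?x) = 0" for r
    proof -
      have "?F (r, r *\<^sub>R vel s ?x) = ?F (r *\<^sub>R ((1, 0) + (0, vel s ?x)))" by simp
      also have "\<dots> = r *\<^sub>R (?F (1, 0) + ?F (0, vel s ?x))"
        by (simp only: linear_scale[OF lin] linear_add[OF lin])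
      also have "?F (0, vel s ?x) = vel s ?x \<bullet> g" using fun_cong[OF g'] by simp
      finally show ?thesis using ag a' by simp
    qed
    ultimately show ?thesis by (simp add: has_field_derivative_def lambda_zero)
  qed
  then obtain c where c: "\<And>s. s \<in> {0..T} \<Longrightarrow> u s (flow y s) = c"
    using has_field_derivative_zero_constant[of "{0..T}" "\<lambda>s. u s (flow y s)"] by auto
  have "u t (flow y t) = u 0 (flow y 0)" using c[OF t] c[of 0] T by (simp del: flow_0)
  then show ?thesis using sol by (simp add: transport_solution_def)
qed

lemma continuous_transported: assumes "t \<in> {0..T}" shows "continuous_on UNIV (u t)"
proof -
  have "Ck_on 0 (\<lambda>(t, x). u t x) ({0..T} \<times> UNIV)"
    using sol unfolding transport_solution_def smooth_on_def by blast
  then have "continuous_on UNIV ((\<lambda>(t, x). u t x) \<circ> (\<lambda>x. (t, x)))"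
    by (intro continuous_on_compose) (use assms in \<open>auto intro!: continuous_intros elim: continuous_on_subset\<close>)
  then show ?thesis by (simp add: o_def)
qed

section \<open>The error at one scale\<close>

definition err :: "real \<Rightarrow> plane \<Rightarrow> real" where
  "err t x = blob_vorticity \<phi> \<epsilon> h w X t x - conv (rescale \<phi> \<epsilon>) (u t) x"

lemma err_eq:
  assumes t: "t \<in> {0..T}"
  shows "err t x = (LINT y|lborel. w y *\<^sub>R (rescale \<phi> \<epsilon> (x - flow (tile h y) t) - rescale \<phi> \<epsilon> (x - flow y t)))"
proof -
  obtain \<psi>' where "c1_bump (rescale \<phi> \<epsilon>) \<psi>' \<epsilon>" using mollifier_bump[OF mol eps] by blast
  then interpret \<psi>: c1_bump "rescale \<phi> \<epsilon>" \<psi>' \<epsilon> .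
  let ?\<psi> = "rescale \<phi> \<epsilon>"
  have [measurable]: "u t \<in> borel_measurable borel"
    using continuous_transported[OF t] by (rule borel_measurable_continuous_onI)
  have 1: "blob_vorticity \<phi> \<epsilon> h w X t x = (LINT y|lborel. w y *\<^sub>R ?\<psi> (x - flow (tile h y) t))"
  proof -
    have "blob_vorticity \<phi> \<epsilon> h w X t x = (\<Sum>\<alpha>\<in>centers h w. circulation h w \<alpha> *\<^sub>R ?\<psi> (x - flow \<alpha> t))"
      by (subst blob_vorticity_def, rule sum.cong[OF refl]) (simp only: trajectory_flow[OF _ t] real_scaleR_def)
    then show ?thesis by (simp only: sum_centers(1)[OF h w])
  qed
  \<comment> \<open>Compact support comes from the blob factor, continuity from both factors; area
    preservation then trades \<open>u t\<close> at the transported point for the initial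
    \<open>w\<close>.\<close>
  have cf: "test_fun (\<lambda>z. ?\<psi> (x - z) * u t z)"
    unfolding test_fun_def
  proof (intro conjI exI allI impI)
    show "continuous_on UNIV (\<lambda>z. ?\<psi> (x - z) * u t z)"
      by (intro continuous_intros continuous_transported[OF t] continuous_on_compose2[OF \<psi>.continuous]) auto
    show "?\<psi> (x - z) * u t z = 0" if "norm x + \<epsilon> < norm z" for z
      using \<psi>.vanish[of "x - z"] that norm_triangle_sub[of z x] by (simp add: norm_minus_commute)
  qed
  have "conv ?\<psi> (u t) x = (LINT z|lborel. ?\<psi> (x - z) * u t z)"
    by (subst conv_lborel) auto
  also have "\<dots> = (LINT y|lborel. ?\<psi> (x - flow y t) * u t (flow y t))"
    by (rule flow_preserves_integral[OF t cf, symmetric])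
  also have "\<dots> = (LINT y|lborel. w y *\<^sub>R ?\<psi> (x - flow y t))"
    by (simp add: transported[OF t] mult.commute)
  finally have 2: "conv ?\<psi> (u t) x = (LINT y|lborel. w y *\<^sub>R ?\<psi> (x - flow y t))" .
  have i2: "integrable lborel (\<lambda>y. w y *\<^sub>R ?\<psi> (x - flow y t))"
    using test_fun_integrable[OF test_fun_flow[OF t cf]] by (simp add: transported[OF t] mult.commute)
  show ?thesis
    unfolding err_def 1 2 scaleR_diff_right
    by (rule Bochner_Integration.integral_diff[OF sum_centers(2)[OF h w] i2, symmetric])
qed

lemma err_sup:
  assumes t: "t \<in> {0..T}" and E: "\<And>y. norm (flow (tile h y) t - flow y t) \<le> E"
  shows "\<bar>err t x\<bar> \<le> \<Lambda> * N / \<epsilon> ^ 3 * E"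
proof -
  have E0: "0 \<le> E" using order_trans[OF norm_ge_zero E] .
  have "norm (err t x) \<le> 0 * 0 + (\<Lambda> / \<epsilon> ^ 3 * E) * N"
    unfolding err_eq[OF t]
  proof (rule weighted_integral[of "{}"])
    fix y
    have "norm (rescale \<phi> \<epsilon> (x - flow (tile h y) t) - rescale \<phi> \<epsilon> (x - flow y t)) \<le>
        \<Lambda> / \<epsilon> ^ 3 * norm ((x - flow (tile h y) t) - (x - flow y t))"
      using rescale_lipschitz[OF \<Lambda>(1) eps, of "x - flow (tile h y) t" "x - flow y t"] by simp
    also have "\<dots> \<le> \<Lambda> / \<epsilon> ^ 3 * E"
      using E[of y] \<Lambda>(2) eps by (intro mult_left_mono) (auto simp: norm_minus_commute)
    finally show "norm (rescale \<phi> \<epsilon> (x - flow (tile h y) t) - rescale \<phi> \<epsilon> (x - flow y t)) \<le>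
        0 * indicator {} y + \<Lambda> / \<epsilon> ^ 3 * E" by simp
  qed (use \<Lambda>(2) eps E0 in auto)
  then show ?thesis by (simp add: mult_ac)
qed

text \<open>For fixed \<open>y\<close> the two blobs differ by at most
  \<open>\<Lambda> / \<epsilon> ^ 3 * E\<close> on two discs of area pi \<epsilon>^2; Fubini then
  leaves the mass of \<open>w\<close>. Integrating thus gains the factor 2 pi \<epsilon>^2 over the
  supremum bound.\<close>

lemma
  assumes t: "t \<in> {0..T}" shows err_measurable: "err t \<in> borel_measurable borel"
    and err_L1: "(\<And>y. norm (flow (tile h y) t - flow y t) \<le> E) \<Longrightarrow>
      (\<integral>\<^sup>+x. ennreal \<bar>err t x\<bar> \<partial>lborel) \<le> ennreal (2 * pi * \<Lambda> * N / \<epsilon> * E)"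
proof -
  obtain \<psi>' where "c1_bump (rescale \<phi> \<epsilon>) \<psi>' \<epsilon>" using mollifier_bump[OF mol eps] by blast
  then interpret \<psi>: c1_bump "rescale \<phi> \<epsilon>" \<psi>' \<epsilon> .
  have [measurable]: "(\<lambda>y. flow y t) \<in> borel_measurable borel"
    using continuous_flow_initial[OF t] by (rule borel_measurable_continuous_onI)
  define G where "G x y = rescale \<phi> \<epsilon> (x - flow (tile h y) t) - rescale \<phi> \<epsilon> (x - flow y t)" for x y
  have [measurable]: "(\<lambda>(x, y). G x y) \<in> borel_measurable (borel \<Otimes>\<^sub>M borel)" unfolding G_def by measurable
  have err: "err t x = (LINT y|lborel. w y *\<^sub>R G x y)" for x using err_eq[OF t] by (simp add: G_def)
  show "err t \<in> borel_measurable borel"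
    unfolding err[abs_def] by (rule lborel.borel_measurable_lebesgue_integral) measurable
  assume E: "\<And>y. norm (flow (tile h y) t - flow y t) \<le> E"
  have E0: "0 \<le> E" using order_trans[OF norm_ge_zero E] .
  let ?c = "\<Lambda> / \<epsilon> ^ 3 * E"
  have c0: "0 \<le> ?c" using \<Lambda>(2) eps E0 by simp
  have G: "\<bar>G x y\<bar> \<le> ?c * (indicator (cball (flow (tile h y) t) \<epsilon>) x + indicator (cball (flow y t) \<epsilon>) x)" for x y
  proof -
    have "\<bar>G x y\<bar> \<le> \<Lambda> / \<epsilon> ^ 3 * norm ((x - flow (tile h y) t) - (x - flow y t))"
      unfolding G_def by (rule rescale_lipschitz[OF \<Lambda>(1) eps])
    also have "\<dots> \<le> ?c"
      using E[of y] \<Lambda>(2) eps by (intro mult_left_mono) (auto simp: norm_minus_commute)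
    finally have le: "\<bar>G x y\<bar> \<le> ?c" .
    show ?thesis
    proof (cases "x \<in> cball (flow (tile h y) t) \<epsilon> \<or> x \<in> cball (flow y t) \<epsilon>")
      case True
      then have "(1::real) \<le> indicator (cball (flow (tile h y) t) \<epsilon>) x + indicator (cball (flow y t) \<epsilon>) x"
        by (auto simp: indicator_def)
      from mult_left_mono[OF this c0] le show ?thesis by simp
    next
      case False
      then have "G x y = 0"
        using \<psi>.vanish[of "x - flow (tile h y) t"] \<psi>.vanish[of "x - flow y t"]
        by (simp add: G_def dist_norm norm_minus_commute)
      then show ?thesis using False by simp
    qed
  qed
  have Gint: "(\<integral>\<^sup>+x. ennreal \<bar>G x y\<bar> \<partial>lborel) \<le> ennreal (2 * pi * \<epsilon>\<^sup>2 * ?c)" for y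
  proof -
    have "(\<integral>\<^sup>+x. ennreal \<bar>G x y\<bar> \<partial>lborel) \<le> (\<integral>\<^sup>+x. ennreal ?c * (indicator (cball (flow (tile h y) t) \<epsilon>) x
        + indicator (cball (flow y t) \<epsilon>) x) \<partial>lborel)"
    proof (rule nn_integral_mono)
      fix x
      show "ennreal \<bar>G x y\<bar> \<le> ennreal ?c * (indicator (cball (flow (tile h y) t) \<epsilon>) x + indicator (cball (flow y t) \<epsilon>) x)"
      proof -
        have "ennreal (c * (indicator A x + indicator B x)) = ennreal c * (indicator A x + indicator B x)"
          if "0 \<le> c" for c and A B :: "plane set"
          using that by (cases "x \<in> A"; cases "x \<in> B") (simp_all add: ennreal_mult)
        from this[OF c0] show ?thesis using ennreal_leI[OF G[of x y]] by simp
      qed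
    qed
    also have "\<dots> = ennreal ?c * (ennreal (pi * \<epsilon>\<^sup>2) + ennreal (pi * \<epsilon>\<^sup>2))"
      using eps by (subst nn_integral_cmult, measurable, subst nn_integral_add, measurable) (simp add: emeasure_cball_plane)
    also have "\<dots> = ennreal (2 * pi * \<epsilon>\<^sup>2 * ?c)"
    proof -
      have "ennreal a * (ennreal b + ennreal b) = ennreal (2 * b * a)" if "0 \<le> a" "0 \<le> b" for a b
        using that by (simp add: mult_ac flip: ennreal_plus ennreal_mult)
      from this[OF c0, of "pi * \<epsilon>\<^sup>2"] show ?thesis by (simp add: mult.assoc)
    qed
    finally show ?thesis .
  qed
  have "(\<integral>\<^sup>+x. ennreal \<bar>err t x\<bar> \<partial>lborel) \<le> (\<integral>\<^sup>+x. (\<integral>\<^sup>+y. ennreal \<bar>w y\<bar> * ennreal \<bar>G x y\<bar> \<partial>lborel) \<partial>lborel)"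
  proof (rule nn_integral_mono)
    fix x
    show "ennreal \<bar>err t x\<bar> \<le> (\<integral>\<^sup>+y. ennreal \<bar>w y\<bar> * ennreal \<bar>G x y\<bar> \<partial>lborel)"
    proof (cases "integrable lborel (\<lambda>y. w y *\<^sub>R G x y)")
      case True
      then show ?thesis using integral_norm_bound_ennreal[OF True] by (simp add: err abs_mult ennreal_mult)
    qed (simp add: err not_integrable_integral_eq)
  qed
  also have "\<dots> = (\<integral>\<^sup>+y. (\<integral>\<^sup>+x. ennreal \<bar>w y\<bar> * ennreal \<bar>G x y\<bar> \<partial>lborel) \<partial>lborel)"
    by (rule lborel_pair.Fubini') measurable
  also have "\<dots> = (\<integral>\<^sup>+y. ennreal \<bar>w y\<bar> * (\<integral>\<^sup>+x. ennreal \<bar>G x y\<bar> \<partial>lborel) \<partial>lborel)"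
    by (intro nn_integral_cong nn_integral_cmult) measurable
  also have "\<dots> \<le> (\<integral>\<^sup>+y. ennreal \<bar>w y\<bar> * ennreal (2 * pi * \<epsilon>\<^sup>2 * ?c) \<partial>lborel)"
    by (intro nn_integral_mono mult_left_mono Gint) auto
  also have "\<dots> = (\<integral>\<^sup>+y. ennreal \<bar>w y\<bar> \<partial>lborel) * ennreal (2 * pi * \<epsilon>\<^sup>2 * ?c)"
    by (rule nn_integral_multc) measurable
  also have "\<dots> \<le> ennreal N * ennreal (2 * pi * \<epsilon>\<^sup>2 * ?c)" by (intro mult_right_mono mass) auto
  also have "\<dots> = ennreal (N * (2 * pi * \<epsilon>\<^sup>2 * ?c))"
    by (intro ennreal_mult[symmetric] N mult_nonneg_nonneg c0) auto
  also have "N * (2 * pi * \<epsilon>\<^sup>2 * ?c) = 2 * pi * \<Lambda> * N / \<epsilon> * E"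
    using eps by (simp add: power2_eq_square power3_eq_cube)
  finally show "(\<integral>\<^sup>+x. ennreal \<bar>err t x\<bar> \<partial>lborel) \<le> ennreal (2 * pi * \<Lambda> * N / \<epsilon> * E)" .
qed

lemma err_Lp:
  assumes t: "t \<in> {0..T}" and E: "\<And>y. norm (flow (tile h y) t - flow y t) \<le> c * \<epsilon> ^ 4" and p: "1 \<le> p"
  shows "Lp_norm p (err t) \<le> ennreal ((2 * pi * \<Lambda> * N * c + 1) * \<epsilon> powr (1 + enn2real (2 / p)))"
proof -
  have "0 \<le> c * \<epsilon> ^ 4" using order_trans[OF norm_ge_zero E] .
  then have c: "0 \<le> c" using eps by (simp add: zero_le_mult_iff)
  then have a: "0 \<le> \<Lambda> * N * c" using \<Lambda>(2) N by simp
  have "1 * (\<Lambda> * N * c) \<le> (2 * pi) * (\<Lambda> * N * c)" using a pi_gt3 by (intro mult_right_mono) auto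
  then have b: "\<Lambda> * N * c \<le> 2 * pi * \<Lambda> * N * c + 1" by (simp add: mult_ac)
  show ?thesis
  proof (rule Lp_norm_interpolation[OF err_measurable[OF t] eps _ _ _ p])
    \<comment> \<open>The added 1 makes the constant positive even if
      \<open>\<Lambda> * N * c = 0\<close>, as the interpolation demands.\<close>
    show "0 < 2 * pi * \<Lambda> * N * c + 1" using b a by (simp add: add_nonneg_pos mult.assoc)
    fix x
    have "\<bar>err t x\<bar> \<le> \<Lambda> * N / \<epsilon> ^ 3 * (c * \<epsilon> ^ 4)" by (rule err_sup[OF t E])
    also have "\<dots> = \<Lambda> * N * c * \<epsilon>" using eps by (simp add: field_simps power_eq_if)
    also have "\<dots> \<le> (2 * pi * \<Lambda> * N * c + 1) * \<epsilon>" using b eps by (intro mult_right_mono) auto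
    finally show "\<bar>err t x\<bar> \<le> (2 * pi * \<Lambda> * N * c + 1) * \<epsilon>" .
  next
    have "(\<integral>\<^sup>+x. ennreal \<bar>err t x\<bar> \<partial>lborel) \<le> ennreal (2 * pi * \<Lambda> * N / \<epsilon> * (c * \<epsilon> ^ 4))"
      by (rule err_L1[OF t E])
    also have "2 * pi * \<Lambda> * N / \<epsilon> * (c * \<epsilon> ^ 4) = 2 * pi * \<Lambda> * N * c * \<epsilon> ^ 3"
      using eps by (simp add: field_simps power_eq_if)
    also have "ennreal \<dots> \<le> ennreal ((2 * pi * \<Lambda> * N * c + 1) * \<epsilon> ^ 3)"
      using eps by (intro ennreal_leI mult_right_mono) auto
    finally show "(\<integral>\<^sup>+x. ennreal \<bar>err t x\<bar> \<partial>lborel) \<le> ennreal ((2 * pi * \<Lambda> * N * c + 1) * \<epsilon> ^ 3)" .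
  qed
qed

end

text \<open>The exponent \<open>C\<^sub>1\<close> may be arbitrarily small: by equi-integrability of the mollified vorticities the
  growth rate of particle distances is \<open>o(\<epsilon>\<^sup>-\<^sup>2)\<close> rather than merely \<open>O(\<epsilon>\<^sup>-\<^sup>2)\<close>.\<close>

lemma small_scale_rate:
  assumes j: "mollifier j" and \<omega>: "integrable lebesgue \<omega>" and \<Lambda>: "0 \<le> \<Lambda>" and N: "0 < N" and C: "0 < C\<^sub>1"
  obtains \<epsilon>\<^sub>0 A where "0 < \<epsilon>\<^sub>0" "2 < A"
    "\<And>\<epsilon>. 0 < \<epsilon> \<Longrightarrow> \<epsilon> < \<epsilon>\<^sub>0 \<Longrightarrow> \<exists>m\<ge>0. 5 * \<Lambda> * m + N / (2 * pi * (A - 2)\<^sup>2) \<le> C\<^sub>1 * N \<and>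
       (\<forall>\<delta> B. 0 < \<delta> \<longrightarrow> B \<in> sets borel \<longrightarrow> emeasure lborel B \<le> ennreal (4 * pi * ((A + 1) * \<epsilon>)\<^sup>2) \<longrightarrow>
         (\<integral>\<^sup>+x. ennreal \<bar>conv (rescale j \<delta>) \<omega> x\<bar> * indicator B x \<partial>lborel) \<le> ennreal m)"
proof -
  \<comment> \<open>The admissible rate \<open>C\<^sub>1 * N\<close> is spent as one half on the far
    field and one quarter on each of two parts of the near field. With
    \<open>A - 2 = 1 + 1 / C\<^sub>1\<close> the product \<open>C\<^sub>1 * (A - 2)\<^sup>2\<close>
    equals \<open>C\<^sub>1 + 2 + 1 / C\<^sub>1\<close>, which exceeds 1 for large and small
    \<open>C\<^sub>1\<close> alike.\<close>
  define A where "A = 3 + 1 / C\<^sub>1"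
  have A: "2 < A" using C by (simp add: A_def add_pos_pos)
  \<comment> \<open>Chosen so that \<open>5 * \<Lambda> * \<eta>\<close> is at most a quarter of the
    rate; the added 1 covers \<open>\<Lambda> = 0\<close>.\<close>
  define \<eta> where "\<eta> = C\<^sub>1 * N / (20 * \<Lambda> + 1)"
  have \<eta>: "0 < \<eta>" using C N \<Lambda> by (simp add: \<eta>_def add_nonneg_pos)
  obtain M where M: "0 \<le> M" "\<And>\<delta> B. 0 < \<delta> \<Longrightarrow> B \<in> sets borel \<Longrightarrow>
      (\<integral>\<^sup>+x. ennreal \<bar>conv (rescale j \<delta>) \<omega> x\<bar> * indicator B x \<partial>lborel) \<le> ennreal M * emeasure lborel B + ennreal \<eta>"
    using mollified_equiintegrable[OF j \<omega> \<eta>] by blast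
  \<comment> \<open>\<open>Q * \<epsilon>\<^sup>2\<close> is the near-field contribution of the
    vorticity below height \<open>M\<close>: 5 \<Lambda> times \<open>M\<close> times the area
    bound. \<open>\<epsilon>\<^sub>0\<close> makes it at most a quarter of the rate and can be fixed
    only after \<open>\<eta>\<close> and \<open>M\<close>.\<close>
  define Q where "Q = 20 * pi * \<Lambda> * M * (A + 1)\<^sup>2"
  have Q: "0 \<le> Q" using \<Lambda> M(1) by (simp add: Q_def)
  define \<epsilon>\<^sub>0 where "\<epsilon>\<^sub>0 = sqrt (C\<^sub>1 * N / (4 * (Q + 1)))"
  have \<epsilon>\<^sub>0: "0 < \<epsilon>\<^sub>0" using C N Q by (simp add: \<epsilon>\<^sub>0_def)
  have far: "N / (2 * pi * (A - 2)\<^sup>2) \<le> C\<^sub>1 * N / 2"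
  proof -
    have "1 \<le> pi * (C\<^sub>1 * (1 + 1 / C\<^sub>1)\<^sup>2)"
    proof -
      have "C\<^sub>1 * (1 + 1 / C\<^sub>1)\<^sup>2 = C\<^sub>1 + 2 + 1 / C\<^sub>1" using C by (simp add: power2_eq_square field_simps)
      then have "1 \<le> C\<^sub>1 * (1 + 1 / C\<^sub>1)\<^sup>2" using C by (simp add: add_increasing2)
      moreover have "1 \<le> pi" using pi_gt3 by simp
      ultimately have "1 * 1 \<le> pi * (C\<^sub>1 * (1 + 1 / C\<^sub>1)\<^sup>2)" by (intro mult_mono) auto
      then show ?thesis by simp
    qed
    then have "N * 1 \<le> N * (pi * (C\<^sub>1 * (A - 2)\<^sup>2))" using N by (intro mult_left_mono) (auto simp: A_def)
    then show ?thesis using A by (simp add: field_simps)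
  qed
  show ?thesis
  proof (rule that[OF \<epsilon>\<^sub>0 A])
    fix \<epsilon> :: real assume \<epsilon>: "0 < \<epsilon>" "\<epsilon> < \<epsilon>\<^sub>0"
    define a where "a = 4 * pi * ((A + 1) * \<epsilon>)\<^sup>2"
    have a: "0 \<le> a" by (simp add: a_def)
    have "\<epsilon>\<^sup>2 \<le> \<epsilon>\<^sub>0\<^sup>2" using \<epsilon> by (intro power_mono) auto
    also have "\<dots> = C\<^sub>1 * N / (4 * (Q + 1))" unfolding \<epsilon>\<^sub>0_def using C N Q by (intro real_sqrt_pow2) auto
    finally have "\<epsilon>\<^sup>2 * (4 * (Q + 1)) \<le> C\<^sub>1 * N" using Q by (simp add: pos_le_divide_eq)
    then have "Q * \<epsilon>\<^sup>2 \<le> C\<^sub>1 * N / 4" by (simp add: algebra_simps) (smt (verit) zero_le_power2)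
    moreover have "5 * \<Lambda> * (M * a) = Q * \<epsilon>\<^sup>2" by (simp add: a_def Q_def power_mult_distrib)
    ultimately have 1: "5 * \<Lambda> * (M * a) \<le> C\<^sub>1 * N / 4" by simp
    have "5 * \<Lambda> * \<eta> = C\<^sub>1 * N / 4 * (20 * \<Lambda> / (20 * \<Lambda> + 1))" by (simp add: \<eta>_def)
    also have "\<dots> \<le> C\<^sub>1 * N / 4 * 1" using \<Lambda> C N by (intro mult_left_mono) auto
    finally have 2: "5 * \<Lambda> * \<eta> \<le> C\<^sub>1 * N / 4" by simp
    show "\<exists>m\<ge>0. 5 * \<Lambda> * m + N / (2 * pi * (A - 2)\<^sup>2) \<le> C\<^sub>1 * N \<and>
       (\<forall>\<delta> B. 0 < \<delta> \<longrightarrow> B \<in> sets borel \<longrightarrow> emeasure lborel B \<le> ennreal (4 * pi * ((A + 1) * \<epsilon>)\<^sup>2) \<longrightarrow>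
         (\<integral>\<^sup>+x. ennreal \<bar>conv (rescale j \<delta>) \<omega> x\<bar> * indicator B x \<partial>lborel) \<le> ennreal m)"
    proof (intro exI[of _ "M * a + \<eta>"] conjI allI impI)
      show "0 \<le> M * a + \<eta>" using M(1) a \<eta> by simp
      show "5 * \<Lambda> * (M * a + \<eta>) + N / (2 * pi * (A - 2)\<^sup>2) \<le> C\<^sub>1 * N"
        using 1 2 far by (simp add: distrib_left)
      fix \<delta> :: real and B :: "plane set" assume \<delta>: "0 < \<delta>" and B: "B \<in> sets borel"
        and Ba: "emeasure lborel B \<le> ennreal (4 * pi * ((A + 1) * \<epsilon>)\<^sup>2)"
      have "(\<integral>\<^sup>+x. ennreal \<bar>conv (rescale j \<delta>) \<omega> x\<bar> * indicator B x \<partial>lborel) \<le> ennreal M * emeasure lborel B + ennreal \<eta>"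
        by (rule M(2)[OF \<delta> B])
      also have "\<dots> \<le> ennreal M * ennreal a + ennreal \<eta>"
        using Ba unfolding a_def by (intro add_right_mono mult_left_mono) auto
      also have "\<dots> = ennreal (M * a + \<eta>)" using M(1) a \<eta> by (simp add: ennreal_mult)
      finally show "(\<integral>\<^sup>+x. ennreal \<bar>conv (rescale j \<delta>) \<omega> x\<bar> * indicator B x \<partial>lborel) \<le> ennreal (M * a + \<eta>)" .
    qed
  qed
qed


section \<open>Constants uniform in the scale, and the conclusion\<close>

theorem lemma3p1:
  fixes j \<phi> \<omega>\<^sub>0 :: "plane \<Rightarrow> real"
    and T C\<^sub>1 :: real
    and \<delta> h :: "real \<Rightarrow> real"
    and w :: "real \<Rightarrow> plane \<Rightarrow> real"
    and X :: "real \<Rightarrow> plane \<Rightarrow> real \<Rightarrow> plane"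
    and \<omega>bar :: "real \<Rightarrow> real \<Rightarrow> plane \<Rightarrow> real"
  assumes "T > 0"
    and "mollifier j" and "mollifier \<phi>"
    and "integrable lebesgue \<omega>\<^sub>0"
    and "\<exists>S. compact S \<and> (AE x in lebesgue. x \<notin> S \<longrightarrow> \<omega>\<^sub>0 x = 0)"
    and "\<forall>\<epsilon>\<in>{0<..<1}. \<delta> \<epsilon> \<in> {0<..<1}"
    and "C\<^sub>1 > 0"
    and "\<forall>\<epsilon>\<in>{0<..<1}. h \<epsilon> = \<epsilon> ^ 4 / exp (C\<^sub>1 * \<epsilon> powr (-2) * enn2real (Lp_norm 1 \<omega>\<^sub>0) * T)"
    and "\<forall>\<epsilon>\<in>{0<..<1}. w \<epsilon> = conv (rescale j (\<delta> \<epsilon>)) \<omega>\<^sub>0"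
    and "\<forall>\<epsilon>\<in>{0<..<1}. blob_trajectories \<phi> \<epsilon> (h \<epsilon>) (w \<epsilon>) T (X \<epsilon>)"
    and "\<forall>\<epsilon>\<in>{0<..<1}.
           transport_solution T (blob_velocity \<phi> \<epsilon> (h \<epsilon>) (w \<epsilon>) (X \<epsilon>)) (w \<epsilon>) (\<omega>bar \<epsilon>)"
  shows "\<exists>C>0. \<forall>\<epsilon>\<in>{0<..<1}. \<forall>p::ennreal. 1 \<le> p \<longrightarrow>
           (SUP t\<in>{0..T}. Lp_norm p (\<lambda>x. blob_vorticity \<phi> \<epsilon> (h \<epsilon>) (w \<epsilon>) (X \<epsilon>) t x
                                          - conv (rescale \<phi> \<epsilon>) (\<omega>bar \<epsilon> t) x))
             \<le> ennreal (C * \<epsilon> powr (1 + enn2real (2 / p)))"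
proof -
  define N where "N = enn2real (Lp_norm 1 \<omega>\<^sub>0)"
  have N0: "0 \<le> N" by (simp add: N_def)
  obtain \<Lambda> where \<Lambda>: "0 \<le> \<Lambda>" "\<And>x y. \<bar>\<phi> x - \<phi> y\<bar> \<le> \<Lambda> * norm (x - y)"
    using mollifier_lipschitz[OF assms(3)] by blast
  obtain S where "compact S" and S: "AE x in lebesgue. x \<notin> S \<longrightarrow> \<omega>\<^sub>0 x = 0" using assms(5) by blast
  then obtain R where R: "\<And>x. x \<in> S \<Longrightarrow> norm x \<le> R" using compact_imp_bounded bounded_iff by metis
  have supp: "AE x in lebesgue. R < norm x \<longrightarrow> \<omega>\<^sub>0 x = 0"
    using S by eventually_elim (use R in \<open>auto simp: not_le[symmetric]\<close>)
  have h_eq: "h \<epsilon> = \<epsilon> ^ 4 * exp (- (C\<^sub>1 * N / \<epsilon>\<^sup>2) * T)" if "\<epsilon> \<in> {0<..<1}" for \<epsilon>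
    using that bspec[OF assms(8) that]
    by (simp add: N_def powr_minus exp_minus field_simps powr_numeral)
  have ex_flow: "\<exists>V. blob_flow \<phi> (w \<epsilon>) \<epsilon> (h \<epsilon>) T \<Lambda> N (X \<epsilon>) (\<omega>bar \<epsilon>) V" if \<epsilon>: "\<epsilon> \<in> {0<..<1}" for \<epsilon>
  proof -
    have sol: "transport_solution T (blob_velocity \<phi> \<epsilon> (h \<epsilon>) (w \<epsilon>) (X \<epsilon>)) (w \<epsilon>) (\<omega>bar \<epsilon>)"
      using assms(11) \<epsilon> by blast
    have \<delta>: "0 < \<delta> \<epsilon>" "\<delta> \<epsilon> < 1" and w: "w \<epsilon> = conv (rescale j (\<delta> \<epsilon>)) \<omega>\<^sub>0" using assms(6,9) \<epsilon> by auto
    \<comment> \<open>Continuity of the mollified vorticity is read off from the transport solution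
      at time 0, which is smooth by hypothesis.\<close>
    have "Ck_on 0 (\<lambda>(t, x). \<omega>bar \<epsilon> t x) ({0..T} \<times> UNIV)"
      using sol unfolding transport_solution_def smooth_on_def by blast
    then have "continuous_on UNIV ((\<lambda>(t, x). \<omega>bar \<epsilon> t x) \<circ> (\<lambda>x. (0, x)))"
      by (intro continuous_on_compose) (use assms(1) in \<open>auto intro!: continuous_intros elim: continuous_on_subset\<close>)
    moreover have "(\<lambda>(t, x). \<omega>bar \<epsilon> t x) \<circ> (\<lambda>x. (0, x)) = w \<epsilon>"
      using sol by (simp add: transport_solution_def fun_eq_iff)
    ultimately have "continuous_on UNIV (w \<epsilon>)" by simp
    then have tw: "test_fun (w \<epsilon>)"
      unfolding test_fun_def using mollified_support[OF assms(2) \<delta> supp] w by (intro conjI exI[of _ "R + 1"]) auto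
    have "blob_setup \<phi> (w \<epsilon>) \<epsilon> (h \<epsilon>) T \<Lambda> N (X \<epsilon>) (\<omega>bar \<epsilon>)"
    proof
      show "0 < h \<epsilon>" using h_eq[OF \<epsilon>] \<epsilon> by simp
      show "(\<integral>\<^sup>+y. ennreal \<bar>w \<epsilon> y\<bar> \<partial>lborel) \<le> ennreal N"
        unfolding w N_def by (rule mollified_mass[OF assms(2,4) \<delta>(1)])
      show "blob_trajectories \<phi> \<epsilon> (h \<epsilon>) (w \<epsilon>) T (X \<epsilon>)" using assms(10) \<epsilon> by blast
    qed (use assms(1,3) \<epsilon> \<Lambda> N0 tw sol in auto)
    then interpret blob_setup \<phi> "w \<epsilon>" \<epsilon> "h \<epsilon>" T \<Lambda> N "X \<epsilon>" "\<omega>bar \<epsilon>" .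
    obtain V where "div_free_field (blob_velocity \<phi> \<epsilon> (h \<epsilon>) (w \<epsilon>) (X \<epsilon>)) T (5 * \<Lambda> * N / \<epsilon>\<^sup>2 + 1) V"
      using velocity_field by blast
    then have "blob_flow \<phi> (w \<epsilon>) \<epsilon> (h \<epsilon>) T \<Lambda> N (X \<epsilon>) (\<omega>bar \<epsilon>) V"
      by (intro blob_flow.intro) (rule blob_setup_axioms)
    then show ?thesis by blast
  qed
  \<comment> \<open>\<open>c\<close> must precede \<epsilon>, so the flow is named outside its
    locale; it depends on the field and \<open>T\<close> but not on the speed bound
    \<open>V\<close>.\<close>
  have "\<exists>c. \<forall>\<epsilon>\<in>{0<..<1}. \<forall>V. blob_flow \<phi> (w \<epsilon>) \<epsilon> (h \<epsilon>) T \<Lambda> N (X \<epsilon>) (\<omega>bar \<epsilon>) V \<longrightarrow>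
      (\<forall>t\<in>{0..T}. \<forall>y. norm (lipschitz_field.flow (blob_velocity \<phi> \<epsilon> (h \<epsilon>) (w \<epsilon>) (X \<epsilon>)) T (tile (h \<epsilon>) y) t
        - lipschitz_field.flow (blob_velocity \<phi> \<epsilon> (h \<epsilon>) (w \<epsilon>) (X \<epsilon>)) T y t) \<le> c * \<epsilon> ^ 4)"
  proof -
    obtain \<epsilon>\<^sub>0 A where \<epsilon>\<^sub>0: "0 < \<epsilon>\<^sub>0" "2 < A" and rate:
      "\<And>\<epsilon>. 0 < N \<Longrightarrow> 0 < \<epsilon> \<Longrightarrow> \<epsilon> < \<epsilon>\<^sub>0 \<Longrightarrow> \<exists>m\<ge>0. 5 * \<Lambda> * m + N / (2 * pi * (A - 2)\<^sup>2) \<le> C\<^sub>1 * N \<and>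
       (\<forall>\<delta> B. 0 < \<delta> \<longrightarrow> B \<in> sets borel \<longrightarrow> emeasure lborel B \<le> ennreal (4 * pi * ((A + 1) * \<epsilon>)\<^sup>2) \<longrightarrow>
         (\<integral>\<^sup>+x. ennreal \<bar>conv (rescale j \<delta>) \<omega>\<^sub>0 x\<bar> * indicator B x \<partial>lborel) \<le> ennreal m)"
    proof (cases "0 < N")
      case True
      show ?thesis by (rule small_scale_rate[OF assms(2,4) \<Lambda>(1) True assms(7)]) (rule that)
    next
      \<comment> \<open>Zero mass makes the rate claim vacuous; 1 and 3 are arbitrary admissible
        values, and the crude estimate takes over.\<close>
      case False then show ?thesis by (intro that[of 1 3]) auto
    qed
    \<comment> \<open>The crude growth factor at \<open>\<epsilon>\<^sub>0\<close> bounds those at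
      all larger scales; being at least 1 it also covers the smaller ones.\<close>
    define c where "c = exp ((5 * \<Lambda> * N / \<epsilon>\<^sub>0\<^sup>2 + 1) * T)"
    have c1: "1 \<le> c" using \<Lambda> N0 assms(1) by (simp add: c_def)
    show ?thesis
    proof (intro exI[of _ c] ballI allI impI)
      fix \<epsilon> V t y
      assume \<epsilon>: "\<epsilon> \<in> {0<..<1}" and bf: "blob_flow \<phi> (w \<epsilon>) \<epsilon> (h \<epsilon>) T \<Lambda> N (X \<epsilon>) (\<omega>bar \<epsilon>) V" and t: "t \<in> {0..T}"
      interpret blob_flow \<phi> "w \<epsilon>" \<epsilon> "h \<epsilon>" T \<Lambda> N "X \<epsilon>" "\<omega>bar \<epsilon>" V by (rule bf)
      show "norm (flow (tile (h \<epsilon>) y) t - flow y t) \<le> c * \<epsilon> ^ 4"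
      proof (cases "0 < N \<and> \<epsilon> < \<epsilon>\<^sub>0")
        case True
        obtain m where m: "0 \<le> m" "5 * \<Lambda> * m + N / (2 * pi * (A - 2)\<^sup>2) \<le> C\<^sub>1 * N"
          "\<And>\<delta> B. 0 < \<delta> \<Longrightarrow> B \<in> sets borel \<Longrightarrow> emeasure lborel B \<le> ennreal (4 * pi * ((A + 1) * \<epsilon>)\<^sup>2) \<Longrightarrow>
            (\<integral>\<^sup>+x. ennreal \<bar>conv (rescale j \<delta>) \<omega>\<^sub>0 x\<bar> * indicator B x \<partial>lborel) \<le> ennreal m"
          using rate[of \<epsilon>] True \<epsilon> by auto
        have \<delta>: "0 < \<delta> \<epsilon>" and w: "w \<epsilon> = conv (rescale j (\<delta> \<epsilon>)) \<omega>\<^sub>0" using assms(6,9) \<epsilon> by auto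
        have he: "h \<epsilon> * exp (C\<^sub>1 * N / \<epsilon>\<^sup>2 * T) = \<epsilon> ^ 4"
          unfolding h_eq[OF \<epsilon>] by (simp add: exp_minus)
        have e4: "\<epsilon> ^ 4 < \<epsilon>" using power_strict_decreasing[of 1 4 \<epsilon>] \<epsilon> by simp
        have "norm (flow (tile (h \<epsilon>) y) t - flow y t) \<le> h \<epsilon> * exp (C\<^sub>1 * N / \<epsilon>\<^sup>2 * T)"
        proof (rule tile_distance_improved[OF t \<epsilon>\<^sub>0(2) m(1)])
          fix B :: "plane set"
          assume "B \<in> sets borel" "emeasure lborel B \<le> ennreal (4 * pi * ((A + 1) * \<epsilon>)\<^sup>2)"
          then show "(\<integral>\<^sup>+y. ennreal \<bar>w \<epsilon> y\<bar> * indicator B y \<partial>lborel) \<le> ennreal m"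
            unfolding w by (rule m(3)[OF \<delta>])
        next
          show "(5 * \<Lambda> * m + N / (2 * pi * (A - 2)\<^sup>2)) / \<epsilon>\<^sup>2 \<le> C\<^sub>1 * N / \<epsilon>\<^sup>2"
            by (intro divide_right_mono m) auto
          show "h \<epsilon> * exp (C\<^sub>1 * N / \<epsilon>\<^sup>2 * T) < \<epsilon>" using he e4 by simp
        qed
        also have "\<dots> = 1 * \<epsilon> ^ 4" using he by simp
        also have "\<dots> \<le> c * \<epsilon> ^ 4" using c1 \<epsilon> by (intro mult_right_mono) auto
        finally show ?thesis .
      next
        case False
        have "5 * \<Lambda> * N / \<epsilon>\<^sup>2 \<le> 5 * \<Lambda> * N / \<epsilon>\<^sub>0\<^sup>2"
        proof (cases "0 < N")
          case True
          then have "\<epsilon>\<^sub>0 \<le> \<epsilon>" using False by simp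
          then show ?thesis using \<Lambda>(2) N0 \<epsilon>\<^sub>0(1) by (intro divide_left_mono power_mono mult_pos_pos mult_nonneg_nonneg) auto
        next
          case False then show ?thesis using N0 by simp
        qed
        then have "exp ((5 * \<Lambda> * N / \<epsilon>\<^sup>2 + 1) * T) \<le> c"
          unfolding c_def using assms(1) by (simp add: mult_right_mono)
        moreover have "h \<epsilon> \<le> \<epsilon> ^ 4"
          unfolding h_eq[OF \<epsilon>] using \<epsilon> assms(1,7) N0 by (intro mult_left_le) auto
        ultimately have "h \<epsilon> * exp ((5 * \<Lambda> * N / \<epsilon>\<^sup>2 + 1) * T) \<le> \<epsilon> ^ 4 * c"
          using \<epsilon> by (intro mult_mono) auto
        then show ?thesis using tile_distance_crude[OF t, of y] by (simp add: mult.commute)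
      qed
    qed
  qed
  then obtain c where c: "\<And>\<epsilon> V t y. \<epsilon> \<in> {0<..<1} \<Longrightarrow> blob_flow \<phi> (w \<epsilon>) \<epsilon> (h \<epsilon>) T \<Lambda> N (X \<epsilon>) (\<omega>bar \<epsilon>) V \<Longrightarrow>
      t \<in> {0..T} \<Longrightarrow> norm (lipschitz_field.flow (blob_velocity \<phi> \<epsilon> (h \<epsilon>) (w \<epsilon>) (X \<epsilon>)) T (tile (h \<epsilon>) y) t
        - lipschitz_field.flow (blob_velocity \<phi> \<epsilon> (h \<epsilon>) (w \<epsilon>) (X \<epsilon>)) T y t) \<le> c * \<epsilon> ^ 4"
    by blast
  \<comment> \<open>No sign of \<open>c\<close> is recorded in the existence claim, so positivity is
    enforced by the maximum.\<close>
  define C where "C = max 1 (2 * pi * \<Lambda> * N * c + 1)"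
  show ?thesis
  proof (intro exI[of _ C] conjI ballI allI impI)
    show "0 < C" by (simp add: C_def)
    fix \<epsilon> :: real and p :: ennreal assume \<epsilon>: "\<epsilon> \<in> {0<..<1}" and p: "1 \<le> p"
    obtain V where bf: "blob_flow \<phi> (w \<epsilon>) \<epsilon> (h \<epsilon>) T \<Lambda> N (X \<epsilon>) (\<omega>bar \<epsilon>) V" using ex_flow[OF \<epsilon>] by blast
    interpret blob_flow \<phi> "w \<epsilon>" \<epsilon> "h \<epsilon>" T \<Lambda> N "X \<epsilon>" "\<omega>bar \<epsilon>" V by (rule bf)
    show "(SUP t\<in>{0..T}. Lp_norm p (\<lambda>x. blob_vorticity \<phi> \<epsilon> (h \<epsilon>) (w \<epsilon>) (X \<epsilon>) t x
        - conv (rescale \<phi> \<epsilon>) (\<omega>bar \<epsilon> t) x)) \<le> ennreal (C * \<epsilon> powr (1 + enn2real (2 / p)))"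
    proof (rule SUP_least)
      fix t assume t: "t \<in> {0..T}"
      have "Lp_norm p (err t) \<le> ennreal ((2 * pi * \<Lambda> * N * c + 1) * \<epsilon> powr (1 + enn2real (2 / p)))"
        by (rule err_Lp[OF t c[OF \<epsilon> bf t] p])
      also have "\<dots> \<le> ennreal (C * \<epsilon> powr (1 + enn2real (2 / p)))"
        by (intro ennreal_leI mult_right_mono) (auto simp: C_def)
      finally show "Lp_norm p (\<lambda>x. blob_vorticity \<phi> \<epsilon> (h \<epsilon>) (w \<epsilon>) (X \<epsilon>) t x
        - conv (rescale \<phi> \<epsilon>) (\<omega>bar \<epsilon> t) x) \<le> ennreal (C * \<epsilon> powr (1 + enn2real (2 / p)))"
        by (simp add: err_def[abs_def])
    qed
  qed
qed

end
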